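(* Let $k$ be an algebraically closed field of characteristic zero and let $q\in k$ be non-zero and not a root of unity. For every $\ell\in\frac12\mathbb{N}_0$, the Frobenius--Schur indicator of the simple right $\mathcal{O}_q(SL_2)$-comodule $X_\ell$ (with respect to the copivotal structure $\gamma$) is $$\nu(X_\ell)=(-1)^{2\ell}.$$
   Context: $\mathbb{N}_0=\{0,1,2,\dots\}$. $\mathcal{O}_q(SL_2)$ is the Hopf algebra generated as an algebra by $a,b,c,d$ with relations $ab=qba$, $ac=qca$, $bd=qdb$, $cd=qdc$, $bc=cb$, $ad-qbc=1=da-q^{-1}bc$; comultiplication $\Delta(a)=a\otimes a+b\otimes c$, $\Delta(b)=a\otimes b+b\otimes d$, $\Delta(c)=c\otimes a+d\otimes c$, $\Delta(d)=c\otimes b+d\otimes d$; counit $\varepsilon(a)=\varepsilon(d)=1$, $\varepsilon(b)=\varepsilon(c)=0$; antipode $S(a)=d$, $S(b)=-q^{-1}b$, $S(c)=-qc$, $S(d)=a$. Let $\gamma:\mathcal{O}_q(SL_2)\to k$ be the algebra map with $\gamma(a)=q^{-1}$, $\gamma(b)=\gamma(c)=0$, $\gamma(d)=q$; then $S^2(x)=\gamma(x_{(1)})\,x_{(2)}\,\gamma(S(x_{(3)}))$ for all $x$. For $\ell\in\frac12\mathbb{N}_0$ let $I_\ell=\{-\ell,-\ell+1,\dots,\ell\}$ and $X_\ell=\mathrm{span}_k\{a^{\ell-i}b^{\ell+i}\mid i\in I_\ell\}\subset\mathcal{O}_q(SL_2)$, a right coideal, hence a right $\mathcal{O}_q(SL_2)$-comodule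 via $\Delta$. The $X_\ell$ form a complete set of representatives of simple right $\mathcal{O}_q(SL_2)$-comodules. For a finite-dimensional right comodule $V$ over $C=\mathcal{O}_q(SL_2)$ with coaction $v\mapsto v_{(0)}\otimes v_{(1)}$, the dual space $V^\vee$ is a right comodule by $\langle f_{(0)},v\rangle f_{(1)}=\langle f,v_{(0)}\rangle S(v_{(1)})$, and $j_V:V\to V^{\vee\vee}$, $\langle j_V(v),f\rangle=\langle f,v_{(0)}\rangle\gamma(v_{(1)})$, is a comodule isomorphism. The Frobenius--Schur indicator $\nu(V)\in k$ is the trace of the linear map $\mathrm{Hom}_C(V,V^\vee)\to\mathrm{Hom}_C(V,V^\vee)$, $f\mapsto f^\vee\circ j_V$, where $f^\vee$ is the transpose of $f$. *)

theory Defs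
  imports
    "HOL-Computational_Algebra.Polynomial"
    "HOL-Library.Poly_Mapping"
    "HOL-Library.Function_Algebras"
begin

text \<open>
  All vector spaces over \<open>'k\<close> below are subspaces of full function spaces \<open>'x \<Rightarrow> 'k\<close> with pointwise
  operations. Duals, tensor products and the algebra \<open>O_q(SL_2)\<close> are then again of this form. Maps
  between subspaces are represented by HOL functions on the ambient types; where a set of maps is
  itself used as a vector space, its elements are normalised to be 0 outside their domain.
\<close>

definition scl :: "'k::field \<Rightarrow> ('x \<Rightarrow> 'k) \<Rightarrow> 'x \<Rightarrow> 'k"
  where "scl c v = (\<lambda>x. c * v x)"

interpretation fs: vector_space "scl :: 'k::field \<Rightarrow> ('x \<Rightarrow> 'k) \<Rightarrow> 'x \<Rightarrow> 'k"
  by unfold_locales (auto simp: scl_def algebra_simps fun_eq_iff)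

definition mscl :: "'k::field \<Rightarrow> ('v \<Rightarrow> 'y \<Rightarrow> 'k) \<Rightarrow> 'v \<Rightarrow> 'y \<Rightarrow> 'k"
  where "mscl c f = (\<lambda>v. scl c (f v))"

interpretation ms: vector_space "mscl :: 'k::field \<Rightarrow> ('v \<Rightarrow> 'y \<Rightarrow> 'k) \<Rightarrow> 'v \<Rightarrow> 'y \<Rightarrow> 'k"
  by unfold_locales (auto simp: mscl_def scl_def algebra_simps fun_eq_iff)

definition linear_on :: "('x \<Rightarrow> 'k::field) set \<Rightarrow> (('x \<Rightarrow> 'k) \<Rightarrow> 'y \<Rightarrow> 'k) \<Rightarrow> bool"
  where "linear_on V f \<longleftrightarrow>
    (\<forall>v\<in>V. \<forall>w\<in>V. f (v + w) = f v + f w) \<and> (\<forall>c. \<forall>v\<in>V. f (scl c v) = scl c (f v))"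

definition form_on :: "('x \<Rightarrow> 'k::field) set \<Rightarrow> (('x \<Rightarrow> 'k) \<Rightarrow> 'k) \<Rightarrow> bool"
  where "form_on V \<phi> \<longleftrightarrow>
    (\<forall>v\<in>V. \<forall>w\<in>V. \<phi> (v + w) = \<phi> v + \<phi> w) \<and> (\<forall>c. \<forall>v\<in>V. \<phi> (scl c v) = c * \<phi> v)"

definition dual :: "('x \<Rightarrow> 'k::field) set \<Rightarrow> (('x \<Rightarrow> 'k) \<Rightarrow> 'k) set"
  where "dual V = {\<phi>. form_on V \<phi> \<and> (\<forall>v. v \<notin> V \<longrightarrow> \<phi> v = 0)}"

definition transpose_on ::
  "('x \<Rightarrow> 'k::field) set \<Rightarrow> (('x \<Rightarrow> 'k) \<Rightarrow> 'y \<Rightarrow> 'k) \<Rightarrow> (('y \<Rightarrow> 'k) \<Rightarrow> 'k) \<Rightarrow> ('x \<Rightarrow> 'k) \<Rightarrow> 'k"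
  where "transpose_on V f \<phi> = (\<lambda>v. if v \<in> V then \<phi> (f v) else 0)"

text \<open>
  Trace of an endomorphism of a finite-dimensional space of maps; it does not depend on the
  basis chosen.
\<close>

definition trace_on ::
  "('v \<Rightarrow> 'y \<Rightarrow> 'k::field) set \<Rightarrow> (('v \<Rightarrow> 'y \<Rightarrow> 'k) \<Rightarrow> 'v \<Rightarrow> 'y \<Rightarrow> 'k) \<Rightarrow> 'k"
  where "trace_on E T =
    (let B = (SOME B. ms.independent B \<and> ms.span B = E)
     in \<Sum>b\<in>B. ms.representation B (T b) b)"

definition bilinear_forms ::
  "('x \<Rightarrow> 'k::field) set \<Rightarrow> ('y \<Rightarrow> 'k) set \<Rightarrow> (('x \<Rightarrow> 'k) \<Rightarrow> ('y \<Rightarrow> 'k) \<Rightarrow> 'k) set"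
  where "bilinear_forms V W =
    {B. (\<forall>v\<in>V. form_on W (\<lambda>w. B v w)) \<and> (\<forall>w\<in>W. form_on V (\<lambda>v. B v w))}"

text \<open>
  An elementary tensor is the functional \<open>B \<mapsto> B(v,w)\<close> on bilinear forms, and \<open>V \<otimes> W\<close> is the span of
  the elementary tensors. Over a field, a sum of elementary tensors is 0 in the usual tensor
  product iff all bilinear forms vanish on it.
\<close>

type_synonym ('x, 'y, 'k) tensor = "(('x \<Rightarrow> 'k) \<Rightarrow> ('y \<Rightarrow> 'k) \<Rightarrow> 'k) \<Rightarrow> 'k"

definition tens ::
  "('x \<Rightarrow> 'k::field) set \<Rightarrow> ('y \<Rightarrow> 'k) set \<Rightarrow> ('x \<Rightarrow> 'k) \<Rightarrow> ('y \<Rightarrow> 'k) \<Rightarrow> ('x, 'y, 'k) tensor"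
  where "tens V W v w = (\<lambda>B. if B \<in> bilinear_forms V W then B v w else 0)"

definition tensor_space ::
  "('x \<Rightarrow> 'k::field) set \<Rightarrow> ('y \<Rightarrow> 'k) set \<Rightarrow> ('x, 'y, 'k) tensor set"
  where "tensor_space V W = fs.span {tens V W v w | v w. v \<in> V \<and> w \<in> W}"

text \<open>
  \<open>tlift b\<close> is the linear map on \<open>V \<otimes> W\<close> induced by a bilinear map \<open>b\<close>; in Sweedler notation
  \<open>tlift b (\<rho> v)\<close> is \<open>b(v_(0), v_(1))\<close>. It works because evaluation at a point is linear. For scalar-valued
  \<open>b\<close> the corresponding value is simply \<open>t b\<close>.
\<close>

definition tlift ::
  "(('x \<Rightarrow> 'k::field) \<Rightarrow> ('y \<Rightarrow> 'k) \<Rightarrow> 'z \<Rightarrow> 'k) \<Rightarrow> ('x, 'y, 'k) tensor \<Rightarrow> 'z \<Rightarrow> 'k"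
  where "tlift b t = (\<lambda>z. t (\<lambda>v w. b v w z))"

lemma tlift_tens:
  assumes "\<And>v. v \<in> V \<Longrightarrow> linear_on W (b v)"
    and "\<And>w. w \<in> W \<Longrightarrow> linear_on V (\<lambda>v. b v w)"
  shows "tlift b (tens V W v w) = b v w"
proof -
  have "(\<lambda>v w. b v w z) \<in> bilinear_forms V W" for z
    using assms by (auto simp: bilinear_forms_def form_on_def linear_on_def scl_def)
  then show ?thesis by (simp add: tlift_def tens_def)
qed

record ('h, 'k) hopf =
  alg :: "('h \<Rightarrow> 'k) set"
  mult :: "('h \<Rightarrow> 'k) \<Rightarrow> ('h \<Rightarrow> 'k) \<Rightarrow> 'h \<Rightarrow> 'k"
  unit :: "'h \<Rightarrow> 'k"
  comult :: "('h \<Rightarrow> 'k) \<Rightarrow> ('h, 'h, 'k) tensor"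
  counit :: "('h \<Rightarrow> 'k) \<Rightarrow> 'k"
  antipode :: "('h \<Rightarrow> 'k) \<Rightarrow> 'h \<Rightarrow> 'k"

record ('x, 'h, 'k) comodule =
  space :: "('x \<Rightarrow> 'k) set"
  coact :: "('x \<Rightarrow> 'k) \<Rightarrow> ('x, 'h, 'k) tensor"

text \<open>A right coideal \<open>V\<close>, with the comultiplication corestricted to \<open>V \<otimes> H\<close>.\<close>

definition coideal_comodule ::
  "('h, 'k::field) hopf \<Rightarrow> ('h \<Rightarrow> 'k) set \<Rightarrow> ('h, 'h, 'k) comodule"
  where "coideal_comodule H V =
    \<lparr> space = V,
      coact = (\<lambda>v. THE t. t \<in> tensor_space V (alg H)
        \<and> tlift (tens (alg H) (alg H)) t = comult H v) \<rparr>"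

definition dual_comodule ::
  "('h, 'k::field) hopf \<Rightarrow> ('x, 'h, 'k) comodule \<Rightarrow> ('x \<Rightarrow> 'k, 'h, 'k) comodule"
  where "dual_comodule H M =
    \<lparr> space = dual (space M),
      coact = (\<lambda>f. THE t. t \<in> tensor_space (dual (space M)) (alg H)
        \<and> (\<forall>v\<in>space M. tlift (\<lambda>g h. scl (g v) h) t
                        = tlift (\<lambda>w h. scl (f w) (antipode H h)) (coact M v))) \<rparr>"

definition comodule_hom ::
  "('h, 'k::field) hopf \<Rightarrow> ('x, 'h, 'k) comodule \<Rightarrow> ('y, 'h, 'k) comodule
    \<Rightarrow> (('x \<Rightarrow> 'k) \<Rightarrow> 'y \<Rightarrow> 'k) set"
  where "comodule_hom H M N =
    {f. linear_on (space M) f \<and> f ` space M \<subseteq> space N \<and> (\<forall>v. v \<notin> space M \<longrightarrow> f v = 0)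
      \<and> (\<forall>v\<in>space M. coact N (f v)
            = tlift (\<lambda>w h. tens (space N) (alg H) (f w) h) (coact M v))}"

definition copivotal_map ::
  "(('h \<Rightarrow> 'k) \<Rightarrow> 'k) \<Rightarrow> ('x, 'h, 'k::field) comodule \<Rightarrow> ('x \<Rightarrow> 'k) \<Rightarrow> (('x \<Rightarrow> 'k) \<Rightarrow> 'k) \<Rightarrow> 'k"
  where "copivotal_map \<gamma> M v =
    (\<lambda>f. if f \<in> dual (space M) then coact M v (\<lambda>w h. f w * \<gamma> h) else 0)"

definition fs_indicator ::
  "('h, 'k::field) hopf \<Rightarrow> (('h \<Rightarrow> 'k) \<Rightarrow> 'k) \<Rightarrow> ('x, 'h, 'k) comodule \<Rightarrow> 'k"
  where "fs_indicator H \<gamma> M =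
    trace_on (comodule_hom H M (dual_comodule H M))
      (\<lambda>f v. if v \<in> space M then transpose_on (space M) f (copivotal_map \<gamma> M v) else 0)"

datatype gen = Ga | Gb | Gc | Gd

datatype word = Word (letters: "gen list")

instantiation word :: monoid_add
begin

definition zero_word where "0 = Word []"
definition plus_word where "u + v = Word (letters u @ letters v)"

instance by standard (auto simp: zero_word_def plus_word_def)

end

text \<open>With \<open>word\<close> as an additive monoid, multiplication of \<open>poly_mapping\<close> is convolution.\<close>

type_synonym 'k free_alg = "word \<Rightarrow>\<^sub>0 'k"

definition var :: "gen \<Rightarrow> 'k::field free_alg"
  where "var g = Poly_Mapping.single (Word [g]) 1"

definition fscl :: "'k::field \<Rightarrow> 'k free_alg \<Rightarrow> 'k free_alg"
  where "fscl c x = Poly_Mapping.single 0 c * x"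

text \<open>
  Algebra map out of the free algebra, for a target with scalar multiplication \<open>s\<close>,
  multiplication \<open>m\<close>, unit \<open>e\<close>, and given images of the generators.
\<close>

definition free_lift ::
  "('k::field \<Rightarrow> 'a::comm_monoid_add \<Rightarrow> 'a) \<Rightarrow> ('a \<Rightarrow> 'a \<Rightarrow> 'a) \<Rightarrow> 'a \<Rightarrow> (gen \<Rightarrow> 'a) \<Rightarrow> 'k free_alg \<Rightarrow> 'a"
  where "free_lift s m e \<eta> x =
    (\<Sum>w\<in>Poly_Mapping.keys x. s (Poly_Mapping.lookup x w) (foldr (\<lambda>g. m (\<eta> g)) (letters w) e))"

definition relators :: "'k::field \<Rightarrow> 'k free_alg set"
  where "relators q =
    (let a = var Ga; b = var Gb; c = var Gc; d = var Gd in
      { a * b - fscl q (b * a),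
        a * c - fscl q (c * a),
        b * d - fscl q (d * b),
        c * d - fscl q (d * c),
        b * c - c * b,
        a * d - fscl q (b * c) - 1,
        d * a - fscl (inverse q) (b * c) - 1 })"

inductive_set rel_ideal :: "'k::field \<Rightarrow> 'k free_alg set" for q :: 'k
  where
    rel_ideal_zero: "0 \<in> rel_ideal q"
  | rel_ideal_rel: "r \<in> relators q \<Longrightarrow> u * r * v \<in> rel_ideal q"
  | rel_ideal_add: "x \<in> rel_ideal q \<Longrightarrow> y \<in> rel_ideal q \<Longrightarrow> x + y \<in> rel_ideal q"

text \<open>
  The quotient of the free algebra by \<open>rel_ideal q\<close>, as a subspace of a function space: the class
  of \<open>x\<close> is represented by evaluation at \<open>x\<close> on the linear forms that vanish on the ideal. That this
  is the quotient is lemma \<open>cls_eq_iff\<close>.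
\<close>

definition annihilator :: "'k::field \<Rightarrow> ('k free_alg \<Rightarrow> 'k) set"
  where "annihilator q =
    {\<phi>. (\<forall>x y. \<phi> (x + y) = \<phi> x + \<phi> y) \<and> (\<forall>c x. \<phi> (fscl c x) = c * \<phi> x) \<and> (\<forall>x\<in>rel_ideal q. \<phi> x = 0)}"

type_synonym 'k Oq_index = "'k free_alg \<Rightarrow> 'k"

definition cls :: "'k::field \<Rightarrow> 'k free_alg \<Rightarrow> 'k Oq_index \<Rightarrow> 'k"
  where "cls q x = (\<lambda>\<phi>. if \<phi> \<in> annihilator q then \<phi> x else 0)"

lemma cls_add: "cls q (x + y) = cls q x + cls q y"
  by (auto simp: cls_def annihilator_def fun_eq_iff)

lemma cls_scl: "cls q (fscl c x) = scl c (cls q x)"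
  by (auto simp: cls_def annihilator_def fun_eq_iff scl_def)

interpretation fa: vector_space "fscl :: 'k::field \<Rightarrow> 'k free_alg \<Rightarrow> 'k free_alg"
  by unfold_locales
    (auto simp: fscl_def algebra_simps single_add mult_single simp flip: mult.assoc)

lemma rel_ideal_mult:
  assumes "x \<in> rel_ideal q"
  shows "u * x * v \<in> rel_ideal q"
  using assms
proof induction
  case (rel_ideal_rel r u' v')
  then have "(u * u') * r * (v' * v) \<in> rel_ideal q" by (rule rel_ideal.rel_ideal_rel)
  then show ?case by (simp add: mult.assoc)
qed (auto simp: algebra_simps intro: rel_ideal.intros)

lemma subspace_rel_ideal: "fa.subspace (rel_ideal q)"
proof (rule fa.subspaceI)
  fix c x assume "x \<in> rel_ideal q"
  from rel_ideal_mult[OF this, of "Poly_Mapping.single 0 c" 1]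
  show "fscl c x \<in> rel_ideal q" by (simp add: fscl_def)
qed (auto intro: rel_ideal.intros)

lemma cls_eq_iff: "cls q x = cls q y \<longleftrightarrow> x - y \<in> rel_ideal q"
proof
  assume eq: "cls q x = cls q y"
  show "x - y \<in> rel_ideal q"
  proof (rule ccontr)
    assume nin: "x - y \<notin> rel_ideal q"
    obtain B where B: "B \<subseteq> rel_ideal q" "fa.independent B" "rel_ideal q \<subseteq> fa.span B"
      using fa.maximal_independent_subset by metis
    have sp: "fa.span B = rel_ideal q"
      using B subspace_rel_ideal fa.span_minimal by blast
    have indep: "fa.independent (insert (x - y) B)"
      using B nin sp by (simp add: fa.independent_insert)
    interpret sc: vector_space "(*) :: 'a \<Rightarrow> 'a \<Rightarrow> 'a"
      by unfold_locales (auto simp: algebra_simps)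
    interpret vp: vector_space_pair "fscl :: 'a \<Rightarrow> _" "(*) :: 'a \<Rightarrow> 'a \<Rightarrow> 'a" ..
    obtain \<phi> where \<phi>: "Vector_Spaces.linear fscl (*) \<phi>"
        "\<forall>z\<in>insert (x - y) B. \<phi> z = (if z = x - y then 1 else 0)"
      using vp.linear_independent_extend[OF indep, of "\<lambda>z. if z = x - y then 1 else 0"] by auto
    interpret lin: Vector_Spaces.linear fscl "(*)" \<phi> by fact
    have "\<phi> z = 0" if "z \<in> B" for z
      using that \<phi>(2) nin B(1) by auto
    then have "\<phi> z = 0" if "z \<in> rel_ideal q" for z
      using that sp by (metis lin.eq_0_on_span)
    then have "\<phi> \<in> annihilator q"
      by (auto simp: annihilator_def lin.add lin.scale)
    then have "\<phi> x = \<phi> y" using eq by (auto simp: cls_def fun_eq_iff split: if_splits)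
    then show False using \<phi>(2) by (simp add: lin.diff)
  qed
next
  assume "x - y \<in> rel_ideal q"
  then have "\<phi> x = \<phi> y" if "\<phi> \<in> annihilator q" for \<phi>
  proof -
    have "\<phi> x = \<phi> ((x - y) + y)" by simp
    also have "\<dots> = \<phi> (x - y) + \<phi> y" using that unfolding annihilator_def by blast
    finally show ?thesis using that \<open>x - y \<in> rel_ideal q\<close> by (simp add: annihilator_def)
  qed
  then show "cls q x = cls q y" by (auto simp: cls_def)
qed

definition rep :: "'k::field \<Rightarrow> ('k Oq_index \<Rightarrow> 'k) \<Rightarrow> 'k free_alg"
  where "rep q X = (SOME x. cls q x = X)"

definition Oq_carrier :: "'k::field \<Rightarrow> ('k Oq_index \<Rightarrow> 'k) set"
  where "Oq_carrier q = range (cls q)"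

definition Oq_mult ::
  "'k::field \<Rightarrow> ('k Oq_index \<Rightarrow> 'k) \<Rightarrow> ('k Oq_index \<Rightarrow> 'k) \<Rightarrow> 'k Oq_index \<Rightarrow> 'k"
  where "Oq_mult q X Y = cls q (rep q X * rep q Y)"

lemma cls_rep: "X \<in> Oq_carrier q \<Longrightarrow> cls q (rep q X) = X"
  unfolding rep_def Oq_carrier_def by (rule someI_ex) auto

lemma Oq_mult_cls: "Oq_mult q (cls q x) (cls q y) = cls q (x * y)"
proof -
  have *: "rep q (cls q z) - z \<in> rel_ideal q" for z
    by (simp add: cls_rep Oq_carrier_def flip: cls_eq_iff)
  have "rep q (cls q x) * rep q (cls q y) - x * y
      = 1 * (rep q (cls q x) - x) * rep q (cls q y) + x * (rep q (cls q y) - y) * 1"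
    by (simp add: algebra_simps)
  also have "\<dots> \<in> rel_ideal q"
    by (intro rel_ideal_add rel_ideal_mult *)
  finally show ?thesis by (simp add: Oq_mult_def cls_eq_iff)
qed

text \<open>
  The structure maps of \<open>O_q(SL_2)\<close>, and the map \<open>\<gamma>\<close>, are the algebra maps (anti-algebra map, for the antipode) on the free algebra
  with the given values on generators. They kill \<open>rel_ideal q\<close> if \<open>q \<noteq> 0\<close>, so they descend to the
  quotient, and the representative chosen by \<open>rep\<close> is irrelevant.
\<close>

definition Oq_tens ::
  "'k::field \<Rightarrow> 'k free_alg \<Rightarrow> 'k free_alg \<Rightarrow> ('k Oq_index, 'k Oq_index, 'k) tensor"
  where "Oq_tens q x y = tens (Oq_carrier q) (Oq_carrier q) (cls q x) (cls q y)"

definition Oq_tens_mult ::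
  "'k::field \<Rightarrow> ('k Oq_index, 'k Oq_index, 'k) tensor \<Rightarrow> ('k Oq_index, 'k Oq_index, 'k) tensor
    \<Rightarrow> ('k Oq_index, 'k Oq_index, 'k) tensor"
  where "Oq_tens_mult q s t =
    tlift (\<lambda>x y. tlift (\<lambda>x' y'. tens (Oq_carrier q) (Oq_carrier q) (Oq_mult q x x') (Oq_mult q y y')) t) s"

definition Oq_comult ::
  "'k::field \<Rightarrow> ('k Oq_index \<Rightarrow> 'k) \<Rightarrow> ('k Oq_index, 'k Oq_index, 'k) tensor"
  where "Oq_comult q X =
    free_lift scl (Oq_tens_mult q) (Oq_tens q 1 1)
      (\<lambda>g. case g of
          Ga \<Rightarrow> Oq_tens q (var Ga) (var Ga) + Oq_tens q (var Gb) (var Gc)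
        | Gb \<Rightarrow> Oq_tens q (var Ga) (var Gb) + Oq_tens q (var Gb) (var Gd)
        | Gc \<Rightarrow> Oq_tens q (var Gc) (var Ga) + Oq_tens q (var Gd) (var Gc)
        | Gd \<Rightarrow> Oq_tens q (var Gc) (var Gb) + Oq_tens q (var Gd) (var Gd))
      (rep q X)"

definition Oq_counit :: "'k::field \<Rightarrow> ('k Oq_index \<Rightarrow> 'k) \<Rightarrow> 'k"
  where "Oq_counit q X =
    free_lift (*) (*) 1 (\<lambda>g. case g of Ga \<Rightarrow> 1 | Gb \<Rightarrow> 0 | Gc \<Rightarrow> 0 | Gd \<Rightarrow> 1) (rep q X)"

definition Oq_antipode :: "'k::field \<Rightarrow> ('k Oq_index \<Rightarrow> 'k) \<Rightarrow> 'k Oq_index \<Rightarrow> 'k"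
  where "Oq_antipode q X =
    free_lift scl (\<lambda>x y. Oq_mult q y x) (cls q 1)
      (\<lambda>g. case g of
          Ga \<Rightarrow> cls q (var Gd)
        | Gb \<Rightarrow> scl (- inverse q) (cls q (var Gb))
        | Gc \<Rightarrow> scl (- q) (cls q (var Gc))
        | Gd \<Rightarrow> cls q (var Ga))
      (rep q X)"

definition Oq_SL2 :: "'k::field \<Rightarrow> ('k Oq_index, 'k) hopf"
  where "Oq_SL2 q =
    \<lparr> alg = Oq_carrier q, mult = Oq_mult q, unit = cls q 1,
      comult = Oq_comult q, counit = Oq_counit q, antipode = Oq_antipode q \<rparr>"

definition Oq_gamma :: "'k::field \<Rightarrow> ('k Oq_index \<Rightarrow> 'k) \<Rightarrow> 'k"
  where "Oq_gamma q X =
    free_lift (*) (*) 1 (\<lambda>g. case g of Ga \<Rightarrow> inverse q | Gb \<Rightarrow> 0 | Gc \<Rightarrow> 0 | Gd \<Rightarrow> q) (rep q X)"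

definition spin_index :: "rat \<Rightarrow> rat set"
  where "spin_index l = {- l + of_nat n | n. - l + of_nat n \<le> l}"

text \<open>For \<open>i \<in> spin_index l\<close> with \<open>2 l\<close> a natural number, \<open>l - i\<close> and \<open>l + i\<close> are natural numbers.\<close>

definition X_space :: "'k::field \<Rightarrow> rat \<Rightarrow> ('k Oq_index \<Rightarrow> 'k) set"
  where "X_space q l =
    fs.span ((\<lambda>i. cls q (var Ga ^ nat \<lfloor>l - i\<rfloor> * var Gb ^ nat \<lfloor>l + i\<rfloor>)) ` spin_index l)"

definition X_comodule :: "'k::field \<Rightarrow> rat \<Rightarrow> ('k Oq_index, 'k Oq_index, 'k) comodule"
  where "X_comodule q l = coideal_comodule (Oq_SL2 q) (X_space q l)"

end

theory Submission
  imports Defs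
begin

text \<open>
  Let \<open>n = 2 l\<close>. In the basis \<open>e\<^sub>j = b\<^sup>j a\<^sup>n\<^sup>-\<^sup>j\<close> of \<open>X\<^sub>l\<close> let \<open>u\<close> be the matrix of the coaction. A comodule map
  \<open>X\<^sub>l \<rightarrow> X\<^sub>l\<^sup>\<or>\<close> is a matrix \<open>\<beta>\<close> with \<open>u\<^sup>T \<beta> = \<beta> S(u)\<close>. Nesting the invariant \<open>x \<otimes> y - q y \<otimes> x\<close> of \<open>X\<^sub>1\<^sub>/\<^sub>2 \<otimes> X\<^sub>1\<^sub>/\<^sub>2\<close> gives
  an antidiagonal matrix \<open>z\<close> with \<open>u z u\<^sup>T = z\<close>, whose entries are \<open>(-q)\<^sup>k\<close> times Gaussian binomials, so
  \<open>z u\<^sup>T = S(u) z\<close> and \<open>\<beta> = z\<^sup>-\<^sup>1\<close> is a solution. Conversely, applying \<open>\<gamma>\<close> to \<open>u\<^sup>T \<beta> = \<beta> S(u)\<close> shows that every solution is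
  antidiagonal, and the top row \<open>u\<^sub>0\<^sub>j = b\<^sup>j a\<^sup>n\<^sup>-\<^sup>j \<noteq> 0\<close> then forces it to be a multiple of \<open>z\<^sup>-\<^sup>1\<close>. Hence the space of
  comodule maps is a line. The map in question sends \<open>\<beta>\<^sub>i\<^sub>j\<close> to \<open>\<beta>\<^sub>j\<^sub>i \<gamma>(u\<^sub>i\<^sub>i)\<close>, which is \<open>(-1)\<^sup>n \<beta>\<^sub>i\<^sub>j\<close> by the symmetry of the
  Gaussian binomials.
\<close>

section \<open>Actions of the free algebra\<close>

text \<open>The structure maps are \<open>free_lift\<close>s evaluated at a representative picked by
  \<open>rep\<close>, so nothing can be computed before they are known to depend on the class alone.
  Each of them is therefore read as an action of the free algebra on a suitable module, applied to a
  unit; well-definedness then says that the seven relators act by zero, or into the ideal. The same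
  device, on a module with basis \<open>b^j\<close>, supplies the linear independence of the basis
  of X_l. The identity S(u) u = 1 is proved directly for the coefficient matrix, by induction on the
  degree. The weights \<gamma>(u_ii) = q^(2i-n) play two roles: they are pairwise distinct because q
  is not a root of unity, which forces a solution to be antidiagonal, and they cancel the powers of
  q in the quotient (-q)^(2i-n) of the i-th and (n-i)-th antidiagonal entries of z, which leaves
  only a sign.\<close>

lemma sum_fun_apply: "(sum f A) x = (\<Sum>i\<in>A. f i x)"
  for f :: "'i \<Rightarrow> 'x \<Rightarrow> 'k::comm_monoid_add"
  by (induction A rule: infinite_finite_induct) auto

lemma scl_apply: "scl c v x = c * v x"
  by (simp add: scl_def)

lemma sum_additive_on:
  fixes h :: "'a::comm_monoid_add \<Rightarrow> 'b::comm_monoid_add"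
  assumes "\<And>x y. x \<in> V \<Longrightarrow> y \<in> V \<Longrightarrow> h (x + y) = h x + h y" "h 0 = 0"
    and "0 \<in> V" "\<And>x y. x \<in> V \<Longrightarrow> y \<in> V \<Longrightarrow> x + y \<in> V"
    and "\<And>i. i \<in> I \<Longrightarrow> v i \<in> V"
  shows "h (sum v I) = (\<Sum>i\<in>I. h (v i))"
proof -
  have "sum v I \<in> V \<and> h (sum v I) = (\<Sum>i\<in>I. h (v i))"
    using assms(5) by (induction I rule: infinite_finite_induct) (simp_all add: assms(1-4))
  then show ?thesis ..
qed

lemma poly_mapping_single_induct [case_names zero single add]:
  fixes x :: "'w \<Rightarrow>\<^sub>0 'k::comm_monoid_add"
  assumes "P 0" and "\<And>w c. P (Poly_Mapping.single w c)"
    and "\<And>x y. P x \<Longrightarrow> P y \<Longrightarrow> P (x + y)"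
  shows "P x"
proof (induction x rule: update_induct)
  case const
  then show ?case by (rule assms(1))
next
  case (update f a b)
  have "Poly_Mapping.update a b f = f + Poly_Mapping.single a b"
    using update(1)
    by (intro poly_mapping_eqI)
      (auto simp: lookup_add lookup_single when_def update.rep_eq in_keys_iff)
  then show ?case using assms update by metis
qed

text \<open>The action of a word has the shape of the \<open>foldr\<close> inside
  \<open>free_lift\<close>: with multiplication by the image of a generator as \<open>act1\<close>,
  unfolding \<open>free_lift\<close> gives \<open>act\<close> at a unit. The invariant subspace
  \<open>M\<close> serves the comultiplication, whose relations are checked only on genuine
  tensors.\<close>

locale word_action = vector_space s
  for s :: "'k::field \<Rightarrow> 'm::ab_group_add \<Rightarrow> 'm" +
  fixes M :: "'m set" and act1 :: "gen \<Rightarrow> 'm \<Rightarrow> 'm"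
  assumes subspace_M: "subspace M"
    and act1_in: "m \<in> M \<Longrightarrow> act1 g m \<in> M"
    and act1_add: "m \<in> M \<Longrightarrow> m' \<in> M \<Longrightarrow> act1 g (m + m') = act1 g m + act1 g m'"
    and act1_scale: "m \<in> M \<Longrightarrow> act1 g (s c m) = s c (act1 g m)"
begin

definition act :: "'k free_alg \<Rightarrow> 'm \<Rightarrow> 'm"
  where "act x m = (\<Sum>w\<in>Poly_Mapping.keys x. s (Poly_Mapping.lookup x w) (foldr act1 (letters w) m))"

lemma foldr_act1_in: "m \<in> M \<Longrightarrow> foldr act1 gs m \<in> M"
  by (induction gs) (auto intro: act1_in)

lemma foldr_act1_add:
  "m \<in> M \<Longrightarrow> m' \<in> M \<Longrightarrow> foldr act1 gs (m + m') = foldr act1 gs m + foldr act1 gs m'"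
  by (induction gs) (auto simp: act1_add foldr_act1_in)

lemma foldr_act1_scale: "m \<in> M \<Longrightarrow> foldr act1 gs (s c m) = s c (foldr act1 gs m)"
  by (induction gs) (auto simp: act1_scale foldr_act1_in)

lemma act_in: "m \<in> M \<Longrightarrow> act x m \<in> M"
  unfolding act_def by (intro subspace_sum subspace_scale subspace_M foldr_act1_in)

lemma act_superset:
  assumes "finite W" "Poly_Mapping.keys x \<subseteq> W"
  shows "act x m = (\<Sum>w\<in>W. s (Poly_Mapping.lookup x w) (foldr act1 (letters w) m))"
  unfolding act_def
  by (rule sum.mono_neutral_left) (use assms in \<open>auto simp: in_keys_iff\<close>)

lemma act_add: "act (x + y) m = act x m + act y m"
proof -
  let ?W = "Poly_Mapping.keys x \<union> Poly_Mapping.keys y"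
  have "Poly_Mapping.keys (x + y) \<subseteq> ?W" by (rule keys_add)
  then show ?thesis
    by (simp add: act_superset[of ?W] lookup_add scale_left_distrib sum.distrib)
qed

lemma act_zero [simp]: "act 0 m = 0"
  by (simp add: act_def)

lemma act_single: "act (Poly_Mapping.single w c) m = s c (foldr act1 (letters w) m)"
  by (simp add: act_def)

lemma act_one [simp]: "act 1 m = m"
  by (simp add: act_single zero_word_def flip: single_one)

lemma act_var [simp]: "act (var g) m = act1 g m"
  by (simp add: var_def act_single)

lemma act_add_right: "m \<in> M \<Longrightarrow> m' \<in> M \<Longrightarrow> act x (m + m') = act x m + act x m'"
  by (simp add: act_def foldr_act1_add scale_right_distrib sum.distrib)

lemma act_scale_right: "m \<in> M \<Longrightarrow> act x (s c m) = s c (act x m)"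
  by (simp add: act_def foldr_act1_scale scale_sum_right mult.commute)

lemma act_zero_right [simp]: "act x 0 = 0"
  using act_scale_right[of 0 x 0] subspace_0[OF subspace_M] by simp

lemma act_mult: "m \<in> M \<Longrightarrow> act (x * y) m = act x (act y m)"
proof (induction x rule: poly_mapping_single_induct)
  case (single w c)
  then show ?case
  proof (induction y rule: poly_mapping_single_induct)
    case (single w' c')
    then show ?case
      by (simp add: act_single mult_single plus_word_def foldr_act1_scale foldr_act1_in)
  next
    case (add x y)
    then show ?case by (simp add: distrib_left act_add act_add_right act_in)
  qed simp
qed (auto simp: distrib_right act_add)

lemma act_fscl: "m \<in> M \<Longrightarrow> act (fscl c x) m = s c (act x m)"
  by (simp add: fscl_def act_mult act_single zero_word_def)

lemma act_sum: "act (sum f A) m = (\<Sum>i\<in>A. act (f i) m)"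
  by (rule sum_additive_on[of UNIV "\<lambda>x. act x m"]) (simp_all add: act_add)

lemma act_diff: "act (x - y) m = act x m - act y m"
  by (metis act_add add_diff_cancel diff_add_cancel)

text \<open>A product u r v sends m to u (r (v m)): v keeps it in \<open>M\<close>, r moves it into
  \<open>N\<close>, and u cannot leave \<open>N\<close>. Where relators act by zero,
  \<open>N\<close> is zero; for the antipode, computed in the free algebra, it is
  \<open>rel_ideal\<close>.\<close>

lemma act_rel_ideal:
  assumes N: "subspace N" "N \<subseteq> M" "\<And>g m. m \<in> N \<Longrightarrow> act1 g m \<in> N"
    and rel: "\<And>r m. r \<in> relators q \<Longrightarrow> m \<in> M \<Longrightarrow> act r m \<in> N"
    and "x \<in> rel_ideal q" "m \<in> M"
  shows "act x m \<in> N"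
  using assms(5)
proof induction
  case (rel_ideal_rel r u v)
  have fold: "foldr act1 gs m \<in> N" if "m \<in> N" for gs m
    using that by (induction gs) (auto intro: N)
  have "act u n \<in> N" if "n \<in> N" for n
    unfolding act_def using that by (intro subspace_sum subspace_scale N fold)
  then show ?case
    using rel_ideal_rel \<open>m \<in> M\<close> by (simp add: act_mult act_in rel)
qed (auto simp: act_add subspace_0 subspace_add N)

lemma act_cls_cong:
  assumes "\<And>r m. r \<in> relators q \<Longrightarrow> m \<in> M \<Longrightarrow> act r m = 0"
    and "cls q x = cls q y" "m \<in> M"
  shows "act x m = act y m"
proof -
  have "x - y \<in> rel_ideal q"
    using assms(2) by (simp add: cls_eq_iff)
  have "act (x - y) m \<in> {0}"
  proof (rule act_rel_ideal[of "{0}" q])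
    show "act1 g m \<in> {0}" if "m \<in> {0}" for g m
      using act1_scale[of 0 g 0] subspace_0[OF subspace_M] that by simp
    show "act r m \<in> {0}" if "r \<in> relators q" "m \<in> M" for r m
      using assms(1)[OF that] by simp
  qed (use \<open>x - y \<in> rel_ideal q\<close> assms(3) subspace_0[OF subspace_M] in auto)
  then show ?thesis by (simp add: act_diff)
qed

text \<open>This removes the arbitrary representative chosen by \<open>rep\<close> from a structure
  map.\<close>

lemma act_rep:
  assumes "\<And>r m. r \<in> relators q \<Longrightarrow> m \<in> M \<Longrightarrow> act r m = 0" and "m \<in> M"
  shows "act (rep q (cls q x)) m = act x m"
  by (rule act_cls_cong[OF assms(1) cls_rep assms(2)]) (auto simp: Oq_carrier_def)

end

section \<open>Calculation modulo the relations\<close>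

lemma relatorsE:
  assumes "r \<in> relators q"
  obtains "r = var Ga * var Gb - fscl q (var Gb * var Ga)"
  | "r = var Ga * var Gc - fscl q (var Gc * var Ga)"
  | "r = var Gb * var Gd - fscl q (var Gd * var Gb)"
  | "r = var Gc * var Gd - fscl q (var Gd * var Gc)"
  | "r = var Gb * var Gc - var Gc * var Gb"
  | "r = var Ga * var Gd - fscl q (var Gb * var Gc) - 1"
  | "r = var Gd * var Ga - fscl (inverse q) (var Gb * var Gc) - 1"
  using assms by (auto simp: relators_def Let_def)

lemma relators_rel_ideal: "r \<in> relators q \<Longrightarrow> r \<in> rel_ideal q"
  using rel_ideal_rel[of r q 1 1] by simp

abbreviation "va \<equiv> var Ga"
abbreviation "vb \<equiv> var Gb"
abbreviation "vc \<equiv> var Gc"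
abbreviation "vd \<equiv> var Gd"

lemma fscl_mult_left: "fscl c x * y = fscl c (x * y)"
  by (simp add: fscl_def mult.assoc)

lemma single_zero_commute:
  fixes x :: "'k::field free_alg"
  shows "x * Poly_Mapping.single 0 c = Poly_Mapping.single 0 c * x"
  by (induction x rule: poly_mapping_single_induct)
    (simp_all add: mult_single distrib_left distrib_right mult.commute)

lemma fscl_mult_right: "x * fscl c y = fscl c (x * y)"
  using single_zero_commute[of x c] by (simp add: fscl_def flip: mult.assoc)

lemma cls_minus: "cls q (- x) = - cls q x"
  using cls_add[of q x "- x"] cls_add[of q 0 0]
  by (simp add: eq_neg_iff_add_eq_0 add.commute)

lemma cls_diff: "cls q (x - y) = cls q x - cls q y"
  using cls_add[of q x "- y"] by (simp add: cls_minus)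

lemma cls_zero [simp]: "cls q 0 = 0"
  using cls_diff[of q 0 0] by simp

lemma cls_sum: "cls q (sum f A) = (\<Sum>i\<in>A. cls q (f i))"
  by (induction A rule: infinite_finite_induct) (auto simp: cls_add)

lemma cls_mult_cong:
  "cls q x = cls q x' \<Longrightarrow> cls q y = cls q y' \<Longrightarrow> cls q (x * y) = cls q (x' * y')"
  by (metis Oq_mult_cls)

lemma cls_in [simp]: "cls q x \<in> Oq_carrier q"
  by (simp add: Oq_carrier_def)

lemma subspace_Oq_carrier: "fs.subspace (Oq_carrier q)"
proof (rule fs.subspaceI)
  show "0 \<in> Oq_carrier q"
    by (metis cls_in cls_zero)
next
  fix X Y assume "X \<in> Oq_carrier q" "Y \<in> Oq_carrier q"
  then show "X + Y \<in> Oq_carrier q"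
    by (metis cls_add cls_in cls_rep)
next
  fix c X assume "X \<in> Oq_carrier q"
  then show "scl c X \<in> Oq_carrier q"
    by (metis cls_scl cls_in cls_rep)
qed

lemma cls_relator: "r \<in> relators q \<Longrightarrow> cls q r = 0"
  by (metis cls_eq_iff cls_zero diff_zero relators_rel_ideal)

lemma Oq_relations:
  shows "cls q (va * vb) = scl q (cls q (vb * va))"
    and "cls q (va * vc) = scl q (cls q (vc * va))"
    and "cls q (vb * vd) = scl q (cls q (vd * vb))"
    and "cls q (vc * vd) = scl q (cls q (vd * vc))"
    and "cls q (vb * vc) = cls q (vc * vb)"
    and "cls q (va * vd) = scl q (cls q (vb * vc)) + cls q 1"
    and "cls q (vd * va) = scl (inverse q) (cls q (vb * vc)) + cls q 1"
proof -
  note [simp] = relators_def Let_def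
  have "cls q (va * vb - fscl q (vb * va)) = 0" by (rule cls_relator) simp
  then show "cls q (va * vb) = scl q (cls q (vb * va))"
    unfolding cls_diff cls_scl right_minus_eq .
  have "cls q (va * vc - fscl q (vc * va)) = 0" by (rule cls_relator) simp
  then show "cls q (va * vc) = scl q (cls q (vc * va))"
    unfolding cls_diff cls_scl right_minus_eq .
  have "cls q (vb * vd - fscl q (vd * vb)) = 0" by (rule cls_relator) simp
  then show "cls q (vb * vd) = scl q (cls q (vd * vb))"
    unfolding cls_diff cls_scl right_minus_eq .
  have "cls q (vc * vd - fscl q (vd * vc)) = 0" by (rule cls_relator) simp
  then show "cls q (vc * vd) = scl q (cls q (vd * vc))"
    unfolding cls_diff cls_scl right_minus_eq .
  have "cls q (vb * vc - vc * vb) = 0" by (rule cls_relator) simp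
  then show "cls q (vb * vc) = cls q (vc * vb)"
    unfolding cls_diff right_minus_eq .
  have "cls q (va * vd - fscl q (vb * vc) - 1) = 0" by (rule cls_relator) simp
  then show "cls q (va * vd) = scl q (cls q (vb * vc)) + cls q 1"
    unfolding cls_diff cls_add cls_scl diff_diff_eq right_minus_eq .
  have "cls q (vd * va - fscl (inverse q) (vb * vc) - 1) = 0" by (rule cls_relator) simp
  then show "cls q (vd * va) = scl (inverse q) (cls q (vb * vc)) + cls q 1"
    unfolding cls_diff cls_add cls_scl diff_diff_eq right_minus_eq .
qed

text \<open>The target is \<open>unit \<Rightarrow> 'k\<close> instead of \<open>'k\<close>, so that its scalar multiplication is \<open>scl\<close>.\<close>

interpretation gam: word_action "scl :: 'k::field \<Rightarrow> (unit \<Rightarrow> 'k) \<Rightarrow> _" UNIV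
  "\<lambda>g. scl (case g of Ga \<Rightarrow> inverse q | Gb \<Rightarrow> 0 | Gc \<Rightarrow> 0 | Gd \<Rightarrow> q)" for q :: "'k::field"
  by unfold_locales (auto simp: algebra_simps scl_def fun_eq_iff)

definition gamma_free :: "'k::field \<Rightarrow> 'k free_alg \<Rightarrow> 'k"
  where "gamma_free q x = gam.act q x (\<lambda>_. 1) ()"

text \<open>Every generator acts by a scalar, so x acts as multiplication by its value at the vector
  1.\<close>

lemma gamma_free_mult: "gamma_free q (x * y) = gamma_free q x * gamma_free q y"
proof -
  have "gam.act q x m = scl (m ()) (gam.act q x (\<lambda>_. 1))" for m
    by (subst gam.act_scale_right[symmetric]) (auto simp: scl_def)
  from this[of "gam.act q y (\<lambda>_. 1)"] show ?thesis
    by (simp add: gamma_free_def gam.act_mult scl_def)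
qed

lemma gamma_free_simps [simp]:
  "gamma_free q (x + y) = gamma_free q x + gamma_free q y"
  "gamma_free q (x - y) = gamma_free q x - gamma_free q y"
  "gamma_free q (fscl c x) = c * gamma_free q x"
  "gamma_free q 0 = 0" "gamma_free q 1 = 1"
  "gamma_free q va = inverse q" "gamma_free q vb = 0" "gamma_free q vc = 0" "gamma_free q vd = q"
  by (simp_all add: gamma_free_def gam.act_add gam.act_diff gam.act_fscl scl_def)

lemma Oq_gamma_cls:
  fixes q :: "'k::field"
  assumes "q \<noteq> 0"
  shows "Oq_gamma q (cls q x) = gamma_free q x"
proof -
  have fold: "foldr (\<lambda>g. (*) (\<eta> g)) gs 1 = foldr (\<lambda>g. scl (\<eta> g)) gs (\<lambda>_. 1) ()"
    for \<eta> :: "gen \<Rightarrow> 'k" and gs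
    by (induction gs) (auto simp: scl_def)
  have "Oq_gamma q (cls q x) = gamma_free q (rep q (cls q x))"
    unfolding Oq_gamma_def free_lift_def gamma_free_def gam.act_def fold
    by (simp add: sum_fun_apply scl_def)
  also have "\<dots> = gamma_free q x"
  proof -
    have "gam.act q (rep q (cls q x)) (\<lambda>_. 1) = gam.act q x (\<lambda>_. 1)"
    proof (rule gam.act_rep)
      fix r :: "'k free_alg" and m assume "r \<in> relators q"
      then show "gam.act q r m = 0"
        by (rule relatorsE)
          (use assms in \<open>auto simp: gam.act_diff gam.act_mult gam.act_fscl scl_def\<close>)
    qed simp
    then show ?thesis by (simp add: gamma_free_def)
  qed
  finally show ?thesis .
qed

section \<open>The antipode, lifted to the free algebra\<close>

definition sgen :: "'k::field \<Rightarrow> gen \<Rightarrow> 'k free_alg"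
  where "sgen q g = (case g of Ga \<Rightarrow> vd | Gb \<Rightarrow> fscl (- inverse q) vb | Gc \<Rightarrow> fscl (- q) vc | Gd \<Rightarrow> va)"

lemma sgen_simps [simp]:
  "sgen q Ga = vd" "sgen q Gb = fscl (- inverse q) vb" "sgen q Gc = fscl (- q) vc" "sgen q Gd = va"
  by (simp_all add: sgen_def)

text \<open>Right multiplication by the image of a letter reverses words, so acting on 1 is the
  anti-algebra map determined by \<open>sgen\<close>.\<close>

interpretation ant: word_action "fscl :: 'k::field \<Rightarrow> 'k free_alg \<Rightarrow> 'k free_alg" UNIV
  "\<lambda>g m. m * sgen q g" for q :: "'k::field"
  by unfold_locales (auto simp: distrib_right fscl_mult_left fa.scale_right_distrib)

lemma Oq_antipode_cls:
  fixes q :: "'k::field"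
  assumes "q \<noteq> 0"
  shows "Oq_antipode q (cls q x) = cls q (ant.act q x 1)"
proof -
  have fold: "foldr (\<lambda>g y. Oq_mult q y (case g of
          Ga \<Rightarrow> cls q (var Gd)
        | Gb \<Rightarrow> scl (- inverse q) (cls q (var Gb))
        | Gc \<Rightarrow> scl (- q) (cls q (var Gc))
        | Gd \<Rightarrow> cls q (var Ga))) gs (cls q 1) = cls q (foldr (\<lambda>g m. m * sgen q g) gs 1)" for gs
  proof (induction gs)
    case (Cons g gs)
    then show ?case
      by (cases g) (simp_all add: Oq_mult_cls flip: cls_scl)
  qed simp
  have "Oq_antipode q (cls q x) = cls q (ant.act q (rep q (cls q x)) 1)"
    by (simp add: Oq_antipode_def free_lift_def ant.act_def fold cls_sum cls_scl)
  also have "\<dots> = cls q (ant.act q x 1)"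
  proof -
    \<comment> \<open>In the free algebra a relator need not act by zero but only into
      \<open>rel_ideal\<close>, which therefore takes the place of zero as the target.\<close>
    have "ant.act q (rep q (cls q x) - x) 1 \<in> rel_ideal q"
    proof (rule ant.act_rel_ideal[of "rel_ideal q" q q])
      fix r m :: "'k free_alg" assume r: "r \<in> relators q"
      have "cls q (ant.act q r 1) = 0"
        using r assms
        by (auto elim!: relatorsE simp: ant.act_diff ant.act_mult ant.act_fscl cls_diff
            cls_scl fscl_mult_right fscl_mult_left Oq_relations fs.scale_right_diff_distrib
            fs.scale_right_distrib)
      then have "ant.act q r 1 \<in> rel_ideal q"
        by (metis cls_eq_iff cls_zero diff_zero)
      \<comment> \<open>Left multiplication by m commutes with the action, so it is enough to know
        the relators at 1.\<close>
      moreover have "ant.act q y m = m * ant.act q y 1" for y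
      proof (induction y rule: poly_mapping_single_induct)
        case (single w c)
        have "foldr (\<lambda>g m. m * sgen q g) gs m = m * foldr (\<lambda>g m. m * sgen q g) gs 1" for gs
          by (induction gs) (auto simp: mult.assoc)
        then show ?case by (simp add: ant.act_single fscl_mult_right)
      qed (auto simp: ant.act_add distrib_left)
      ultimately show "ant.act q r m \<in> rel_ideal q"
        using rel_ideal_mult[of "ant.act q r 1" q m 1] by simp
    next
      fix g and m :: "'k free_alg" assume "m \<in> rel_ideal q"
      then show "m * sgen q g \<in> rel_ideal q"
        using rel_ideal_mult[of m q 1] by simp
    next
      show "rep q (cls q x) - x \<in> rel_ideal q"
        by (simp add: cls_rep flip: cls_eq_iff)
    qed (auto simp: subspace_rel_ideal)
    then show ?thesis by (simp add: cls_eq_iff ant.act_diff)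
  qed
  finally show ?thesis .
qed

text \<open>
  Left multiplication on the quotient of \<open>O\<^sub>q\<close> by the left ideal generated by \<open>a - 1\<close> and \<open>c\<close>, in coordinates
  with respect to the basis \<open>b\<^sup>j\<close>.
\<close>

definition bgen :: "'k::field \<Rightarrow> gen \<Rightarrow> (nat \<Rightarrow> 'k) \<Rightarrow> nat \<Rightarrow> 'k"
  where "bgen q g m j = (case g of
      Ga \<Rightarrow> q ^ j * m j
    | Gb \<Rightarrow> (if j = 0 then 0 else m (j - 1))
    | Gc \<Rightarrow> 0
    | Gd \<Rightarrow> inverse q ^ j * m j)"

lemma bgen_shift: "bgen q Gb m j = (if j = 0 then 0 else m (j - 1))"
  by (simp add: bgen_def)

lemma bgen_simps [simp]:
  "bgen q Ga m j = q ^ j * m j" "bgen q Gb m 0 = 0" "bgen q Gb m (Suc j) = m j"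
  "bgen q Gc m j = 0" "bgen q Gd m j = inverse q ^ j * m j"
  by (simp_all add: bgen_def)

interpretation bor: word_action "scl :: 'k::field \<Rightarrow> (nat \<Rightarrow> 'k) \<Rightarrow> _" UNIV "bgen q" for q :: "'k::field"
  by unfold_locales (auto simp: algebra_simps scl_def fun_eq_iff bgen_def split: gen.split)

text \<open>The coefficient of b^i when x acts on the cyclic vector b^0. A class is a function on
  linear forms, so its value at the index \<open>phi q i\<close> is this coefficient: coordinates in
  O_q become evaluations at points.\<close>

definition phi :: "'k::field \<Rightarrow> nat \<Rightarrow> 'k free_alg \<Rightarrow> 'k"
  where "phi q i x = bor.act q x (\<lambda>j. if j = 0 then 1 else 0) i"

lemma phi_annihilator:
  fixes q :: "'k::field"
  assumes "q \<noteq> 0"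
  shows "phi q i \<in> annihilator q"
proof -
  have "bor.act q x m \<in> {0}" if "x \<in> rel_ideal q" for x :: "'k free_alg" and m
    using _ _ _ _ that
  proof (rule bor.act_rel_ideal)
    fix r :: "'k free_alg" and m assume r: "r \<in> relators q"
    have "bor.act q r m j = 0" for j
      using r
      by (rule relatorsE; cases j; simp add: bor.act_diff bor.act_mult bor.act_fscl scl_def)
        (simp_all add: assms field_simps)
    then show "bor.act q r m \<in> {0}" by (simp add: fun_eq_iff)
  qed (auto simp: fun_eq_iff bgen_def split: gen.split)
  then have "bor.act q x m = 0" if "x \<in> rel_ideal q" for x :: "'k free_alg" and m
    using that by blast
  then show ?thesis
    by (auto simp: annihilator_def phi_def bor.act_add bor.act_fscl scl_def)
qed

text \<open>The letter a fixes the cyclic vector and b raises the index, so the exponent of a is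
  invisible. Monomials of one total degree are still separated, which gives their linear
  independence.\<close>

lemma phi_monomial: "phi q i (vb ^ j * va ^ s) = (if i = j then 1 else 0)"
proof -
  have "bor.act q (va ^ s) (\<lambda>j. if j = 0 then 1 else 0) = (\<lambda>j. if j = 0 then 1 else 0)"
    by (induction s) (auto simp: bor.act_mult fun_eq_iff)
  moreover have "bor.act q (vb ^ j) (\<lambda>j. if j = 0 then 1 else 0) = (\<lambda>i. if i = j then 1 else 0)"
    by (induction j) (auto simp: bor.act_mult fun_eq_iff bgen_shift)
  ultimately show ?thesis by (simp add: phi_def bor.act_mult)
qed

section \<open>Tensors and the comultiplication\<close>

lemma form_onD:
  assumes "form_on V \<phi>"
  shows "v \<in> V \<Longrightarrow> w \<in> V \<Longrightarrow> \<phi> (v + w) = \<phi> v + \<phi> w"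
    and "v \<in> V \<Longrightarrow> \<phi> (scl c v) = c * \<phi> v"
  using assms by (auto simp: form_on_def)

lemma bilinear_formsD:
  assumes "B \<in> bilinear_forms V W"
  shows "v \<in> V \<Longrightarrow> form_on W (B v)" and "w \<in> W \<Longrightarrow> form_on V (\<lambda>v. B v w)"
  using assms by (auto simp: bilinear_forms_def)

lemma tens_add_left:
  "v \<in> V \<Longrightarrow> v' \<in> V \<Longrightarrow> w \<in> W \<Longrightarrow> tens V W (v + v') w = tens V W v w + tens V W v' w"
  by (auto simp: tens_def fun_eq_iff form_onD(1)[OF bilinear_formsD(2)])

lemma tens_scl_left:
  "v \<in> V \<Longrightarrow> w \<in> W \<Longrightarrow> tens V W (scl c v) w = scl c (tens V W v w)"
  by (auto simp: tens_def fun_eq_iff scl_apply form_onD(2)[OF bilinear_formsD(2)])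

lemma tens_add_right:
  "v \<in> V \<Longrightarrow> w \<in> W \<Longrightarrow> w' \<in> W \<Longrightarrow> tens V W v (w + w') = tens V W v w + tens V W v w'"
  by (auto simp: tens_def fun_eq_iff form_onD(1)[OF bilinear_formsD(1)])

lemma tens_scl_right:
  "v \<in> V \<Longrightarrow> w \<in> W \<Longrightarrow> tens V W v (scl c w) = scl c (tens V W v w)"
  by (auto simp: tens_def fun_eq_iff scl_apply form_onD(2)[OF bilinear_formsD(1)])

lemma tens_zero_left: "0 \<in> V \<Longrightarrow> w \<in> W \<Longrightarrow> tens V W 0 w = 0"
  using tens_scl_left[of 0 V w W 0] by simp

lemma tens_zero_right: "v \<in> V \<Longrightarrow> 0 \<in> W \<Longrightarrow> tens V W v 0 = 0"
  using tens_scl_right[of v V 0 W 0] by simp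

lemma tens_sum_left:
  assumes "fs.subspace V" "\<And>i. i \<in> I \<Longrightarrow> v i \<in> V" "w \<in> W"
  shows "tens V W (sum v I) w = (\<Sum>i\<in>I. tens V W (v i) w)"
  by (rule sum_additive_on[of V "\<lambda>v. tens V W v w"])
    (simp_all add: assms tens_add_left tens_zero_left fs.subspace_0 fs.subspace_add)

lemma tens_sum_right:
  assumes "fs.subspace W" "\<And>i. i \<in> I \<Longrightarrow> w i \<in> W" "v \<in> V"
  shows "tens V W v (sum w I) = (\<Sum>i\<in>I. tens V W v (w i))"
  by (rule sum_additive_on[of W "tens V W v"])
    (simp_all add: assms tens_add_right tens_zero_right fs.subspace_0 fs.subspace_add)

lemma subspace_tensor_space: "fs.subspace (tensor_space V W)"
  by (simp add: tensor_space_def)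

lemma tens_in [intro]: "v \<in> V \<Longrightarrow> w \<in> W \<Longrightarrow> tens V W v w \<in> tensor_space V W"
  unfolding tensor_space_def by (rule fs.span_base) auto

lemma tensor_space_induct:
  assumes "t \<in> tensor_space V W"
    and "\<And>v w. v \<in> V \<Longrightarrow> w \<in> W \<Longrightarrow> P (tens V W v w)"
    and "P 0" "\<And>s t. s \<in> tensor_space V W \<Longrightarrow> t \<in> tensor_space V W \<Longrightarrow> P s \<Longrightarrow> P t \<Longrightarrow> P (s + t)"
    and "\<And>c t. t \<in> tensor_space V W \<Longrightarrow> P t \<Longrightarrow> P (scl c t)"
  shows "P t"
proof -
  have "t \<in> tensor_space V W \<and> P t"
    using assms(1) unfolding tensor_space_def
  proof (rule fs.span_induct)
    show "fs.subspace {t. t \<in> fs.span {tens V W v w |v w. v \<in> V \<and> w \<in> W} \<and> P t}"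
      using assms(3-5) unfolding tensor_space_def
      by (intro fs.subspaceI) (auto intro: fs.span_add fs.span_scale fs.span_zero)
  qed (use assms(2) in \<open>auto intro: fs.span_base\<close>)
  then show ?thesis by simp
qed

lemma tlift_add: "tlift b (s + t) = tlift b s + tlift b t"
  by (simp add: tlift_def fun_eq_iff)

lemma tlift_zero [simp]: "tlift b 0 = 0"
  by (simp add: tlift_def fun_eq_iff)

lemma tlift_scl: "tlift b (scl c t) = scl c (tlift b t)"
  by (simp add: tlift_def fun_eq_iff scl_def)

lemma tlift_sum: "tlift b (sum t I) = (\<Sum>i\<in>I. tlift b (t i))"
  by (rule sum_additive_on[of UNIV "tlift b"]) (simp_all add: tlift_add)

section \<open>Multiplication on the tensor square\<close>

lemma Oq_mult_in [simp]: "Oq_mult q X Y \<in> Oq_carrier q"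
  by (simp add: Oq_mult_def)

lemma Oq_mult_linear:
  assumes "X \<in> Oq_carrier q" "X' \<in> Oq_carrier q"
  shows "Oq_mult q (X + X') Y = Oq_mult q X Y + Oq_mult q X' Y"
    and "Oq_mult q (scl c X) Y = scl c (Oq_mult q X Y)"
    and "Oq_mult q Y (X + X') = Oq_mult q Y X + Oq_mult q Y X'"
    and "Oq_mult q Y (scl c X) = scl c (Oq_mult q Y X)"
proof -
  obtain x x' where x: "X = cls q x" "X' = cls q x'"
    using assms by (auto simp: Oq_carrier_def)
  have l: "Oq_mult q (cls q z) Y = cls q (z * rep q Y)" for z
    by (simp add: Oq_mult_def) (metis Oq_mult_cls Oq_mult_def cls_in cls_mult_cong cls_rep)
  have r: "Oq_mult q Y (cls q z) = cls q (rep q Y * z)" for z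
    by (simp add: Oq_mult_def) (metis Oq_mult_cls Oq_mult_def cls_in cls_mult_cong cls_rep)
  show "Oq_mult q (X + X') Y = Oq_mult q X Y + Oq_mult q X' Y"
    and "Oq_mult q (scl c X) Y = scl c (Oq_mult q X Y)"
    and "Oq_mult q Y (X + X') = Oq_mult q Y X + Oq_mult q Y X'"
    and "Oq_mult q Y (scl c X) = scl c (Oq_mult q Y X)"
    unfolding x by (simp_all add: l r distrib_left distrib_right fscl_mult_left fscl_mult_right
        flip: cls_add cls_scl)
qed

definition lmul ::
  "'k::field \<Rightarrow> ('k Oq_index \<Rightarrow> 'k) \<Rightarrow> ('k Oq_index \<Rightarrow> 'k)
    \<Rightarrow> ('k Oq_index, 'k Oq_index, 'k) tensor \<Rightarrow> ('k Oq_index, 'k Oq_index, 'k) tensor"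
  where "lmul q X Y =
    tlift (\<lambda>x' y'. tens (Oq_carrier q) (Oq_carrier q) (Oq_mult q X x') (Oq_mult q Y y'))"

abbreviation "OT q \<equiv> tensor_space (Oq_carrier q) (Oq_carrier q)"
abbreviation "otens q \<equiv> tens (Oq_carrier q) (Oq_carrier q)"

lemma lmul_add: "lmul q X Y (S + T) = lmul q X Y S + lmul q X Y T"
  and lmul_scl: "lmul q X Y (scl c T) = scl c (lmul q X Y T)"
  and lmul_zero [simp]: "lmul q X Y 0 = 0"
  by (simp_all add: lmul_def tlift_add tlift_scl)

lemma lmul_tens:
  assumes "X \<in> Oq_carrier q" "Y \<in> Oq_carrier q" "X' \<in> Oq_carrier q" "Y' \<in> Oq_carrier q"
  shows "lmul q X Y (otens q X' Y') = otens q (Oq_mult q X X') (Oq_mult q Y Y')"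
  unfolding lmul_def
  by (rule tlift_tens)
    (auto simp: linear_on_def Oq_mult_linear tens_add_left tens_add_right tens_scl_left tens_scl_right)

lemma lmul_cls:
  "lmul q (cls q x) (cls q y) (otens q (cls q x') (cls q y')) = otens q (cls q (x * x')) (cls q (y * y'))"
  by (simp add: lmul_tens Oq_mult_cls)

lemma lmul_in:
  assumes "X \<in> Oq_carrier q" "Y \<in> Oq_carrier q" "T \<in> OT q"
  shows "lmul q X Y T \<in> OT q"
  by (rule tensor_space_induct[OF assms(3), of "\<lambda>T. lmul q X Y T \<in> OT q"])
    (simp_all add: assms lmul_tens tens_in lmul_add lmul_scl subspace_tensor_space
      fs.subspace_add fs.subspace_scale fs.subspace_0)

text \<open>Linearity in the left factors is what allows \<open>tlift_tens\<close> to evaluate the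
  outer lift in \<open>Oq_tens_mult\<close>.\<close>

lemma lmul_linear:
  assumes "X \<in> Oq_carrier q" "X' \<in> Oq_carrier q" "Y \<in> Oq_carrier q" "T \<in> OT q"
  shows "lmul q (X + X') Y T = lmul q X Y T + lmul q X' Y T"
    and "lmul q (scl c X) Y T = scl c (lmul q X Y T)"
    and "lmul q Y (X + X') T = lmul q Y X T + lmul q Y X' T"
    and "lmul q Y (scl c X) T = scl c (lmul q Y X T)"
proof -
  let ?P = "\<lambda>T. lmul q (X + X') Y T = lmul q X Y T + lmul q X' Y T
    \<and> lmul q (scl c X) Y T = scl c (lmul q X Y T)
    \<and> lmul q Y (X + X') T = lmul q Y X T + lmul q Y X' T
    \<and> lmul q Y (scl c X) T = scl c (lmul q Y X T)"
  note sub = subspace_Oq_carrier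
  have "?P T"
  proof (rule tensor_space_induct[OF assms(4), of ?P])
    fix v w assume "v \<in> Oq_carrier q" "w \<in> Oq_carrier q"
    then show "?P (otens q v w)" using assms
      by (simp add: lmul_tens fs.subspace_add[OF sub] fs.subspace_scale[OF sub] Oq_mult_linear
          tens_add_left tens_add_right tens_scl_left tens_scl_right)
  qed (simp_all add: lmul_add lmul_scl fs.scale_right_distrib mult.commute add_ac)
  then show "lmul q (X + X') Y T = lmul q X Y T + lmul q X' Y T"
    and "lmul q (scl c X) Y T = scl c (lmul q X Y T)"
    and "lmul q Y (X + X') T = lmul q Y X T + lmul q Y X' T"
    and "lmul q Y (scl c X) T = scl c (lmul q Y X T)"
    by blast+
qed

lemma Oq_tens_mult_tens:
  assumes "X \<in> Oq_carrier q" "Y \<in> Oq_carrier q" "T \<in> OT q"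
  shows "Oq_tens_mult q (otens q X Y) T = lmul q X Y T"
  unfolding Oq_tens_mult_def lmul_def[symmetric]
  by (rule tlift_tens) (use assms in \<open>auto simp: linear_on_def lmul_linear\<close>)

lemma Oq_tens_mult_add: "Oq_tens_mult q (S + S') T = Oq_tens_mult q S T + Oq_tens_mult q S' T"
  by (simp add: Oq_tens_mult_def tlift_add)

definition cgen ::
  "'k::field \<Rightarrow> gen \<Rightarrow> ('k Oq_index, 'k Oq_index, 'k) tensor \<Rightarrow> ('k Oq_index, 'k Oq_index, 'k) tensor"
  where "cgen q g T = (case g of
      Ga \<Rightarrow> lmul q (cls q va) (cls q va) T + lmul q (cls q vb) (cls q vc) T
    | Gb \<Rightarrow> lmul q (cls q va) (cls q vb) T + lmul q (cls q vb) (cls q vd) T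
    | Gc \<Rightarrow> lmul q (cls q vc) (cls q va) T + lmul q (cls q vd) (cls q vc) T
    | Gd \<Rightarrow> lmul q (cls q vc) (cls q vb) T + lmul q (cls q vd) (cls q vd) T)"

text \<open>A generator acts by left multiplication with its coproduct, so acting on 1 \<otimes> 1
  gives the comultiplication.\<close>

interpretation cm: word_action "scl :: 'k::field \<Rightarrow> ('k Oq_index, 'k Oq_index, 'k) tensor \<Rightarrow> _"
  "OT q" "cgen q" for q :: "'k::field"
proof unfold_locales
  show "fs.subspace (OT q)" by (rule subspace_tensor_space)
  fix m m' :: "('k Oq_index, 'k Oq_index, 'k) tensor" and g c
  assume m: "m \<in> OT q"
  show "cgen q g m \<in> OT q"
    unfolding cgen_def using m
    by (cases g) (simp_all add: fs.subspace_add[OF subspace_tensor_space] lmul_in)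
  show "cgen q g (m + m') = cgen q g m + cgen q g m'"
    by (cases g) (simp_all add: cgen_def lmul_add add_ac)
  show "cgen q g (scl c m) = scl c (cgen q g m)"
    by (cases g) (simp_all add: cgen_def lmul_scl fs.scale_right_distrib)
qed

lemma cgen_cls:
  "cgen q Ga (otens q (cls q x) (cls q y)) =
    otens q (cls q (va * x)) (cls q (va * y)) + otens q (cls q (vb * x)) (cls q (vc * y))"
  "cgen q Gb (otens q (cls q x) (cls q y)) =
    otens q (cls q (va * x)) (cls q (vb * y)) + otens q (cls q (vb * x)) (cls q (vd * y))"
  "cgen q Gc (otens q (cls q x) (cls q y)) =
    otens q (cls q (vc * x)) (cls q (va * y)) + otens q (cls q (vd * x)) (cls q (vc * y))"
  "cgen q Gd (otens q (cls q x) (cls q y)) =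
    otens q (cls q (vc * x)) (cls q (vb * y)) + otens q (cls q (vd * x)) (cls q (vd * y))"
  by (simp_all add: cgen_def lmul_cls)

text \<open>Words are kept bracketed to the right, so a relation at the front of a longer word can
  be used for rewriting only in this form with a trailing factor.\<close>

lemma Oq_relations_mult:
  shows "cls q (va * (vb * x)) = scl q (cls q (vb * (va * x)))"
    and "cls q (va * (vc * x)) = scl q (cls q (vc * (va * x)))"
    and "cls q (vb * (vd * x)) = scl q (cls q (vd * (vb * x)))"
    and "cls q (vc * (vd * x)) = scl q (cls q (vd * (vc * x)))"
    and "cls q (vb * (vc * x)) = cls q (vc * (vb * x))"
    and "cls q (va * (vd * x)) = scl q (cls q (vb * (vc * x))) + cls q x"
    and "cls q (vd * (va * x)) = scl (inverse q) (cls q (vb * (vc * x))) + cls q x"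
proof -
  have *: "cls q (y * x) = cls q (z * x)" if "cls q y = cls q z" for y z
    by (rule cls_mult_cong[OF that refl])
  note simps = Oq_relations cls_scl cls_add mult.assoc distrib_right fscl_mult_left mult_1_left
  show "cls q (va * (vb * x)) = scl q (cls q (vb * (va * x)))"
    using *[of "va * vb" "fscl q (vb * va)"] unfolding simps by blast
  show "cls q (va * (vc * x)) = scl q (cls q (vc * (va * x)))"
    using *[of "va * vc" "fscl q (vc * va)"] unfolding simps by blast
  show "cls q (vb * (vd * x)) = scl q (cls q (vd * (vb * x)))"
    using *[of "vb * vd" "fscl q (vd * vb)"] unfolding simps by blast
  show "cls q (vc * (vd * x)) = scl q (cls q (vd * (vc * x)))"
    using *[of "vc * vd" "fscl q (vd * vc)"] unfolding simps by blast
  show "cls q (vb * (vc * x)) = cls q (vc * (vb * x))"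
    using *[of "vb * vc" "vc * vb"] unfolding simps by blast
  show "cls q (va * (vd * x)) = scl q (cls q (vb * (vc * x))) + cls q x"
    using *[of "va * vd" "fscl q (vb * vc) + 1"] unfolding simps by blast
  show "cls q (vd * (va * x)) = scl (inverse q) (cls q (vb * (vc * x))) + cls q x"
    using *[of "vd * va" "fscl (inverse q) (vb * vc) + 1"] unfolding simps by blast
qed

text \<open>By linearity elementary tensors suffice. There both legs are put in normal order and the
  mixed terms cancel: the comultiplication respects the relations.\<close>

lemma cm_relators:
  fixes q :: "'k::field"
  assumes "q \<noteq> 0" "r \<in> relators q" "T \<in> OT q"
  shows "cm.act q r T = 0"
proof (rule tensor_space_induct[OF assms(3), of "\<lambda>T. cm.act q r T = 0"])
  fix X Y assume "X \<in> Oq_carrier q" "Y \<in> Oq_carrier q"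
  then obtain x y where xy: "X = cls q x" "Y = cls q y"
    by (auto simp: Oq_carrier_def)
  have t: "otens q (cls q x) (cls q y) \<in> OT q" for x y by (simp add: tens_in)
  note sub = fs.subspace_scale[OF subspace_Oq_carrier] fs.subspace_add[OF subspace_Oq_carrier]
  note ops = cm.act_diff cm.act_mult[OF t] cm.act_fscl[OF t] cm.act_var cm.act_one
    cgen_cls cm.act1_add[OF t t] Oq_relations_mult tens_add_left tens_add_right tens_scl_left
    tens_scl_right sub cls_in
  show "cm.act q r (otens q X Y) = 0"
    using assms(2) unfolding xy
    by (rule relatorsE; simp only: ops) (simp_all add: fun_eq_iff scl_def field_simps assms(1))
qed (simp_all add: cm.act_add_right cm.act_scale_right)

lemma foldr_eq_on:
  assumes "m \<in> M" "\<And>g m. m \<in> M \<Longrightarrow> f g m = h g m" "\<And>g m. m \<in> M \<Longrightarrow> h g m \<in> M"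
  shows "foldr f gs m = foldr h gs m"
proof -
  have "foldr h gs m \<in> M \<and> foldr f gs m = foldr h gs m"
    by (induction gs) (simp_all add: assms)
  then show ?thesis ..
qed

lemma Oq_comult_cls:
  fixes q :: "'k::field"
  assumes "q \<noteq> 0"
  shows "Oq_comult q (cls q x) = cm.act q x (otens q (cls q 1) (cls q 1))"
proof -
  have one: "otens q (cls q 1) (cls q 1) \<in> OT q" by (simp add: tens_in)
  have gen: "Oq_tens_mult q (case g of
          Ga \<Rightarrow> Oq_tens q (var Ga) (var Ga) + Oq_tens q (var Gb) (var Gc)
        | Gb \<Rightarrow> Oq_tens q (var Ga) (var Gb) + Oq_tens q (var Gb) (var Gd)
        | Gc \<Rightarrow> Oq_tens q (var Gc) (var Ga) + Oq_tens q (var Gd) (var Gc)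
        | Gd \<Rightarrow> Oq_tens q (var Gc) (var Gb) + Oq_tens q (var Gd) (var Gd)) T = cgen q g T"
    if "T \<in> OT q" for g T
    using that by (cases g) (simp_all add: Oq_tens_def Oq_tens_mult_add Oq_tens_mult_tens cgen_def)
  have fold: "foldr (\<lambda>g. Oq_tens_mult q (case g of
          Ga \<Rightarrow> Oq_tens q (var Ga) (var Ga) + Oq_tens q (var Gb) (var Gc)
        | Gb \<Rightarrow> Oq_tens q (var Ga) (var Gb) + Oq_tens q (var Gb) (var Gd)
        | Gc \<Rightarrow> Oq_tens q (var Gc) (var Ga) + Oq_tens q (var Gd) (var Gc)
        | Gd \<Rightarrow> Oq_tens q (var Gc) (var Gb) + Oq_tens q (var Gd) (var Gd)))
      gs (otens q (cls q 1) (cls q 1)) = foldr (cgen q) gs (otens q (cls q 1) (cls q 1))"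
    for gs :: "gen list"
    by (rule foldr_eq_on[OF one]) (simp_all only: gen cm.act1_in)
  have "Oq_comult q (cls q x) = cm.act q (rep q (cls q x)) (otens q (cls q 1) (cls q 1))"
    unfolding Oq_comult_def free_lift_def cm.act_def Oq_tens_def[of q 1 1] fold ..
  also have "\<dots> = cm.act q x (otens q (cls q 1) (cls q 1))"
    by (rule cm.act_rep[OF cm_relators one]) (use assms in auto)
  finally show ?thesis .
qed

section \<open>Matrix coefficients\<close>

definition shift :: "(nat \<Rightarrow> 'a::zero) \<Rightarrow> nat \<Rightarrow> 'a"
  where "shift G i = (if i = 0 then 0 else G (i - 1))"

lemma shift_simps [simp]: "shift G 0 = 0" "shift G (Suc i) = G i"
  by (simp_all add: shift_def)

text \<open>
  A sequence \<open>G\<close> stands for \<open>\<Sum>\<^sub>i y\<^sup>i x\<^sup>n\<^sup>-\<^sup>i \<otimes> G\<^sub>i\<close>, where \<open>x y = q y x\<close>. Then \<open>Lmul q p r\<close> is left multiplication by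
  \<open>x \<otimes> p + y \<otimes> r\<close>, and \<open>Rmul q n p r\<close> is right multiplication by it, with \<open>n\<close> the degree of the result.
  So \<open>col q j s\<close> below is the coaction on \<open>y\<^sup>j x\<^sup>s\<close>.
\<close>

definition Lmul :: "'k::field \<Rightarrow> 'k free_alg \<Rightarrow> 'k free_alg \<Rightarrow> (nat \<Rightarrow> 'k free_alg) \<Rightarrow> nat \<Rightarrow> 'k free_alg"
  where "Lmul q p r G i = fscl (q ^ i) (p * G i) + r * shift G i"

definition Rmul :: "'k::field \<Rightarrow> nat \<Rightarrow> 'k free_alg \<Rightarrow> 'k free_alg \<Rightarrow> (nat \<Rightarrow> 'k free_alg) \<Rightarrow> nat \<Rightarrow> 'k free_alg"
  where "Rmul q n p r G i = G i * p + fscl (q ^ n * inverse q ^ i) (shift G i * r)"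

abbreviation "Lx q \<equiv> Lmul q va vc"
abbreviation "Ly q \<equiv> Lmul q vb vd"

definition col0 :: "nat \<Rightarrow> 'k::field free_alg"
  where "col0 i = (if i = 0 then 1 else 0)"

definition col :: "'k::field \<Rightarrow> nat \<Rightarrow> nat \<Rightarrow> nat \<Rightarrow> 'k free_alg"
  where "col q j s = (Ly q ^^ j) ((Lx q ^^ s) col0)"

lemma col_Suc_left: "col q (Suc j) s = Ly q (col q j s)"
  by (simp add: col_def)

lemma col_0_Suc: "col q 0 (Suc s) = Lx q (col q 0 s)"
  by (simp add: col_def)

lemma col_0_0: "col q 0 0 = col0"
  by (simp add: col_def)

lemma Lmul_support:
  assumes "\<And>i. i > n \<Longrightarrow> G i = 0" "i > Suc n"
  shows "Lmul q p r G i = 0"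
  using assms by (cases i) (auto simp: Lmul_def)

lemma col_support: "i > j + s \<Longrightarrow> col q j s i = 0"
proof (induction j arbitrary: i)
  case 0
  then show ?case
  proof (induction s arbitrary: i)
    case (Suc s)
    then show ?case by (simp add: col_0_Suc Lmul_support[of s])
  qed (simp add: col_0_0 col0_def)
next
  case (Suc j)
  then show ?case by (simp add: col_Suc_left Lmul_support[of "j + s"])
qed

text \<open>The coefficient at y^0 takes the x-part of every factor, hence only a and b occur. Row 0
  of the coefficient matrix thus consists of the basis monomials, which \<open>phi\<close> shows to
  be nonzero.\<close>

lemma col_at_0: "col q j s 0 = vb ^ j * va ^ s"
proof (induction j)
  case 0
  show ?case by (induction s) (simp_all add: col_0_0 col_0_Suc col0_def Lmul_def)
qed (simp add: col_Suc_left Lmul_def mult.assoc)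

definition seq_eq :: "'k::field \<Rightarrow> (nat \<Rightarrow> 'k free_alg) \<Rightarrow> (nat \<Rightarrow> 'k free_alg) \<Rightarrow> bool"
  where "seq_eq q G H \<longleftrightarrow> (\<forall>i. cls q (G i) = cls q (H i))"

lemma seq_eq_refl [simp]: "seq_eq q G G"
  by (simp add: seq_eq_def)

lemma Lmul_cong:
  assumes "seq_eq q G H"
  shows "seq_eq q (Lmul q p r G) (Lmul q p r H)"
proof -
  have *: "cls q (x * G i) = cls q (x * H i)" for x i
    by (rule cls_mult_cong) (use assms in \<open>simp_all add: seq_eq_def\<close>)
  have "cls q (Lmul q p r G i) = cls q (Lmul q p r H i)" for i
    by (cases i) (simp_all add: Lmul_def cls_add cls_scl *)
  then show ?thesis by (simp add: seq_eq_def)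
qed

lemma Lmul_fscl: "Lmul q p r (\<lambda>i. fscl c (G i)) = (\<lambda>i. fscl c (Lmul q p r G i))"
  by (auto simp: fun_eq_iff Lmul_def shift_def fa.scale_right_distrib fscl_mult_right mult.commute)

lemma seq_eq_fscl: "seq_eq q G H \<Longrightarrow> seq_eq q (\<lambda>i. fscl c (G i)) (\<lambda>i. fscl c (H i))"
  by (simp add: seq_eq_def cls_scl)

text \<open>The coaction respects x y = q y x. Comparing coefficients uses a b = q b a, c d = q d c
  and, in the mixed term, both determinant relations together with b c = c b.\<close>

lemma Lx_Ly:
  assumes "q \<noteq> 0"
  shows "seq_eq q (Lx q (Ly q G)) (\<lambda>i. fscl q (Ly q (Lx q G) i))"
  unfolding seq_eq_def
proof
  fix i
  consider "i = 0" | "i = 1" | k where "i = Suc (Suc k)"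
    by (metis One_nat_def not0_implies_Suc)
  then show "cls q (Lx q (Ly q G) i) = cls q (fscl q (Ly q (Lx q G) i))"
    using assms
    by cases
      (simp_all add: Lmul_def cls_add cls_scl distrib_left fscl_mult_right Oq_relations_mult scl_def
        fun_eq_iff field_simps)
qed

lemma Lx_col:
  assumes "q \<noteq> 0"
  shows "seq_eq q (Lx q (col q j s)) (\<lambda>i. fscl (q ^ j) (col q j (Suc s) i))"
proof (induction j)
  case (Suc j)
  have "seq_eq q (Lx q (Ly q (col q j s))) (\<lambda>i. fscl q (Ly q (Lx q (col q j s)) i))"
    by (rule Lx_Ly[OF assms])
  moreover have "seq_eq q (\<lambda>i. fscl q (Ly q (Lx q (col q j s)) i))
      (\<lambda>i. fscl q (Ly q (\<lambda>i. fscl (q ^ j) (col q j (Suc s) i)) i))"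
    by (intro seq_eq_fscl Lmul_cong Suc)
  ultimately show ?case
    by (simp add: col_Suc_left Lmul_fscl seq_eq_def)
qed (simp add: col_0_Suc)

text \<open>Left and right multiplication commute already in the free algebra, by associativity and
  bookkeeping of powers of q. The exponent written as \<open>q ^ n * inverse q ^ i\<close> keeps
  this valid for i > n, where n - i would be truncated.\<close>

lemma Rmul_Lmul:
  fixes q :: "'k::field"
  assumes "q \<noteq> 0"
  shows "Rmul q (Suc n) p r (Lmul q p' r' G) = Lmul q p' r' (Rmul q n p r G)"
proof
  fix i
  consider "i = 0" | "i = 1" | k where "i = Suc (Suc k)"
    by (metis One_nat_def not0_implies_Suc)
  then show "Rmul q (Suc n) p r (Lmul q p' r' G) i = Lmul q p' r' (Rmul q n p r G) i"
    using assms
    by cases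
      (simp_all add: Lmul_def Rmul_def distrib_left distrib_right fscl_mult_left fscl_mult_right
        mult.assoc fa.scale_right_distrib field_simps)
qed

lemma Rmul_col0:
  assumes "q \<noteq> 0"
  shows "Rmul q (Suc 0) p r col0 = Lmul q p r col0"
proof
  fix i
  show "Rmul q (Suc 0) p r col0 i = Lmul q p r col0 i"
    using assms by (cases i) (auto simp: Rmul_def Lmul_def col0_def shift_def)
qed

text \<open>The product y^j x^s x is in normal order, so this is an equality in the free algebra. An
  x on the left or a y on the right must be reordered, which costs a power of q and holds only
  between classes.\<close>

lemma Rx_col:
  assumes "q \<noteq> 0"
  shows "Rmul q (Suc (j + s)) va vc (col q j s) = col q j (Suc s)"
proof (induction j)
  case 0
  show ?case
  proof (induction s)
    case (Suc s)
    then show ?case by (simp add: Rmul_Lmul assms col_0_Suc)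
  qed (simp add: col_0_0 col_0_Suc Rmul_col0 assms)
next
  case (Suc j)
  then show ?case by (simp add: col_Suc_left Rmul_Lmul assms)
qed

lemma Ry_col:
  assumes "q \<noteq> 0"
  shows "seq_eq q (Rmul q (Suc (j + s)) vb vd (col q j s)) (\<lambda>i. fscl (q ^ s) (col q (Suc j) s i))"
proof (induction j)
  case 0
  \<comment> \<open>Right multiplication passes through all left factors down to
    \<open>col0\<close>, where right and left multiplication agree; the y created there is then
    moved out through the factors x.\<close>
  have "Rmul q (Suc s) vb vd (col q 0 s) = (Lx q ^^ s) (Ly q col0)"
  proof (induction s)
    case (Suc s)
    then show ?case by (simp add: Rmul_Lmul assms col_0_Suc[of q s])
  qed (simp add: col_0_0 Rmul_col0 assms)
  moreover have "seq_eq q ((Lx q ^^ s) (Ly q col0)) (\<lambda>i. fscl (q ^ s) (col q 1 s i))"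
  proof (induction s)
    case (Suc s)
    have "seq_eq q (Lx q ((Lx q ^^ s) (Ly q col0))) (Lx q (\<lambda>i. fscl (q ^ s) (col q 1 s i)))"
      by (rule Lmul_cong[OF Suc])
    also have "Lx q (\<lambda>i. fscl (q ^ s) (col q 1 s i)) = (\<lambda>i. fscl (q ^ s) (Lx q (col q 1 s) i))"
      by (rule Lmul_fscl)
    finally have "seq_eq q ((Lx q ^^ Suc s) (Ly q col0)) (\<lambda>i. fscl (q ^ s) (Lx q (col q 1 s) i))"
      by simp
    moreover have "seq_eq q (\<lambda>i. fscl (q ^ s) (Lx q (col q 1 s) i))
        (\<lambda>i. fscl (q ^ s) (fscl (q ^ 1) (col q 1 (Suc s) i)))"
      by (intro seq_eq_fscl Lx_col assms)
    ultimately show ?case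
      by (simp add: seq_eq_def mult.commute)
  qed (simp add: col_Suc_left col_0_0)
  ultimately show ?case by simp
next
  case (Suc j)
  have "seq_eq q (Ly q (Rmul q (Suc (j + s)) vb vd (col q j s))) (Ly q (\<lambda>i. fscl (q ^ s) (col q (Suc j) s i)))"
    by (rule Lmul_cong[OF Suc])
  then show ?case
    by (simp add: col_Suc_left Rmul_Lmul assms Lmul_fscl)
qed

text \<open>The q-Pochhammer symbol (q^2; q^2)_n. It differs from the factorial in q^2 by a power of
  1 - q^2, which cancels in binomials.\<close>

definition qfac :: "'k::field \<Rightarrow> nat \<Rightarrow> 'k"
  where "qfac q n = (\<Prod>i<n. 1 - q ^ (2 * Suc i))"

lemma qfac_simps [simp]: "qfac q 0 = 1" "qfac q (Suc n) = qfac q n * (1 - q ^ (2 * Suc n))"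
  by (simp_all add: qfac_def)

lemma qfac_nonzero:
  assumes "\<forall>n>0. q ^ n \<noteq> 1"
  shows "qfac q n \<noteq> 0"
proof (induction n)
  case (Suc n)
  have "q ^ (2 * Suc n) \<noteq> 1" using assms[rule_format, of "2 * Suc n"] by simp
  then show ?case using Suc by (metis eq_iff_diff_eq_0 mult_eq_0_iff qfac_simps(2))
qed simp

text \<open>\<open>(-q)\<^sup>k\<close> times the Gaussian binomial coefficient in \<open>q\<^sup>2\<close>.\<close>

definition zcoef :: "'k::field \<Rightarrow> nat \<Rightarrow> nat \<Rightarrow> 'k"
  where "zcoef q n k = (if k \<le> n then (- q) ^ k * qfac q n / (qfac q k * qfac q (n - k)) else 0)"

text \<open>Pascal's rule for Gaussian binomials in q^2. The two terms are the two ways of nesting: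
  x e_k and e_(m-k) y each cost q^k in normal ordering, while y e_k and e_(m-k) x cost nothing and
  carry the factor -q.\<close>

lemma zcoef_Suc:
  assumes "\<forall>n>0. q ^ n \<noteq> 1"
  shows "zcoef q (Suc m) k = q ^ (2 * k) * zcoef q m k - q * shift (zcoef q m) k"
proof -
  note nz = qfac_nonzero[OF assms]
  \<comment> \<open>The boundary cases rely on the zero values of \<open>zcoef\<close> and
    \<open>shift\<close>; in the interior, k' and d replace k and m so that no truncated subtraction
    remains.\<close>
  consider "k = 0" | "k = Suc m" | "k > Suc m" | k' d where "k = Suc k'" "m = Suc (k' + d)"
  proof -
    assume *: "k = 0 \<Longrightarrow> thesis" "k = Suc m \<Longrightarrow> thesis" "k > Suc m \<Longrightarrow> thesis"
      "\<And>k' d. k = Suc k' \<Longrightarrow> m = Suc (k' + d) \<Longrightarrow> thesis"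
    show thesis
    proof (cases k)
      case (Suc k')
      then show ?thesis using * less_iff_Suc_add[of k' m] by (metis Suc_lessI not_less_eq)
    qed (use * in simp)
  qed
  then show ?thesis
  proof cases
    case 4
    have nz2: "1 - q ^ (2 * Suc i) \<noteq> 0" for i
      using assms by (metis eq_iff_diff_eq_0 nat_0_less_mult_iff zero_less_Suc zero_less_numeral)
    define A where "A = qfac q k'"
    define B where "B = qfac q d"
    define C where "C = qfac q m"
    define a where "a = q ^ (2 * Suc k')"
    define b where "b = q ^ (2 * Suc d)"
    have ab: "q ^ (2 * Suc m) = a * b"
      by (simp add: a_def b_def 4 algebra_simps flip: power_add)
    have n: "A \<noteq> 0" "B \<noteq> 0" "1 - a \<noteq> 0" "1 - b \<noteq> 0"
      by (simp_all only: A_def B_def a_def b_def nz nz2 not_False_eq_True)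
    have z1: "zcoef q (Suc m) k = (- q) ^ Suc k' * (C * (1 - q ^ (2 * Suc m))) / (A * (1 - a) * (B * (1 - b)))"
      by (simp add: zcoef_def 4 A_def B_def C_def a_def b_def del: power_Suc mult_Suc_right)
    have z2: "zcoef q m k = (- q) ^ Suc k' * C / (A * (1 - a) * B)"
      by (simp add: zcoef_def 4 A_def B_def C_def a_def del: power_Suc mult_Suc_right)
    have z3: "shift (zcoef q m) k = (- q) ^ k' * C / (A * (B * (1 - b)))"
      by (simp add: zcoef_def 4 A_def B_def C_def b_def del: power_Suc mult_Suc_right)
    have z4: "q ^ (2 * k) = a" by (simp add: a_def 4)
    show ?thesis
      unfolding z1 z2 z3 z4 ab using n by (simp add: divide_simps) (simp add: algebra_simps)
  next
    case 2
    then show ?thesis using nz[of m] nz[of "Suc m"] by (simp add: zcoef_def del: qfac_simps(2))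
  qed (use nz[of m] nz[of "Suc m"] in \<open>simp_all add: zcoef_def shift_def del: qfac_simps(2)\<close>)
qed

lemma zcoef_0_0: "zcoef q 0 0 = 1"
  by (simp add: zcoef_def)

lemma zcoef_nonzero:
  assumes "q \<noteq> 0" "\<forall>n>0. q ^ n \<noteq> 1" "k \<le> n"
  shows "zcoef q n k \<noteq> 0"
  using qfac_nonzero[OF assms(2)] assms(1,3) by (simp add: zcoef_def)

text \<open>The Gaussian binomial is symmetric, so only (-q)^(n-k) is compared with (-q)^k; this is
  the source of the sign in the indicator. The factor q^n clears negative exponents.\<close>

lemma zcoef_sym:
  assumes "q \<noteq> 0" "k \<le> n"
  shows "q ^ n * zcoef q n (n - k) = (- 1) ^ n * q ^ (2 * (n - k)) * zcoef q n k"
proof -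
  obtain d where d: "n = k + d" using assms(2) le_Suc_ex by blast
  define X where "X = qfac q n / (qfac q k * qfac q d)"
  have z: "zcoef q n (n - k) = (- q) ^ d * X" "zcoef q n k = (- q) ^ k * X"
    by (simp_all add: zcoef_def X_def d mult.commute)
  have m: "(- q) ^ i = (- 1) ^ i * q ^ i" for i
    by (rule power_minus)
  have e: "(- 1) ^ n * (- 1) ^ k = ((- 1) ^ d :: 'a)"
    unfolding d by (simp add: power_add mult.commute flip: power_mult_distrib)
  have "(- 1) ^ n * q ^ (2 * (n - k)) * zcoef q n k
      = ((- 1) ^ n * (- 1) ^ k) * (q ^ (2 * d) * q ^ k) * X"
    unfolding z m by (simp add: d mult_ac)
  also have "q ^ (2 * d) * q ^ k = q ^ n * q ^ d"
    unfolding d by (simp add: mult_2 add_ac flip: power_add)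
  finally show ?thesis unfolding e z m by (simp only: mult_ac)
qed

text \<open>The character turns the generator matrix into diag(q^-1, q), so it rescales x by q^-1
  and y by q.\<close>

lemma gamma_free_col:
  assumes "q \<noteq> 0"
  shows "gamma_free q (col q j s i) = (if i = j then q ^ j * inverse q ^ s else 0)"
proof (induction j arbitrary: i)
  case 0
  show ?case
    by (induction s arbitrary: i)
      (auto simp: col_0_0 col0_def col_0_Suc Lmul_def gamma_free_mult shift_def)
qed (auto simp: col_Suc_left Lmul_def gamma_free_mult shift_def assms)

definition anti :: "'k::field \<Rightarrow> 'k free_alg \<Rightarrow> 'k free_alg"
  where "anti q x = ant.act q x 1"

lemma anti_simps [simp]:
  "anti q (x + y) = anti q x + anti q y" "anti q (fscl c x) = fscl c (anti q x)" "anti q 0 = 0"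
  "anti q 1 = 1" "anti q (var g * x) = anti q x * sgen q g"
  by (simp_all add: anti_def ant.act_add ant.act_fscl ant.act_mult)

lemma cls_anti_cong: "q \<noteq> 0 \<Longrightarrow> cls q x = cls q y \<Longrightarrow> cls q (anti q x) = cls q (anti q y)"
  by (metis Oq_antipode_cls anti_def)

lemma gamma_free_anti_col:
  assumes "q \<noteq> 0"
  shows "gamma_free q (anti q (col q j s i)) = (if i = j then inverse q ^ j * q ^ s else 0)"
proof (induction j arbitrary: i)
  case 0
  show ?case
    by (induction s arbitrary: i)
      (auto simp: col_0_0 col0_def col_0_Suc Lmul_def gamma_free_mult shift_def)
qed (auto simp: col_Suc_left Lmul_def gamma_free_mult shift_def assms)

section \<open>The coefficient matrix, its invariant and its inverse\<close>

definition umat :: "'k::field \<Rightarrow> nat \<Rightarrow> nat \<Rightarrow> nat \<Rightarrow> 'k free_alg"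
  where "umat q n i j = col q j (n - j) i"

lemma umat_support: "i > n \<Longrightarrow> j \<le> n \<Longrightarrow> umat q n i j = 0"
  by (simp add: umat_def col_support)

lemma cls_fscl_cong: "cls q x = cls q y \<Longrightarrow> cls q (fscl c x) = cls q (fscl c y)"
  by (simp add: cls_scl)

lemma fscl_sum: "fscl c (sum f A) = (\<Sum>i\<in>A. fscl c (f i))"
  by (rule fa.scale_sum_right)

text \<open>
  With \<open>e\<^sub>k = y\<^sup>k x\<^sup>n\<^sup>-\<^sup>k\<close>, the sum \<open>\<Sum>\<^sub>k z\<^sub>k e\<^sub>k \<otimes> e\<^sub>n\<^sub>-\<^sub>k\<close> is an invariant of \<open>X \<otimes> X\<close>: the next one arises by inserting the previous one in the middle
  of the invariant \<open>x \<otimes> y - q y \<otimes> x\<close>, multiplying the first factor from the left and the second one from the right.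
\<close>

lemma sandwich_expand:
  "(\<Sum>k\<in>K. fscl (z k) (Lmul q p r (G k) i * Rmul q n p' r' (H k) l)) =
    fscl (q ^ i) (p * (\<Sum>k\<in>K. fscl (z k) (G k i * H k l)) * p')
    + fscl (q ^ i * (q ^ n * inverse q ^ l)) (p * (\<Sum>k\<in>K. fscl (z k) (G k i * shift (H k) l)) * r')
    + r * (\<Sum>k\<in>K. fscl (z k) (shift (G k) i * H k l)) * p'
    + fscl (q ^ n * inverse q ^ l) (r * (\<Sum>k\<in>K. fscl (z k) (shift (G k) i * shift (H k) l)) * r')"
proof -
  have "fscl (z k) (Lmul q p r (G k) i * Rmul q n p' r' (H k) l) =
      fscl (q ^ i) (p * fscl (z k) (G k i * H k l) * p')
      + fscl (q ^ i * (q ^ n * inverse q ^ l)) (p * fscl (z k) (G k i * shift (H k) l) * r')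
      + r * fscl (z k) (shift (G k) i * H k l) * p'
      + fscl (q ^ n * inverse q ^ l) (r * fscl (z k) (shift (G k) i * shift (H k) l) * r')" for k
    by (simp add: Lmul_def Rmul_def distrib_left distrib_right fscl_mult_left fscl_mult_right
        fa.scale_right_distrib mult_ac add_ac)
  then show ?thesis
    by (simp add: sum.distrib sum_distrib_left sum_distrib_right fscl_sum)
qed

text \<open>X and Y stand for the powers of q in \<open>sandwich_expand\<close>, and the w's for its
  inner sums, already known to be scalar. The outer terms vanish by a b = q b a and c d = q d c; the
  middle ones are a d - q b c = 1 and c b - q d a = -q.\<close>

lemma invariant_relations:
  assumes "q \<noteq> 0"
  shows "scl X (scl w00 (cls q (va * vb))) + scl (X * Y) (scl w01 (cls q (va * vd)))
      + scl w10 (cls q (vc * vb)) + scl Y (scl w11 (cls q (vc * vd)))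
    - scl q (scl X (scl w00 (cls q (vb * va))) + scl (X * Y) (scl w01 (cls q (vb * vc)))
      + scl w10 (cls q (vd * va)) + scl Y (scl w11 (cls q (vd * vc))))
    = scl (X * Y * w01 - q * w10) (cls q 1)"
  using assms by (simp add: Oq_relations fun_eq_iff scl_def) (simp add: field_simps)

text \<open>The induction nests the previous invariant and replaces it by its scalar value. In
  matrix form this is the entry (i, l) of u z u^T = z, where z has \<open>zcoef q n k\<close> at (k,
  n - k).\<close>

lemma invariant_tensor:
  fixes q :: "'k::field"
  assumes q: "q \<noteq> 0" "\<forall>n>0. q ^ n \<noteq> 1"
  shows "cls q (\<Sum>k\<le>n. fscl (zcoef q n k) (umat q n i k * umat q n l (n - k)))
    = (if i + l = n then scl (zcoef q n i) (cls q 1) else 0)"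
proof (induction n arbitrary: i l)
  case 0
  show ?case by (auto simp: zcoef_0_0 umat_def col_0_0 col0_def)
next
  case (Suc m)
  let ?n = "Suc m"
  define W where "W i l = (\<Sum>k\<le>m. fscl (zcoef q m k) (umat q m i k * umat q m l (m - k)))" for i l
  define w where "w i l = (if i + l = m then zcoef q m i else 0)" for i l
  have W: "cls q (W i l) = scl (w i l) (cls q 1)" for i l
    using Suc by (simp add: W_def w_def zero_fun_def)
  have sW: "cls q (p * W i l * r) = scl (w i l) (cls q (p * r))" for p r i l
  proof -
    have "cls q (p * W i l * r) = cls q (p * fscl (w i l) 1 * r)"
      by (intro cls_mult_cong) (simp_all add: W cls_scl)
    then show ?thesis by (simp add: fscl_mult_left fscl_mult_right cls_scl)
  qed
  have W01: "(\<Sum>k\<le>m. fscl (zcoef q m k) (umat q m i k * shift (\<lambda>l. umat q m l (m - k)) l))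
      = shift (W i) l" for i l
    by (cases l) (simp_all add: W_def)
  have W10: "(\<Sum>k\<le>m. fscl (zcoef q m k) (shift (\<lambda>i. umat q m i k) i * umat q m l (m - k)))
      = shift (\<lambda>i. W i l) i" for i l
    by (cases i) (simp_all add: W_def)
  have W11: "(\<Sum>k\<le>m. fscl (zcoef q m k) (shift (\<lambda>i. umat q m i k) i * shift (\<lambda>l. umat q m l (m - k)) l))
      = shift (\<lambda>i. shift (W i) l) i" for i l
    by (cases i; cases l) (simp_all add: W_def)
  note expand = sandwich_expand[where G = "\<lambda>k i. umat q m i k" and H = "\<lambda>k l. umat q m l (m - k)"
    and z = "zcoef q m" and K = "{..m}" and q = q and n = ?n, unfolded W01 W10 W11 W_def[symmetric]]
  \<comment> \<open>The x in front of e_k and the y behind e_(m-k) each yield q^k, hence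
    q^(2k).\<close>
  have xy: "cls q (\<Sum>k\<le>m. fscl (q ^ (2 * k) * zcoef q m k) (umat q ?n i k * umat q ?n l (?n - k)))
      = cls q (\<Sum>k\<le>m. fscl (zcoef q m k)
          (Lx q (\<lambda>i. umat q m i k) i * Rmul q ?n vb vd (\<lambda>l. umat q m l (m - k)) l))"
    unfolding cls_sum
  proof (intro sum.cong refl)
    fix k assume "k \<in> {..m}"
    then have k: "k \<le> m" by simp
    have "cls q (Lx q (\<lambda>i. umat q m i k) i) = cls q (fscl (q ^ k) (umat q ?n i k))"
      using Lx_col[OF q(1), of k "m - k"] k by (simp add: seq_eq_def umat_def Suc_diff_le)
    moreover have "cls q (Rmul q ?n vb vd (\<lambda>l. umat q m l (m - k)) l)
        = cls q (fscl (q ^ k) (umat q ?n l (?n - k)))"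
      using Ry_col[OF q(1), of "m - k" k] k by (simp add: seq_eq_def umat_def Suc_diff_le)
    ultimately have "cls q (Lx q (\<lambda>i. umat q m i k) i * Rmul q ?n vb vd (\<lambda>l. umat q m l (m - k)) l)
      = cls q (fscl (q ^ k) (umat q ?n i k) * fscl (q ^ k) (umat q ?n l (?n - k)))"
      by (rule cls_mult_cong)
    then show "cls q (fscl (q ^ (2 * k) * zcoef q m k) (umat q ?n i k * umat q ?n l (?n - k)))
      = cls q (fscl (zcoef q m k)
          (Lx q (\<lambda>i. umat q m i k) i * Rmul q ?n vb vd (\<lambda>l. umat q m l (m - k)) l))"
      by (simp add: cls_scl fscl_mult_left fscl_mult_right mult_2_right power_add mult_ac)
  qed
  \<comment> \<open>Both products are already in normal order; only the index moves.\<close>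
  have yx: "(\<Sum>k\<le>m. fscl (zcoef q m k) (umat q ?n i (Suc k) * umat q ?n l (m - k)))
      = (\<Sum>k\<le>m. fscl (zcoef q m k)
          (Ly q (\<lambda>i. umat q m i k) i * Rmul q ?n va vc (\<lambda>l. umat q m l (m - k)) l))"
  proof (intro sum.cong refl)
    fix k assume "k \<in> {..m}"
    then have k: "k \<le> m" by simp
    have "Ly q (\<lambda>i. umat q m i k) i = umat q ?n i (Suc k)"
      using k by (simp add: umat_def col_Suc_left)
    moreover have "Rmul q ?n va vc (\<lambda>l. umat q m l (m - k)) l = umat q ?n l (m - k)"
      using Rx_col[OF q(1), of "m - k" k] k by (simp add: umat_def Suc_diff_le)
    ultimately show "fscl (zcoef q m k) (umat q ?n i (Suc k) * umat q ?n l (m - k))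
      = fscl (zcoef q m k)
          (Ly q (\<lambda>i. umat q m i k) i * Rmul q ?n va vc (\<lambda>l. umat q m l (m - k)) l)"
      by simp
  qed
  have "(\<Sum>k\<le>?n. fscl (zcoef q ?n k) (umat q ?n i k * umat q ?n l (?n - k)))
      = (\<Sum>k\<le>?n. fscl (q ^ (2 * k) * zcoef q m k) (umat q ?n i k * umat q ?n l (?n - k)))
        - fscl q (\<Sum>k\<le>?n. fscl (shift (zcoef q m) k) (umat q ?n i k * umat q ?n l (?n - k)))"
    by (simp only: zcoef_Suc[OF q(2)] fa.scale_left_diff_distrib sum_subtractf fscl_sum fa.scale_scale)
  also have "(\<Sum>k\<le>?n. fscl (q ^ (2 * k) * zcoef q m k) (umat q ?n i k * umat q ?n l (?n - k)))
      = (\<Sum>k\<le>m. fscl (q ^ (2 * k) * zcoef q m k) (umat q ?n i k * umat q ?n l (?n - k)))"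
    by (simp add: zcoef_def)
  also have "(\<Sum>k\<le>?n. fscl (shift (zcoef q m) k) (umat q ?n i k * umat q ?n l (?n - k)))
      = (\<Sum>k\<le>m. fscl (zcoef q m k) (umat q ?n i (Suc k) * umat q ?n l (m - k)))"
    by (simp add: sum.atMost_Suc_shift del: sum.atMost_Suc)
  finally have "cls q (\<Sum>k\<le>?n. fscl (zcoef q ?n k) (umat q ?n i k * umat q ?n l (?n - k)))
      = cls q (\<Sum>k\<le>m. fscl (zcoef q m k)
          (Lx q (\<lambda>i. umat q m i k) i * Rmul q ?n vb vd (\<lambda>l. umat q m l (m - k)) l))
        - scl q (cls q (\<Sum>k\<le>m. fscl (zcoef q m k)
          (Ly q (\<lambda>i. umat q m i k) i * Rmul q ?n va vc (\<lambda>l. umat q m l (m - k)) l)))"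
    by (simp only: cls_diff cls_scl xy yx)
  also have "\<dots> = (if i + l = ?n then scl (zcoef q ?n i) (cls q 1) else 0)"
  proof -
    define w01 where "w01 = (if l = 0 then 0 else w i (l - 1))"
    define w10 where "w10 = (if i = 0 then 0 else w (i - 1) l)"
    define w11 where "w11 = (if i = 0 \<or> l = 0 then 0 else w (i - 1) (l - 1))"
    have s01: "cls q (p * shift (W i) l * r) = scl w01 (cls q (p * r))" for p r
      by (cases l) (simp_all add: w01_def sW)
    have s10: "cls q (p * shift (\<lambda>i. W i l) i * r) = scl w10 (cls q (p * r))" for p r
      by (cases i) (simp_all add: w10_def sW)
    have s11: "cls q (p * shift (\<lambda>i. shift (W i) l) i * r) = scl w11 (cls q (p * r))" for p r
      by (cases i; cases l) (simp_all add: w11_def sW)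
    \<comment> \<open>On i + l = m + 1 the powers of q combine to q^(2i), so the scalars satisfy
      \<open>zcoef_Suc\<close> again, now in the row index.\<close>
    have "q ^ i * (q ^ Suc m * inverse q ^ l) * w01 - q * w10
        = (if i + l = ?n then zcoef q ?n i else 0)"
    proof -
      have "q ^ Suc m * inverse q ^ l = q ^ i" if "i + l = ?n"
        using q(1) by (simp add: that[symmetric] power_add power_inverse del: power_Suc)
      \<comment> \<open>If l = 0 then i = m + 1, where \<open>zcoef q m i\<close> is zero as
        well.\<close>
      moreover have "w01 = (if i + l = ?n then zcoef q m i else 0)"
        by (cases l) (auto simp: w01_def w_def zcoef_def)
      moreover have "w10 = (if i + l = ?n then shift (zcoef q m) i else 0)"
        by (cases i) (auto simp: w10_def w_def)
      ultimately show ?thesis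
        by (auto simp: zcoef_Suc[OF q(2)] power_add mult_2)
    qed
    then show ?thesis
      unfolding expand cls_add cls_scl sW s01 s10 s11 invariant_relations[OF q(1)] by simp
  qed
  finally show ?case .
qed

lemma anti_Lmul:
  "anti q (Lmul q (var g) (var h) G k) =
    fscl (q ^ k) (anti q (G k) * sgen q g) + shift (\<lambda>k. anti q (G k)) k * sgen q h"
  by (cases k) (simp_all add: Lmul_def)

text \<open>S reverses products, so the generator split off from S(u) meets the one split off by
  \<open>Lmul\<close>. Summation over the common index pairs them to S(a) p + S(b) r and S(c) p +
  S(d) r, the middle factors on the right. For (p, r) a column of the generator matrix these are 0
  or 1 modulo the relations.\<close>

lemma antipode_sandwich:
  fixes q :: "'k::field"
  assumes q: "q \<noteq> 0" and g: "\<And>i. i > m \<Longrightarrow> g i = 0"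
  shows "cls q (\<Sum>i\<le>Suc m. anti q (umat q (Suc m) k i) * Lmul q p r g i) =
    cls q (fscl (q ^ k) (\<Sum>i\<le>m. anti q (umat q m k i) * (vd * p - fscl (inverse q) (vb * r)) * g i)
      + shift (\<lambda>k. \<Sum>i\<le>m. anti q (umat q m k i) * (va * r - fscl q (vc * p)) * g i) k)"
proof -
  let ?A = "\<lambda>i. anti q (umat q (Suc m) k i)"
  let ?B = "\<lambda>i k. anti q (umat q m k i)"
  have "(\<Sum>i\<le>Suc m. ?A i * Lmul q p r g i)
      = (\<Sum>i\<le>Suc m. fscl (q ^ i) (?A i) * p * g i) + (\<Sum>i\<le>Suc m. ?A i * r * shift g i)"
    by (simp add: Lmul_def distrib_left fscl_mult_left fscl_mult_right mult.assoc sum.distrib)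
  \<comment> \<open>The last p-term and the first r-term vanish, so both sums run over the entries
    of g from 0 to m.\<close>
  also have "(\<Sum>i\<le>Suc m. fscl (q ^ i) (?A i) * p * g i) = (\<Sum>i\<le>m. fscl (q ^ i) (?A i) * p * g i)"
    by (simp add: g)
  also have "(\<Sum>i\<le>Suc m. ?A i * r * shift g i) = (\<Sum>i\<le>m. ?A (Suc i) * r * g i)"
    by (simp add: sum.atMost_Suc_shift del: sum.atMost_Suc)
  also have "(\<Sum>i\<le>m. fscl (q ^ i) (?A i) * p * g i) + (\<Sum>i\<le>m. ?A (Suc i) * r * g i)
      = (\<Sum>i\<le>m. fscl (q ^ i) (?A i) * p * g i + ?A (Suc i) * r * g i)"
    by (simp add: sum.distrib)
  finally have 1: "cls q (\<Sum>i\<le>Suc m. ?A i * Lmul q p r g i)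
      = (\<Sum>i\<le>m. cls q (fscl (q ^ i) (?A i) * p * g i + ?A (Suc i) * r * g i))"
    by (simp add: cls_sum)
  have 2: "cls q (fscl (q ^ i) (?A i) * p * g i + ?A (Suc i) * r * g i)
      = cls q (fscl (q ^ k) (?B i k * (vd * p - fscl (inverse q) (vb * r)) * g i)
          + shift (?B i) k * (va * r - fscl q (vc * p)) * g i)" if i: "i \<le> m" for i
  proof -
    \<comment> \<open>The power q^i in \<open>Lmul\<close> is what turns column i in degree m + 1
      into x times column i in degree m.\<close>
    have "cls q (anti q (Lx q (\<lambda>k. umat q m k i) k)) = cls q (anti q (fscl (q ^ i) (umat q (Suc m) k i)))"
      using Lx_col[OF q, of i "m - i"] i
      by (intro cls_anti_cong q) (simp add: seq_eq_def umat_def Suc_diff_le)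
    then have "cls q (fscl (q ^ i) (?A i)) = cls q (anti q (Lx q (\<lambda>k. umat q m k i) k))"
      by simp
    then have "cls q (fscl (q ^ i) (?A i) * p * g i)
        = cls q (anti q (Lx q (\<lambda>k. umat q m k i) k) * p * g i)"
      by (intro cls_mult_cong refl)
    moreover have "?A (Suc i) = anti q (Ly q (\<lambda>k. umat q m k i) k)"
      using i by (simp add: umat_def col_Suc_left)
    ultimately have "cls q (fscl (q ^ i) (?A i) * p * g i + ?A (Suc i) * r * g i)
        = cls q (anti q (Lx q (\<lambda>k. umat q m k i) k) * p * g i
            + anti q (Ly q (\<lambda>k. umat q m k i) k) * r * g i)"
      by (simp add: cls_add)
    also have "anti q (Lx q (\<lambda>k. umat q m k i) k) * p * g i
            + anti q (Ly q (\<lambda>k. umat q m k i) k) * r * g i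
        = fscl (q ^ k) (?B i k * (vd * p - fscl (inverse q) (vb * r)) * g i)
          + shift (?B i) k * (va * r - fscl q (vc * p)) * g i"
      by (simp add: anti_Lmul distrib_left distrib_right right_diff_distrib left_diff_distrib
          fscl_mult_left fscl_mult_right mult.assoc fa.scale_right_distrib
          fa.scale_right_diff_distrib algebra_simps)
    finally show ?thesis .
  qed
  have "(\<Sum>i\<le>m. cls q (fscl (q ^ i) (?A i) * p * g i + ?A (Suc i) * r * g i))
      = cls q (\<Sum>i\<le>m. fscl (q ^ k) (?B i k * (vd * p - fscl (inverse q) (vb * r)) * g i)
          + shift (?B i) k * (va * r - fscl q (vc * p)) * g i)"
    unfolding cls_sum by (intro sum.cong refl 2) simp
  also have "(\<Sum>i\<le>m. fscl (q ^ k) (?B i k * (vd * p - fscl (inverse q) (vb * r)) * g i)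
          + shift (?B i) k * (va * r - fscl q (vc * p)) * g i)
      = fscl (q ^ k) (\<Sum>i\<le>m. ?B i k * (vd * p - fscl (inverse q) (vb * r)) * g i)
        + shift (\<lambda>k. \<Sum>i\<le>m. ?B i k * (va * r - fscl q (vc * p)) * g i) k"
    by (cases k) (simp_all add: sum.distrib fscl_sum)
  finally show ?thesis unfolding 1 .
qed

lemma sum_cls_middle:
  assumes "cls q x = scl c (cls q 1)"
  shows "cls q (\<Sum>i\<in>I. f i * x * g i) = scl c (cls q (\<Sum>i\<in>I. f i * g i))"
proof -
  have "cls q (f i * x * g i) = scl c (cls q (f i * g i))" for i
  proof -
    have "cls q (f i * x * g i) = cls q (f i * fscl c 1 * g i)"
      by (intro cls_mult_cong refl) (simp add: assms cls_scl)
    then show ?thesis by (simp add: fscl_mult_left fscl_mult_right cls_scl)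
  qed
  then show ?thesis by (simp add: cls_sum fs.scale_sum_right)
qed

text \<open>Column 0 is x times column 0 of the previous degree and column j + 1 is y times column
  j, so \<open>antipode_sandwich\<close> applies with (p, r) = (a, c) or (b, d).\<close>

lemma antipode_umat:
  fixes q :: "'k::field"
  assumes q: "q \<noteq> 0"
  shows "j \<le> n \<Longrightarrow> cls q (\<Sum>i\<le>n. anti q (umat q n k i) * umat q n i j) = cls q (if k = j then 1 else 0)"
proof (induction n arbitrary: k j)
  case 0
  then show ?case by (simp add: umat_def col_0_0 col0_def)
next
  case (Suc m)
  have IH: "cls q (\<Sum>i\<le>m. anti q (umat q m k i) * umat q m i j) = cls q (if k = j then 1 else 0)"
    if "j \<le> m" for j k
    using Suc.IH[OF that] by simp
  have [simp]: "cls q (shift G k) = shift (\<lambda>k. cls q (G k)) k" for G k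
    by (cases k) simp_all
  show ?case
  proof (cases j)
    case 0
    have g: "umat q m i 0 = 0" if "i > m" for i
      using that by (simp add: umat_support)
    have "(\<lambda>i. umat q (Suc m) i j) = Lx q (\<lambda>i. umat q m i 0)"
      by (simp add: umat_def col_0_Suc 0 fun_eq_iff)
    then have "cls q (\<Sum>i\<le>Suc m. anti q (umat q (Suc m) k i) * umat q (Suc m) i j)
        = cls q (\<Sum>i\<le>Suc m. anti q (umat q (Suc m) k i) * Lx q (\<lambda>i. umat q m i 0) i)"
      by (metis (no_types, lifting))
    also have "\<dots> = cls q (fscl (q ^ k) (\<Sum>i\<le>m. anti q (umat q m k i) * (vd * va - fscl (inverse q) (vb * vc)) * umat q m i 0)
      + shift (\<lambda>k. \<Sum>i\<le>m. anti q (umat q m k i) * (va * vc - fscl q (vc * va)) * umat q m i 0) k)"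
      by (rule antipode_sandwich[OF q g])
    also have "\<dots> = scl (q ^ k) (cls q (if k = 0 then 1 else 0))"
    proof -
      have 1: "cls q (vd * va - fscl (inverse q) (vb * vc)) = scl 1 (cls q 1)"
        by (simp add: cls_diff cls_scl Oq_relations)
      have 2: "cls q (va * vc - fscl q (vc * va)) = scl 0 (cls q 1)"
        by (simp add: cls_diff cls_scl Oq_relations)
      show ?thesis
        unfolding cls_add cls_scl sum_cls_middle[OF 1] IH[OF le0]
        by (cases k) (simp_all add: sum_cls_middle[OF 2])
    qed
    finally show ?thesis using 0 by (auto simp: cls_scl)
  next
    case (Suc j')
    then have j': "j' \<le> m" using Suc.prems by simp
    have g: "umat q m i j' = 0" if "i > m" for i
      using that j' by (simp add: umat_support)
    have "(\<lambda>i. umat q (Suc m) i j) = Ly q (\<lambda>i. umat q m i j')"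
      by (simp add: umat_def col_Suc_left Suc fun_eq_iff)
    then have "cls q (\<Sum>i\<le>Suc m. anti q (umat q (Suc m) k i) * umat q (Suc m) i j)
        = cls q (\<Sum>i\<le>Suc m. anti q (umat q (Suc m) k i) * Ly q (\<lambda>i. umat q m i j') i)"
      by (metis (no_types, lifting))
    also have "\<dots> = cls q (fscl (q ^ k) (\<Sum>i\<le>m. anti q (umat q m k i) * (vd * vb - fscl (inverse q) (vb * vd)) * umat q m i j')
      + shift (\<lambda>k. \<Sum>i\<le>m. anti q (umat q m k i) * (va * vd - fscl q (vc * vb)) * umat q m i j') k)"
      by (rule antipode_sandwich[OF q g])
    also have "\<dots> = shift (\<lambda>k. cls q (if k = j' then 1 else 0)) k"
    proof -
      have 1: "cls q (vd * vb - fscl (inverse q) (vb * vd)) = scl 0 (cls q 1)"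
        using q by (simp add: cls_diff cls_scl Oq_relations)
      have 2: "cls q (va * vd - fscl q (vc * vb)) = scl 1 (cls q 1)"
        by (simp add: cls_diff cls_scl Oq_relations)
      show ?thesis
        unfolding cls_add cls_scl sum_cls_middle[OF 1]
        by (cases k) (simp_all add: sum_cls_middle[OF 2] IH[OF j'])
    qed
    finally show ?thesis using Suc by (cases k) auto
  qed
qed

lemma antipode_umat_zcoef:
  fixes q :: "'k::field"
  assumes q: "q \<noteq> 0" "\<forall>n>0. q ^ n \<noteq> 1" and "j \<le> n" "k \<le> n"
  shows "scl (zcoef q n j) (cls q (anti q (umat q n (n - k) j)))
    = scl (zcoef q n (n - k)) (cls q (umat q n (n - j) k))"
proof -
  let ?S = "\<lambda>i. anti q (umat q n (n - k) i)"
  let ?U = "umat q n"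
  \<comment> \<open>T is the entry (n - k, n - j) of S(u) u z u^T, evaluated once by u z u^T = z and
    once by S(u) u = 1.\<close>
  define T where "T = (\<Sum>i\<le>n. \<Sum>h\<le>n. fscl (zcoef q n h) (?S i * ?U i h * ?U (n - j) (n - h)))"
  have "T = (\<Sum>i\<le>n. ?S i * (\<Sum>h\<le>n. fscl (zcoef q n h) (?U i h * ?U (n - j) (n - h))))"
    by (simp add: T_def sum_distrib_left fscl_mult_right mult.assoc)
  then have "cls q T = (\<Sum>i\<le>n. cls q (?S i * (\<Sum>h\<le>n. fscl (zcoef q n h) (?U i h * ?U (n - j) (n - h)))))"
    by (simp add: cls_sum)
  also have "\<dots> = (\<Sum>i\<le>n. cls q (?S i * fscl (if i = j then zcoef q n i else 0) 1))"
  proof (intro sum.cong refl cls_mult_cong)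
    fix i
    show "cls q (\<Sum>h\<le>n. fscl (zcoef q n h) (?U i h * ?U (n - j) (n - h)))
        = cls q (fscl (if i = j then zcoef q n i else 0) 1)"
      using assms(3) by (subst invariant_tensor[OF q]) (auto simp: cls_scl)
  qed
  also have "\<dots> = (\<Sum>i\<le>n. if i = j then scl (zcoef q n i) (cls q (?S i)) else 0)"
    by (intro sum.cong refl) (simp add: fscl_mult_right cls_scl)
  also have "\<dots> = scl (zcoef q n j) (cls q (?S j))"
    using assms(3) by (subst sum.delta) simp_all
  finally have 1: "cls q T = scl (zcoef q n j) (cls q (?S j))" .
  have "T = (\<Sum>h\<le>n. fscl (zcoef q n h) ((\<Sum>i\<le>n. ?S i * ?U i h) * ?U (n - j) (n - h)))"
    unfolding T_def by (subst sum.swap) (simp add: sum_distrib_right fscl_sum)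
  then have "cls q T = (\<Sum>h\<le>n. scl (zcoef q n h) (cls q ((\<Sum>i\<le>n. ?S i * ?U i h) * ?U (n - j) (n - h))))"
    by (simp add: cls_sum cls_scl)
  also have "\<dots> = (\<Sum>h\<le>n. if n - k = h then scl (zcoef q n h) (cls q (?U (n - j) (n - h))) else 0)"
  proof (intro sum.cong refl)
    fix h assume "h \<in> {..n}"
    then have "cls q ((\<Sum>i\<le>n. ?S i * ?U i h) * ?U (n - j) (n - h))
        = cls q ((if n - k = h then 1 else 0) * ?U (n - j) (n - h))"
      by (intro cls_mult_cong antipode_umat q(1) refl) simp
    then show "scl (zcoef q n h) (cls q ((\<Sum>i\<le>n. ?S i * ?U i h) * ?U (n - j) (n - h)))
        = (if n - k = h then scl (zcoef q n h) (cls q (?U (n - j) (n - h))) else 0)"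
      by simp
  qed
  also have "\<dots> = scl (zcoef q n (n - k)) (cls q (?U (n - j) k))"
    using assms(4) by (subst sum.delta') simp_all
  finally show ?thesis using 1 by simp
qed

section \<open>The coproduct of the monomials\<close>

lemma cls_va_vb_power:
  "cls q (va * (vb ^ i * x)) = cls q (fscl (q ^ i) (vb ^ i * (va * x)))"
proof (induction i)
  case (Suc i)
  have "cls q (va * (vb * (vb ^ i * x))) = cls q (fscl q (vb * (va * (vb ^ i * x))))"
    by (simp add: Oq_relations_mult cls_scl)
  also have "cls q (vb * (va * (vb ^ i * x))) = cls q (vb * fscl (q ^ i) (vb ^ i * (va * x)))"
    by (intro cls_mult_cong refl Suc)
  then have "cls q (fscl q (vb * (va * (vb ^ i * x))))
      = cls q (fscl q (vb * fscl (q ^ i) (vb ^ i * (va * x))))"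
    by (rule cls_fscl_cong)
  finally show ?case by (simp add: fscl_mult_right mult.assoc)
qed simp

text \<open>The letters are ordered oppositely to \<open>X_space\<close>: with b in front,
  multiplication by b gives a monomial again and a passes with a power of q, as in
  \<open>Lmul\<close>.\<close>

definition mon :: "nat \<Rightarrow> nat \<Rightarrow> 'k::field free_alg"
  where "mon n i = vb ^ i * va ^ (n - i)"

lemma va_mon: "i \<le> n \<Longrightarrow> cls q (va * mon n i) = scl (q ^ i) (cls q (mon (Suc n) i))"
  using cls_va_vb_power[of q i "va ^ (n - i)"] by (simp add: mon_def cls_scl Suc_diff_le)

lemma vb_mon: "vb * mon n i = mon (Suc n) (Suc i)"
  by (simp add: mon_def mult.assoc)

text \<open>\<open>Lmul\<close> is realised in O_q by x = a and y = b, which satisfy x y = q y x;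
  the right tensor factor carries the sequence G.\<close>

lemma otens_mon_step:
  fixes q :: "'k::field"
  assumes G: "\<And>i. i > n \<Longrightarrow> G i = 0"
  shows "(\<Sum>i\<le>n. otens q (cls q (va * mon n i)) (cls q (p * G i))
      + otens q (cls q (vb * mon n i)) (cls q (r * G i)))
    = (\<Sum>i\<le>Suc n. otens q (cls q (mon (Suc n) i)) (cls q (Lmul q p r G i)))"
proof -
  let ?e = "\<lambda>i. cls q (mon (Suc n) i)"
  have z: "otens q X 0 = 0" if "X \<in> Oq_carrier q" for X
    using that by (intro tens_zero_right fs.subspace_0 subspace_Oq_carrier)
  have "(\<Sum>i\<le>Suc n. otens q (?e i) (cls q (Lmul q p r G i)))
      = (\<Sum>i\<le>Suc n. otens q (?e i) (scl (q ^ i) (cls q (p * G i))))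
        + (\<Sum>i\<le>Suc n. otens q (?e i) (cls q (r * shift G i)))"
    unfolding sum.distrib[symmetric]
    by (intro sum.cong refl)
      (simp add: Lmul_def cls_add cls_scl tens_add_right fs.subspace_scale[OF subspace_Oq_carrier])
  also have "(\<Sum>i\<le>Suc n. otens q (?e i) (scl (q ^ i) (cls q (p * G i))))
      = (\<Sum>i\<le>n. otens q (?e i) (scl (q ^ i) (cls q (p * G i))))"
    by (simp add: G z)
  also have "\<dots> = (\<Sum>i\<le>n. otens q (cls q (va * mon n i)) (cls q (p * G i)))"
    by (intro sum.cong refl) (simp add: va_mon tens_scl_left tens_scl_right)
  also have "(\<Sum>i\<le>Suc n. otens q (?e i) (cls q (r * shift G i)))
      = (\<Sum>i\<le>n. otens q (cls q (vb * mon n i)) (cls q (r * G i)))"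
    by (simp add: sum.atMost_Suc_shift z vb_mon del: sum.atMost_Suc)
  finally show ?thesis unfolding sum.distrib by (rule sym)
qed

text \<open>The coproducts of a and b have the form a \<otimes> p + b \<otimes> r with (p, r) = (a,
  c) and (b, d), so each letter is one application of \<open>otens_mon_step\<close>.\<close>

lemma cm_act_mon:
  fixes q :: "'k::field"
  shows "cm.act q (vb ^ j * va ^ s) (otens q (cls q 1) (cls q 1))
    = (\<Sum>i\<le>j + s. otens q (cls q (mon (j + s) i)) (cls q (col q j s i)))"
proof -
  define one where "one = otens q (cls q 1) (cls q 1)"
  have one: "one \<in> OT q" unfolding one_def by (simp add: tens_in)
  define P where "P j s \<longleftrightarrow> cm.act q (vb ^ j * va ^ s) one
    = (\<Sum>i\<le>j + s. otens q (cls q (mon (j + s) i)) (cls q (col q j s i)))" for j s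
  have cgen_sum: "cgen q g (\<Sum>i\<in>I. otens q (cls q (x i)) (cls q (y i)))
      = (\<Sum>i\<in>I. cgen q g (otens q (cls q (x i)) (cls q (y i))))" for g x y and I :: "nat set"
  proof -
    have "cgen q g 0 = 0" by (cases g) (simp_all add: cgen_def)
    then show ?thesis
      by (intro sum_additive_on[of "OT q" "cgen q g"])
        (simp_all add: cm.act1_add tens_in fs.subspace_0 fs.subspace_add subspace_tensor_space)
  qed
  have "P 0 0" by (simp add: P_def col_0_0 col0_def mon_def one_def)
  moreover have "P 0 (Suc s)" if "P 0 s" for s
  proof -
    have "cm.act q (va ^ Suc s) one = cgen q Ga (\<Sum>i\<le>s. otens q (cls q (mon s i)) (cls q (col q 0 s i)))"
      using that one by (simp add: P_def cm.act_mult)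
    also have "\<dots> = (\<Sum>i\<le>Suc s. otens q (cls q (mon (Suc s) i)) (cls q (Lx q (col q 0 s) i)))"
      unfolding cgen_sum cgen_cls by (intro otens_mon_step col_support) simp
    finally show ?thesis by (simp add: P_def col_0_Suc)
  qed
  ultimately have "P 0 s" for s by (induction s) blast+
  moreover have "P (Suc j) s" if "P j s" for j s
  proof -
    have "cm.act q (vb ^ Suc j * va ^ s) one
        = cgen q Gb (\<Sum>i\<le>j + s. otens q (cls q (mon (j + s) i)) (cls q (col q j s i)))"
      using that one by (simp add: P_def cm.act_mult mult.assoc)
    also have "\<dots> = (\<Sum>i\<le>Suc (j + s). otens q (cls q (mon (Suc (j + s)) i)) (cls q (Ly q (col q j s) i)))"
      unfolding cgen_sum cgen_cls by (intro otens_mon_step col_support) simp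
    finally show ?thesis by (simp add: P_def col_Suc_left)
  qed
  ultimately have "P j s" by (induction j) blast+
  then show ?thesis by (simp add: P_def one_def)
qed

section \<open>Comodules with a basis\<close>

text \<open>Vectors are functions, so the i-th coordinate can be the value at a point
  \<open>p i\<close>. The dual then has the same form, with the vectors \<open>e i\<close> as
  evaluation points.\<close>

locale coordinates =
  fixes V :: "('x \<Rightarrow> 'k::field) set" and n :: nat and e :: "nat \<Rightarrow> 'x \<Rightarrow> 'k" and p :: "nat \<Rightarrow> 'x"
  assumes V_span: "V = fs.span (e ` {..n})"
    and dual_basis: "i \<le> n \<Longrightarrow> j \<le> n \<Longrightarrow> e j (p i) = (if i = j then 1 else 0)"
begin

lemma basis_in: "i \<le> n \<Longrightarrow> e i \<in> V"
  unfolding V_span by (rule fs.span_base) simp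

lemma subspace_V: "fs.subspace V"
  by (simp add: V_span)

lemma expand:
  assumes "v \<in> V"
  shows "v = (\<Sum>i\<le>n. scl (v (p i)) (e i))"
proof -
  let ?S = "{v. v = (\<Sum>i\<le>n. scl (v (p i)) (e i))}"
  have "fs.span (e ` {..n}) \<subseteq> ?S"
  proof (rule fs.span_minimal)
    show "e ` {..n} \<subseteq> ?S"
    proof (rule image_subsetI, rule CollectI)
      fix j assume "j \<in> {..n}"
      then have j: "j \<le> n" by simp
      have "(\<Sum>i\<le>n. scl (e j (p i)) (e i)) = (\<Sum>i\<le>n. if i = j then e i else 0)"
        using j by (intro sum.cong refl) (simp add: dual_basis)
      then show "e j = (\<Sum>i\<le>n. scl (e j (p i)) (e i))"
        using j by simp
    qed
    show "fs.subspace ?S"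
    proof (rule fs.subspaceI)
      fix v w assume "v \<in> ?S" "w \<in> ?S"
      then have "v = (\<Sum>i\<le>n. scl (v (p i)) (e i))" "w = (\<Sum>i\<le>n. scl (w (p i)) (e i))"
        by simp_all
      then have "v + w = (\<Sum>i\<le>n. scl (v (p i)) (e i)) + (\<Sum>i\<le>n. scl (w (p i)) (e i))"
        by (rule arg_cong2)
      also have "\<dots> = (\<Sum>i\<le>n. scl ((v + w) (p i)) (e i))"
        by (simp add: fs.scale_left_distrib sum.distrib)
      finally show "v + w \<in> ?S" unfolding mem_Collect_eq .
    next
      fix c v assume "v \<in> ?S"
      then have "v = (\<Sum>i\<le>n. scl (v (p i)) (e i))" by simp
      then have "scl c v = scl c (\<Sum>i\<le>n. scl (v (p i)) (e i))" by (rule arg_cong)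
      also have "\<dots> = (\<Sum>i\<le>n. scl (scl c v (p i)) (e i))"
        by (simp add: fs.scale_sum_right scl_apply)
      finally show "scl c v \<in> ?S" unfolding mem_Collect_eq .
    qed simp
  qed
  then show ?thesis using assms V_span by blast
qed

lemma form_on_sum:
  assumes \<phi>: "form_on V \<phi>" and "\<And>i. i \<in> I \<Longrightarrow> v i \<in> V"
  shows "\<phi> (\<Sum>i\<in>I. scl (c i) (v i)) = (\<Sum>i\<in>I. c i * \<phi> (v i))"
proof -
  have "\<phi> 0 = 0"
    using form_onD(2)[OF \<phi> fs.subspace_0[OF subspace_V], of 0] by simp
  then have "\<phi> (\<Sum>i\<in>I. scl (c i) (v i)) = (\<Sum>i\<in>I. \<phi> (scl (c i) (v i)))"
    using assms fs.subspace_0[OF subspace_V] fs.subspace_add[OF subspace_V]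
      fs.subspace_scale[OF subspace_V]
    by (intro sum_additive_on[of V \<phi>]) (simp_all add: form_onD[OF \<phi>])
  then show ?thesis using assms by (simp add: form_onD(2)[OF \<phi>])
qed

lemma form_on_expand:
  assumes "form_on V \<phi>" "v \<in> V"
  shows "\<phi> v = (\<Sum>i\<le>n. v (p i) * \<phi> (e i))"
proof -
  have "\<phi> v = \<phi> (\<Sum>i\<le>n. scl (v (p i)) (e i))"
    using expand[OF assms(2)] by (rule arg_cong)
  also have "\<dots> = (\<Sum>i\<le>n. v (p i) * \<phi> (e i))"
    by (rule form_on_sum[OF assms(1)]) (simp_all add: basis_in)
  finally show ?thesis .
qed

text \<open>The i-th coordinate form tensored with the identity of the second factor.\<close>

definition slice :: "nat \<Rightarrow> ('x, 'h, 'k) tensor \<Rightarrow> 'h \<Rightarrow> 'k"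
  where "slice i t = tlift (\<lambda>v h. scl (v (p i)) h) t"

lemma slice_tens: "slice i (tens V W v w) = scl (v (p i)) w"
  unfolding slice_def
  by (rule tlift_tens)
    (auto simp: linear_on_def fs.scale_right_distrib fs.scale_left_distrib scl_apply mult.commute)

lemma slice_zero [simp]: "slice i 0 = 0"
  by (simp add: slice_def)

lemma slice_sum: "slice i (sum t I) = (\<Sum>j\<in>I. slice i (t j))"
  by (simp add: slice_def tlift_sum)

lemma slice_combination:
  "i \<le> n \<Longrightarrow> slice i (\<Sum>j\<le>n. tens V W (e j) (h j)) = h i"
proof -
  assume i: "i \<le> n"
  have "slice i (\<Sum>j\<le>n. tens V W (e j) (h j)) = (\<Sum>j\<le>n. if j = i then h j else 0)"
    unfolding slice_sum slice_tens by (intro sum.cong refl) (use i in \<open>auto simp: dual_basis\<close>)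
  also have "\<dots> = h i" using i by simp
  finally show ?thesis .
qed

lemma tensor_expand:
  assumes "fs.subspace W" "t \<in> tensor_space V W"
  shows "t = (\<Sum>i\<le>n. tens V W (e i) (slice i t)) \<and> (\<forall>i. slice i t \<in> W)"
proof (rule tensor_space_induct[OF assms(2),
      of "\<lambda>t. t = (\<Sum>i\<le>n. tens V W (e i) (slice i t)) \<and> (\<forall>i. slice i t \<in> W)"])
  fix v w assume v: "v \<in> V" and w: "w \<in> W"
  have "tens V W v w = tens V W (\<Sum>i\<le>n. scl (v (p i)) (e i)) w"
    using expand[OF v] by (rule arg_cong)
  also have "\<dots> = (\<Sum>i\<le>n. tens V W (scl (v (p i)) (e i)) w)"
    by (intro tens_sum_left subspace_V w fs.subspace_scale basis_in) simp
  also have "\<dots> = (\<Sum>i\<le>n. tens V W (e i) (slice i (tens V W v w)))"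
    by (intro sum.cong refl) (simp add: slice_tens tens_scl_left tens_scl_right basis_in w)
  finally show "tens V W v w = (\<Sum>i\<le>n. tens V W (e i) (slice i (tens V W v w)))
      \<and> (\<forall>i. slice i (tens V W v w) \<in> W)"
    unfolding slice_tens by (auto intro: fs.subspace_scale assms(1) w)
next
  show "0 = (\<Sum>i\<le>n. tens V W (e i) (slice i 0)) \<and> (\<forall>i. slice i 0 \<in> W)"
    by (simp add: tens_zero_right basis_in fs.subspace_0 assms(1))
next
  fix s t assume s: "s = (\<Sum>i\<le>n. tens V W (e i) (slice i s)) \<and> (\<forall>i. slice i s \<in> W)"
    and t: "t = (\<Sum>i\<le>n. tens V W (e i) (slice i t)) \<and> (\<forall>i. slice i t \<in> W)"
  have sl: "slice i (s + t) = slice i s + slice i t" for i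
    by (simp add: slice_def tlift_add)
  have "s + t = (\<Sum>i\<le>n. tens V W (e i) (slice i s)) + (\<Sum>i\<le>n. tens V W (e i) (slice i t))"
    using conjunct1[OF s] conjunct1[OF t] by (rule arg_cong2)
  also have "\<dots> = (\<Sum>i\<le>n. tens V W (e i) (slice i (s + t)))"
    by (simp add: sl tens_add_right basis_in conjunct2[OF s] conjunct2[OF t] flip: sum.distrib)
  finally show "s + t = (\<Sum>i\<le>n. tens V W (e i) (slice i (s + t))) \<and> (\<forall>i. slice i (s + t) \<in> W)"
    using conjunct2[OF s] conjunct2[OF t] fs.subspace_add[OF assms(1)] unfolding sl by blast
next
  fix c t assume t: "t = (\<Sum>i\<le>n. tens V W (e i) (slice i t)) \<and> (\<forall>i. slice i t \<in> W)"
  have sl: "slice i (scl c t) = scl c (slice i t)" for i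
    by (simp add: slice_def tlift_scl)
  have "scl c t = scl c (\<Sum>i\<le>n. tens V W (e i) (slice i t))"
    using conjunct1[OF t] by (rule arg_cong)
  also have "\<dots> = (\<Sum>i\<le>n. tens V W (e i) (slice i (scl c t)))"
    by (simp add: sl tens_scl_right basis_in conjunct2[OF t] fs.scale_sum_right)
  finally show "scl c t = (\<Sum>i\<le>n. tens V W (e i) (slice i (scl c t))) \<and> (\<forall>i. slice i (scl c t) \<in> W)"
    using conjunct2[OF t] fs.subspace_scale[OF assms(1)] unfolding sl by blast
qed

text \<open>A tensor is recovered from its slices. This gives the uniqueness behind the definite
  descriptions of the coactions and splits an equation of coactions into components.\<close>

lemma tensor_eqI:
  assumes "fs.subspace W" "s \<in> tensor_space V W" "t \<in> tensor_space V W"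
    and "\<And>i. i \<le> n \<Longrightarrow> slice i s = slice i t"
  shows "s = t"
proof -
  have "s = (\<Sum>i\<le>n. tens V W (e i) (slice i s))"
    using tensor_expand[OF assms(1,2)] by blast
  also have "\<dots> = (\<Sum>i\<le>n. tens V W (e i) (slice i t))"
    by (intro sum.cong refl) (simp add: assms(4))
  also have "\<dots> = t"
    using tensor_expand[OF assms(1,3)] by metis
  finally show ?thesis .
qed

lemma combination_tensor_in:
  "(\<And>i. i \<le> n \<Longrightarrow> h i \<in> W) \<Longrightarrow> (\<Sum>i\<le>n. tens V W (e i) (h i)) \<in> tensor_space V W"
  by (intro fs.subspace_sum subspace_tensor_space tens_in basis_in) simp_all

definition dual_vec :: "nat \<Rightarrow> ('x \<Rightarrow> 'k) \<Rightarrow> 'k"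
  where "dual_vec i = (\<lambda>v. if v \<in> V then v (p i) else 0)"

lemma subspace_dual: "fs.subspace (dual V)"
proof (rule fs.subspaceI)
  show "0 \<in> dual V" by (simp add: dual_def form_on_def)
next
  fix \<phi> \<psi> assume "\<phi> \<in> dual V" "\<psi> \<in> dual V"
  then show "\<phi> + \<psi> \<in> dual V"
    by (simp add: dual_def form_on_def distrib_left add_ac)
next
  fix c \<phi> assume "\<phi> \<in> dual V"
  then show "scl c \<phi> \<in> dual V"
    by (simp add: dual_def form_on_def scl_apply[of c \<phi>] distrib_left mult.left_commute)
qed

lemma dual_vec_in: "dual_vec i \<in> dual V"
  using fs.subspace_add[OF subspace_V] fs.subspace_scale[OF subspace_V]
  by (simp add: dual_def form_on_def dual_vec_def scl_apply)

lemma dual_expand: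
  assumes "\<phi> \<in> dual V"
  shows "\<phi> = (\<Sum>i\<le>n. scl (\<phi> (e i)) (dual_vec i))"
proof
  fix v
  show "\<phi> v = (\<Sum>i\<le>n. scl (\<phi> (e i)) (dual_vec i)) v"
  proof (cases "v \<in> V")
    case True
    then show ?thesis
      using form_on_expand[of \<phi> v] assms
      by (simp add: dual_def sum_fun_apply scl_apply dual_vec_def mult.commute)
  next
    case False
    then show ?thesis
      using assms by (simp add: dual_def sum_fun_apply scl_apply dual_vec_def)
  qed
qed

lemma dual_coordinates: "coordinates (dual V) n dual_vec e"
proof
  show "dual V = fs.span (dual_vec ` {..n})"
  proof
    show "dual V \<subseteq> fs.span (dual_vec ` {..n})"
    proof
      fix \<phi> assume "\<phi> \<in> dual V"
      then have "\<phi> = (\<Sum>i\<le>n. scl (\<phi> (e i)) (dual_vec i))" by (rule dual_expand)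
      also have "\<dots> \<in> fs.span (dual_vec ` {..n})"
        by (intro fs.span_sum fs.span_scale fs.span_base) simp
      finally show "\<phi> \<in> fs.span (dual_vec ` {..n})" .
    qed
    show "fs.span (dual_vec ` {..n}) \<subseteq> dual V"
      by (rule fs.span_minimal) (auto simp: dual_vec_in subspace_dual)
  qed
  show "dual_vec j (e i) = (if i = j then 1 else 0)" if "i \<le> n" "j \<le> n" for i j
    using that by (auto simp: dual_vec_def basis_in dual_basis)
qed

end

lemma (in coordinates) to_dual_expand:
  assumes "linear_on V g" "g ` V \<subseteq> dual V" "v \<in> V" "w \<in> V"
  shows "g v w = (\<Sum>k\<le>n. v (p k) * (\<Sum>j\<le>n. w (p j) * g (e k) (e j)))"
proof -
  have "form_on V (\<lambda>v. g v w)"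
    using assms(1) by (simp add: form_on_def linear_on_def scl_apply)
  then have "g v w = (\<Sum>k\<le>n. v (p k) * g (e k) w)"
    using assms(3) by (rule form_on_expand)
  also have "\<dots> = (\<Sum>k\<le>n. v (p k) * (\<Sum>j\<le>n. w (p j) * g (e k) (e j)))"
  proof (intro sum.cong refl)
    fix k assume "k \<in> {..n}"
    then have "g (e k) \<in> dual V" using assms(2) basis_in by auto
    then have "form_on V (g (e k))" by (simp add: dual_def)
    from form_on_expand[OF this assms(4)]
    show "v (p k) * g (e k) w = v (p k) * (\<Sum>j\<le>n. w (p j) * g (e k) (e j))" by simp
  qed
  finally show ?thesis .
qed

lemma coideal_coact:
  assumes "coordinates V n e p" and "fs.subspace (alg H)" "V \<subseteq> alg H"
    and h: "\<And>i. i \<le> n \<Longrightarrow> h i \<in> alg H"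
    and comult: "comult H v = (\<Sum>i\<le>n. tens (alg H) (alg H) (e i) (h i))"
  shows "coact (coideal_comodule H V) v = (\<Sum>i\<le>n. tens V (alg H) (e i) (h i))"
proof -
  interpret coordinates V n e p by fact
  let ?t = "\<Sum>i\<le>n. tens V (alg H) (e i) (h i)"
  have "tlift (tens (alg H) (alg H)) (tens V (alg H) v w) = tens (alg H) (alg H) v w" for v w
    by (rule tlift_tens)
      (use assms(3) in \<open>auto simp: linear_on_def tens_add_left tens_add_right tens_scl_left
        tens_scl_right subset_iff\<close>)
  then have ex: "tlift (tens (alg H) (alg H)) ?t = comult H v"
    by (simp add: tlift_sum comult)
  \<comment> \<open>The form v(p i) w(z) makes sense on all of \<open>alg H\<close>, so slices can
    be read off after inclusion into the tensor square; hence the corestriction is unique.\<close>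
  have sl: "slice i t z = tlift (tens (alg H) (alg H)) t (\<lambda>v w. v (p i) * w z)" for i t z
  proof -
    have "(\<lambda>v w. v (p i) * w z) \<in> bilinear_forms (alg H) (alg H)"
      by (auto simp: bilinear_forms_def form_on_def scl_apply algebra_simps)
    then show ?thesis by (simp add: slice_def tlift_def tens_def scl_apply)
  qed
  show ?thesis
    unfolding coideal_comodule_def comodule.simps
  proof (rule the_equality)
    show "?t \<in> tensor_space V (alg H) \<and> tlift (tens (alg H) (alg H)) ?t = comult H v"
      using ex combination_tensor_in h by blast
    fix t assume t: "t \<in> tensor_space V (alg H) \<and> tlift (tens (alg H) (alg H)) t = comult H v"
    show "t = ?t"
      by (rule tensor_eqI[OF assms(2)])
        (use t ex combination_tensor_in h in \<open>auto simp: fun_eq_iff sl\<close>)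
  qed
qed

section \<open>Comodules given by a coefficient matrix, and their duals\<close>

locale matrix_comodule = coordinates V n e p
  for V :: "('x \<Rightarrow> 'k::field) set" and n e p +
  fixes H :: "('h, 'k) hopf" and M :: "('x, 'h, 'k) comodule" and u :: "nat \<Rightarrow> nat \<Rightarrow> 'h \<Rightarrow> 'k"
  assumes subspace_alg: "fs.subspace (alg H)"
    and space_M [simp]: "space M = V"
    and matrix_in: "i \<le> n \<Longrightarrow> j \<le> n \<Longrightarrow> u i j \<in> alg H"
    and coact_M: "v \<in> V \<Longrightarrow>
      coact M v = (\<Sum>i\<le>n. tens V (alg H) (e i) (\<Sum>j\<le>n. scl (v (p j)) (u i j)))"
    and antipode_linear: "linear_on (alg H) (antipode H)"
    and antipode_in: "h \<in> alg H \<Longrightarrow> antipode H h \<in> alg H"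
begin

abbreviation "A \<equiv> alg H"
abbreviation "S \<equiv> antipode H"

interpretation dual: coordinates "dual V" n dual_vec e
  by (rule dual_coordinates)

lemma row_in: "i \<le> n \<Longrightarrow> (\<Sum>j\<le>n. scl (c j) (u i j)) \<in> A"
  by (intro fs.subspace_sum fs.subspace_scale subspace_alg matrix_in) simp_all

lemma antipode_row:
  "i \<le> n \<Longrightarrow> S (\<Sum>j\<le>n. scl (c j) (u i j)) = (\<Sum>j\<le>n. scl (c j) (S (u i j)))"
proof -
  assume i: "i \<le> n"
  have lin: "S (v + w) = S v + S w" "S (scl c v) = scl c (S v)" if "v \<in> A" "w \<in> A" for v w c
    using antipode_linear that by (auto simp: linear_on_def)
  have S0: "S 0 = 0"
    using lin(2)[of 0 0 0] fs.subspace_0[OF subspace_alg] by simp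
  have "S (\<Sum>j\<le>n. scl (c j) (u i j)) = (\<Sum>j\<le>n. S (scl (c j) (u i j)))"
    by (rule sum_additive_on[of A S])
      (use i in \<open>simp_all add: lin S0 fs.subspace_0 fs.subspace_add fs.subspace_scale subspace_alg matrix_in\<close>)
  also have "\<dots> = (\<Sum>j\<le>n. scl (c j) (S (u i j)))"
    by (intro sum.cong refl lin(2) matrix_in) (use i matrix_in in auto)
  finally show ?thesis .
qed

lemma dual_row_in: "j \<le> n \<Longrightarrow> (\<Sum>i\<le>n. scl (c i) (S (u i j))) \<in> A"
  by (intro fs.subspace_sum fs.subspace_scale subspace_alg matrix_in antipode_in) simp_all

text \<open>At v = e_j the defining identity leaves the sum over i of \<phi>(e_i) S(u_ij), which is
  therefore the j-th slice.\<close>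

lemma coact_dual:
  assumes \<phi>: "\<phi> \<in> dual V"
  shows "coact (dual_comodule H M) \<phi>
    = (\<Sum>j\<le>n. tens (dual V) A (dual_vec j) (\<Sum>i\<le>n. scl (\<phi> (e i)) (S (u i j))))"
proof -
  let ?t = "\<Sum>j\<le>n. tens (dual V) A (dual_vec j) (\<Sum>i\<le>n. scl (\<phi> (e i)) (S (u i j)))"
  have form: "form_on V \<phi>" using \<phi> by (simp add: dual_def)
  have lhs: "tlift (\<lambda>g h. scl (g v) h) (tens (dual V) A g h) = scl (g v) h" for v g h
    by (rule tlift_tens)
      (auto simp: linear_on_def fs.scale_right_distrib fs.scale_left_distrib scl_apply mult.commute)
  have rhs: "tlift (\<lambda>w h. scl (\<phi> w) (S h)) (tens V A w h) = scl (\<phi> w) (S h)" for w h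
    by (rule tlift_tens)
      (use antipode_linear form in \<open>auto simp: linear_on_def form_on_def fs.scale_right_distrib
        fs.scale_left_distrib mult.commute\<close>)
  have t_in: "?t \<in> tensor_space (dual V) A"
    by (intro dual.combination_tensor_in dual_row_in)
  have eq: "tlift (\<lambda>g h. scl (g v) h) ?t = tlift (\<lambda>w h. scl (\<phi> w) (S h)) (coact M v)"
    if v: "v \<in> V" for v
  proof -
    have "tlift (\<lambda>g h. scl (g v) h) ?t = (\<Sum>j\<le>n. scl (v (p j)) (\<Sum>i\<le>n. scl (\<phi> (e i)) (S (u i j))))"
      unfolding tlift_sum lhs by (simp add: dual_vec_def v)
    also have "\<dots> = (\<Sum>i\<le>n. scl (\<phi> (e i)) (\<Sum>j\<le>n. scl (v (p j)) (S (u i j))))"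
      unfolding fs.scale_sum_right by (subst sum.swap) (simp add: mult.commute)
    also have "\<dots> = (\<Sum>i\<le>n. scl (\<phi> (e i)) (S (\<Sum>j\<le>n. scl (v (p j)) (u i j))))"
      by (intro sum.cong refl) (simp add: antipode_row)
    also have "\<dots> = tlift (\<lambda>w h. scl (\<phi> w) (S h)) (coact M v)"
      unfolding coact_M[OF v] tlift_sum rhs ..
    finally show ?thesis .
  qed
  show ?thesis
    unfolding dual_comodule_def comodule.simps space_M
  proof (rule the_equality)
    show "?t \<in> tensor_space (dual V) A \<and>
      (\<forall>v\<in>V. tlift (\<lambda>g h. scl (g v) h) ?t = tlift (\<lambda>w h. scl (\<phi> w) (S h)) (coact M v))"
      using t_in eq by blast
    fix t assume t: "t \<in> tensor_space (dual V) A \<and>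
      (\<forall>v\<in>V. tlift (\<lambda>g h. scl (g v) h) t = tlift (\<lambda>w h. scl (\<phi> w) (S h)) (coact M v))"
    show "t = ?t"
    proof (rule dual.tensor_eqI[OF subspace_alg])
      fix i assume "i \<le> n"
      then show "dual.slice i t = dual.slice i ?t"
        using t eq[of "e i"] basis_in[of i] by (simp add: dual.slice_def)
    qed (use t t_in in auto)
  qed
qed

lemma space_dual_comodule: "space (dual_comodule H M) = dual V"
  by (simp add: dual_comodule_def)

text \<open>By linearity the coaction condition is tested at v = e_k; its j-th slice is the entry
  (k, j) of u^T \<beta> = \<beta> S(u) with \<beta>_ij = g(e_i)(e_j).\<close>

lemma comodule_hom_dual_iff:
  "g \<in> comodule_hom H M (dual_comodule H M) \<longleftrightarrow>
    linear_on V g \<and> g ` V \<subseteq> dual V \<and> (\<forall>v. v \<notin> V \<longrightarrow> g v = 0) \<and>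
    (\<forall>k\<le>n. \<forall>j\<le>n. (\<Sum>i\<le>n. scl (g (e i) (e j)) (u i k)) = (\<Sum>i\<le>n. scl (g (e k) (e i)) (S (u i j))))"
proof -
  have "(\<forall>v\<in>V. coact (dual_comodule H M) (g v) = tlift (\<lambda>w h. tens (dual V) A (g w) h) (coact M v))
    \<longleftrightarrow> (\<forall>k\<le>n. \<forall>j\<le>n. (\<Sum>i\<le>n. scl (g (e i) (e j)) (u i k)) = (\<Sum>i\<le>n. scl (g (e k) (e i)) (S (u i j))))"
    if lin: "linear_on V g" and sub: "g ` V \<subseteq> dual V"
  proof -
    have gd: "g v \<in> dual V" if "v \<in> V" for v
      using sub that by (simp add: image_subset_iff)
    have tl: "tlift (\<lambda>w h. tens (dual V) A (g w) h) (tens V A w h) = tens (dual V) A (g w) h" for w h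
      by (rule tlift_tens)
        (use lin gd in \<open>auto simp: linear_on_def tens_add_left tens_add_right tens_scl_left tens_scl_right\<close>)
    have rhs: "tlift (\<lambda>w h. tens (dual V) A (g w) h) (coact M v)
        = (\<Sum>i\<le>n. tens (dual V) A (g (e i)) (\<Sum>k\<le>n. scl (v (p k)) (u i k)))" if "v \<in> V" for v
      unfolding coact_M[OF that] tlift_sum tl ..
    have iff: "coact (dual_comodule H M) (g v) = tlift (\<lambda>w h. tens (dual V) A (g w) h) (coact M v)
      \<longleftrightarrow> (\<forall>j\<le>n. (\<Sum>i\<le>n. scl (g v (e i)) (S (u i j)))
            = (\<Sum>i\<le>n. scl (g (e i) (e j)) (\<Sum>k\<le>n. scl (v (p k)) (u i k))))" (is "?L = ?R \<longleftrightarrow> ?C")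
      if v: "v \<in> V" for v
    proof -
      have L: "dual.slice j ?L = (\<Sum>i\<le>n. scl (g v (e i)) (S (u i j)))" if "j \<le> n" for j
        unfolding coact_dual[OF gd[OF v]] by (rule dual.slice_combination[OF that])
      have R: "dual.slice j ?R = (\<Sum>i\<le>n. scl (g (e i) (e j)) (\<Sum>k\<le>n. scl (v (p k)) (u i k)))" for j
        unfolding rhs[OF v] dual.slice_sum dual.slice_tens ..
      have "?L \<in> tensor_space (dual V) A"
        unfolding coact_dual[OF gd[OF v]] by (intro dual.combination_tensor_in dual_row_in)
      moreover have "?R \<in> tensor_space (dual V) A"
        unfolding rhs[OF v]
        by (intro fs.subspace_sum subspace_tensor_space tens_in gd basis_in row_in) simp_all
      ultimately have "?L = ?R \<longleftrightarrow> (\<forall>j\<le>n. dual.slice j ?L = dual.slice j ?R)"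
        using dual.tensor_eqI[OF subspace_alg] by metis
      also have "\<dots> \<longleftrightarrow> ?C"
        by (intro all_cong) (simp only: L R)
      finally show ?thesis .
    qed
    have at_basis: "(\<Sum>k\<le>n. scl (e m (p k)) (u i k)) = u i m" if "m \<le> n" for i m
    proof -
      have "(\<Sum>k\<le>n. scl (e m (p k)) (u i k)) = (\<Sum>k\<le>n. if k = m then u i k else 0)"
        using that by (intro sum.cong refl) (simp add: dual_basis)
      then show ?thesis using that by simp
    qed
    show ?thesis
    proof
      assume *: "\<forall>v\<in>V. coact (dual_comodule H M) (g v) = tlift (\<lambda>w h. tens (dual V) A (g w) h) (coact M v)"
      show "\<forall>k\<le>n. \<forall>j\<le>n. (\<Sum>i\<le>n. scl (g (e i) (e j)) (u i k)) = (\<Sum>i\<le>n. scl (g (e k) (e i)) (S (u i j)))"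
      proof (intro allI impI)
        fix k j assume k: "k \<le> n" and j: "j \<le> n"
        from * basis_in[OF k] have "\<forall>j\<le>n. (\<Sum>i\<le>n. scl (g (e k) (e i)) (S (u i j)))
            = (\<Sum>i\<le>n. scl (g (e i) (e j)) (\<Sum>m\<le>n. scl (e k (p m)) (u i m)))"
          using iff by blast
        then show "(\<Sum>i\<le>n. scl (g (e i) (e j)) (u i k)) = (\<Sum>i\<le>n. scl (g (e k) (e i)) (S (u i j)))"
          using j by (simp add: at_basis[OF k])
      qed
    next
      assume *: "\<forall>k\<le>n. \<forall>j\<le>n. (\<Sum>i\<le>n. scl (g (e i) (e j)) (u i k)) = (\<Sum>i\<le>n. scl (g (e k) (e i)) (S (u i j)))"
      show "\<forall>v\<in>V. coact (dual_comodule H M) (g v) = tlift (\<lambda>w h. tens (dual V) A (g w) h) (coact M v)"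
      proof
        fix v assume v: "v \<in> V"
        have gv: "g v x = (\<Sum>k\<le>n. v (p k) * g (e k) x)" for x
          by (rule form_on_expand[OF _ v]) (use lin in \<open>simp add: form_on_def linear_on_def scl_apply\<close>)
        have "(\<Sum>i\<le>n. scl (g v (e i)) (S (u i j)))
            = (\<Sum>i\<le>n. scl (g (e i) (e j)) (\<Sum>k\<le>n. scl (v (p k)) (u i k)))" if j: "j \<le> n" for j
        proof -
          have "(\<Sum>i\<le>n. scl (g v (e i)) (S (u i j)))
              = (\<Sum>i\<le>n. \<Sum>k\<le>n. scl (v (p k)) (scl (g (e k) (e i)) (S (u i j))))"
            unfolding gv by (simp add: fs.scale_sum_left)
          also have "\<dots> = (\<Sum>k\<le>n. scl (v (p k)) (\<Sum>i\<le>n. scl (g (e k) (e i)) (S (u i j))))"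
            unfolding fs.scale_sum_right by (rule sum.swap)
          also have "\<dots> = (\<Sum>k\<le>n. scl (v (p k)) (\<Sum>i\<le>n. scl (g (e i) (e j)) (u i k)))"
            using * j by (intro sum.cong refl) simp
          also have "\<dots> = (\<Sum>i\<le>n. scl (g (e i) (e j)) (\<Sum>k\<le>n. scl (v (p k)) (u i k)))"
            unfolding fs.scale_sum_right by (subst sum.swap) (simp add: mult.commute)
          finally show ?thesis .
        qed
        then show "coact (dual_comodule H M) (g v) = tlift (\<lambda>w h. tens (dual V) A (g w) h) (coact M v)"
          using iff[OF v] by blast
      qed
    qed
  qed
  then show ?thesis
    unfolding comodule_hom_def space_dual_comodule space_M by blast
qed

lemma transpose_copivotal:
  assumes "g ` V \<subseteq> dual V" "form_on A \<gamma>" "v \<in> V" "w \<in> V"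
  shows "transpose_on V g (copivotal_map \<gamma> M v) w
    = (\<Sum>i\<le>n. \<Sum>k\<le>n. v (p k) * (g w (e i) * \<gamma> (u i k)))"
proof -
  have gw: "g w \<in> dual V" using assms by blast
  \<comment> \<open>\<open>tens\<close> is set to zero on everything but bilinear forms, so
    bilinearity is checked before the tensor is evaluated.\<close>
  have B: "(\<lambda>w' h. g w w' * \<gamma> h) \<in> bilinear_forms V A"
    using gw assms(2) by (auto simp: bilinear_forms_def form_on_def dual_def algebra_simps)
  have \<gamma>: "\<gamma> (\<Sum>k\<le>n. scl (c k) (u i k)) = (\<Sum>k\<le>n. c k * \<gamma> (u i k))" if i: "i \<le> n" for c i
  proof -
    have "\<gamma> 0 = 0"
      using form_onD(2)[OF assms(2) fs.subspace_0[OF subspace_alg], of 0] by simp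
    then have "\<gamma> (\<Sum>k\<le>n. scl (c k) (u i k)) = (\<Sum>k\<le>n. \<gamma> (scl (c k) (u i k)))"
      using i by (intro sum_additive_on[of A \<gamma>])
        (simp_all add: form_onD[OF assms(2)] fs.subspace_0 fs.subspace_add fs.subspace_scale
          subspace_alg matrix_in)
    also have "\<dots> = (\<Sum>k\<le>n. c k * \<gamma> (u i k))"
      using i by (intro sum.cong refl) (simp add: form_onD[OF assms(2)] matrix_in)
    finally show ?thesis .
  qed
  have "transpose_on V g (copivotal_map \<gamma> M v) w = coact M v (\<lambda>w' h. g w w' * \<gamma> h)"
    using assms(4) gw by (simp add: transpose_on_def copivotal_map_def)
  also have "\<dots> = (\<Sum>i\<le>n. g w (e i) * \<gamma> (\<Sum>k\<le>n. scl (v (p k)) (u i k)))"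
    unfolding coact_M[OF assms(3)] by (simp add: sum_fun_apply tens_def B)
  also have "\<dots> = (\<Sum>i\<le>n. \<Sum>k\<le>n. v (p k) * (g w (e i) * \<gamma> (u i k)))"
    by (intro sum.cong refl) (simp add: \<gamma> sum_distrib_left mult.left_commute)
  finally show ?thesis .
qed

end

section \<open>The spin comodules\<close>

text \<open>The basis picked by \<open>SOME\<close> may differ from {b}, but comparing dimensions
  shows that it has a single element, whose coordinate under T is the scalar.\<close>

lemma trace_on_line:
  assumes "b \<noteq> 0" and scalar: "\<And>f. f \<in> ms.span {b} \<Longrightarrow> T f = mscl \<sigma> f"
  shows "trace_on (ms.span {b}) T = \<sigma>"
proof -
  define B where "B = (SOME B. ms.independent B \<and> ms.span B = ms.span {b})"
  have "ms.independent {b} \<and> ms.span {b} = ms.span {b}"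
    using assms(1) by simp
  then have "ms.independent B \<and> ms.span B = ms.span {b}"
    unfolding B_def by (rule someI)
  then have B: "ms.independent B" "ms.span B = ms.span {b}"
    by simp_all
  have "card B = ms.dim {b}"
    using ms.dim_eq_card[OF B(2,1)] by simp
  also have "\<dots> = card {b}"
    using assms(1) by (intro ms.dim_eq_card_independent) simp
  finally have "card B = 1" by simp
  then obtain c where c: "B = {c}" by (auto simp: card_1_singleton_iff)
  then have c_in: "c \<in> ms.span {b}"
    using B(2) ms.span_base[of c B] by simp
  have "ms.representation {c} (mscl \<sigma> c) c = \<sigma> * ms.representation {c} c c"
    using B(1) c ms.span_base[of c "{c}"] by (subst ms.representation_scale) auto
  also have "\<dots> = \<sigma>"
    using B(1) c by (subst ms.representation_basis) auto
  finally show ?thesis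
    unfolding trace_on_def B_def[symmetric] Let_def c by (simp add: scalar[OF c_in])
qed

lemma power_inj_not_root:
  fixes q :: "'k::field"
  assumes "q \<noteq> 0" "\<forall>n>0. q ^ n \<noteq> 1" "q ^ i = q ^ j"
  shows "i = j"
proof -
  have le: "i = j" if "i \<le> j" "q ^ i = q ^ j" for i j
  proof -
    have "q ^ j = q ^ i * q ^ (j - i)"
      using that(1) by (simp flip: power_add)
    then have "q ^ (j - i) = 1"
      using that(2) assms(1) by simp
    then show ?thesis
      using assms(2)[rule_format, of "j - i"] that(1) by (cases "j - i") auto
  qed
  show ?thesis
    using le[of i j] le[of j i] assms(3) by (cases "i \<le> j") auto
qed

text \<open>Reordering a^s b^i costs the unit q^(s i), so both families span the same space. The
  spin index i corresponds to the exponent l + i of b.\<close>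

lemma X_space_eq:
  fixes q :: "'k::field" and l :: rat
  assumes "q \<noteq> 0" and N: "2 * l = of_nat N"
  shows "X_space q l = fs.span ((\<lambda>i. cls q (mon N i)) ` {..N})"
proof -
  let ?f = "\<lambda>i. cls q (va ^ nat \<lfloor>l - i\<rfloor> * vb ^ nat \<lfloor>l + i\<rfloor>)"
  let ?g = "\<lambda>i. cls q (va ^ (N - i) * vb ^ i)"
  have "spin_index l = (\<lambda>j. - l + of_nat j) ` {..N}"
  proof -
    have "- l + of_nat j \<le> l \<longleftrightarrow> j \<le> N" for j
    proof -
      have "- l + of_nat j \<le> l \<longleftrightarrow> (of_nat j :: rat) \<le> 2 * l" by auto
      then show ?thesis by (simp add: N)
    qed
    then show ?thesis by (auto simp: spin_index_def)
  qed
  then have "?f ` spin_index l = (\<lambda>j. ?f (- l + of_nat j)) ` {..N}"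
    by (simp add: image_image)
  also have "\<dots> = ?g ` {..N}"
  proof (intro image_cong refl)
    fix j assume "j \<in> {..N}"
    then have "l - (- l + of_nat j) = of_nat (N - j)"
      using N by (simp add: of_nat_diff)
    then have "nat \<lfloor>l - (- l + of_nat j)\<rfloor> = N - j" by (simp only: floor_of_nat nat_int)
    moreover have "nat \<lfloor>l + (- l + of_nat j)\<rfloor> = j" by simp
    ultimately show "?f (- l + of_nat j) = ?g j" by simp
  qed
  finally have X: "X_space q l = fs.span (?g ` {..N})"
    by (simp add: X_space_def)
  have "cls q (va ^ s * vb ^ i) = cls q (fscl (q ^ (s * i)) (vb ^ i * va ^ s))" for s i
  proof (induction s)
    case (Suc s)
    have "cls q (va * (va ^ s * vb ^ i)) = cls q (va * fscl (q ^ (s * i)) (vb ^ i * va ^ s))"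
      by (intro cls_mult_cong refl Suc)
    also have "\<dots> = scl (q ^ (s * i)) (cls q (va * (vb ^ i * va ^ s)))"
      by (simp add: fscl_mult_right cls_scl)
    also have "\<dots> = cls q (fscl (q ^ (Suc s * i)) (vb ^ i * va ^ Suc s))"
      by (simp add: cls_va_vb_power cls_scl power_add mult.commute)
    finally show ?case by (simp add: mult.assoc)
  qed simp
  then have g: "?g i = scl (q ^ ((N - i) * i)) (cls q (mon N i))" for i
    by (simp add: mon_def cls_scl)
  have "fs.span (?g ` {..N}) \<subseteq> fs.span ((\<lambda>i. cls q (mon N i)) ` {..N})"
    unfolding g
    by (intro fs.span_minimal image_subsetI fs.span_scale fs.span_base imageI fs.subspace_span)
  moreover have "fs.span ((\<lambda>i. cls q (mon N i)) ` {..N}) \<subseteq> fs.span (?g ` {..N})"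
  proof (rule fs.span_minimal)
    show "(\<lambda>i. cls q (mon N i)) ` {..N} \<subseteq> fs.span (?g ` {..N})"
    proof (rule image_subsetI)
      fix i assume "i \<in> {..N}"
      then have "scl (inverse (q ^ ((N - i) * i))) (?g i) \<in> fs.span (?g ` {..N})"
        by (intro fs.span_scale fs.span_base) simp
      then show "cls q (mon N i) \<in> fs.span (?g ` {..N})"
        using assms(1) by (simp only: g fs.scale_scale) simp
    qed
  qed simp
  ultimately show ?thesis using X by blast
qed

lemma X_coordinates:
  fixes q :: "'k::field" and l :: rat
  assumes "q \<noteq> 0" "2 * l = of_nat N"
  shows "coordinates (X_space q l) N (\<lambda>i. cls q (mon N i)) (phi q)"
proof
  show "X_space q l = fs.span ((\<lambda>i. cls q (mon N i)) ` {..N})"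
    by (rule X_space_eq[OF assms])
  show "cls q (mon N j) (phi q i) = (if i = j then 1 else 0)" if "i \<le> N" "j \<le> N" for i j
    by (simp add: cls_def phi_annihilator assms mon_def phi_monomial)
qed

lemma X_space_subset:
  fixes q :: "'k::field" and l :: rat
  shows "X_space q l \<subseteq> Oq_carrier q"
  unfolding X_space_def
  by (rule fs.span_minimal) (auto simp: subspace_Oq_carrier)

lemma Oq_antipode_linear:
  fixes q :: "'k::field"
  assumes "q \<noteq> 0"
  shows "linear_on (Oq_carrier q) (Oq_antipode q)"
proof -
  have S: "Oq_antipode q (cls q x) = cls q (anti q x)" for x
    by (simp add: Oq_antipode_cls[OF assms] anti_def)
  show ?thesis
    by (auto simp: linear_on_def Oq_carrier_def S simp flip: cls_add cls_scl)
qed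

lemma X_matrix_comodule:
  fixes q :: "'k::field" and l :: rat
  assumes q: "q \<noteq> 0" and N: "2 * l = of_nat N"
  shows "matrix_comodule (X_space q l) N (\<lambda>i. cls q (mon N i)) (phi q) (Oq_SL2 q) (X_comodule q l)
    (\<lambda>i j. cls q (umat q N i j))"
proof -
  interpret coordinates "X_space q l" N "\<lambda>i. cls q (mon N i)" "phi q"
    by (rule X_coordinates[OF assms])
  have S: "Oq_antipode q (cls q x) = cls q (anti q x)" for x
    by (simp add: Oq_antipode_cls[OF q] anti_def)
  have alg: "alg (Oq_SL2 q) = Oq_carrier q" by (simp add: Oq_SL2_def)
  show ?thesis
  proof
    show "fs.subspace (alg (Oq_SL2 q))" by (simp add: alg subspace_Oq_carrier)
    show "space (X_comodule q l) = X_space q l"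
      by (simp add: X_comodule_def coideal_comodule_def)
    show "cls q (umat q N i j) \<in> alg (Oq_SL2 q)" for i j by (simp add: alg)
    show "linear_on (alg (Oq_SL2 q)) (antipode (Oq_SL2 q))"
      unfolding alg using Oq_antipode_linear[OF q] by (simp add: Oq_SL2_def)
    show "antipode (Oq_SL2 q) h \<in> alg (Oq_SL2 q)" if "h \<in> alg (Oq_SL2 q)" for h
      using that by (auto simp: Oq_SL2_def Oq_carrier_def S)
  next
    fix v assume v: "v \<in> X_space q l"
    let ?one = "otens q (cls q 1) (cls q 1)"
    have one: "?one \<in> OT q" by (simp add: tens_in)
    let ?h = "\<lambda>i. \<Sum>j\<le>N. scl (v (phi q j)) (cls q (umat q N i j))"
    have h: "?h i \<in> Oq_carrier q" for i
      by (intro fs.subspace_sum fs.subspace_scale subspace_Oq_carrier cls_in)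
    \<comment> \<open>Expanding v in monomials lifts it to the free algebra, where the action
      computes its coproduct.\<close>
    have "v = (\<Sum>j\<le>N. scl (v (phi q j)) (cls q (mon N j)))" by (rule expand[OF v])
    also have "\<dots> = cls q (\<Sum>j\<le>N. fscl (v (phi q j)) (mon N j))"
      by (simp add: cls_sum cls_scl)
    finally have "Oq_comult q v = cm.act q (\<Sum>j\<le>N. fscl (v (phi q j)) (mon N j)) ?one"
      using Oq_comult_cls[OF q] by metis
    also have "\<dots> = (\<Sum>j\<le>N. scl (v (phi q j)) (cm.act q (mon N j) ?one))"
      by (simp add: cm.act_sum cm.act_fscl[OF one])
    also have "\<dots> = (\<Sum>j\<le>N. scl (v (phi q j)) (\<Sum>i\<le>N. otens q (cls q (mon N i)) (cls q (umat q N i j))))"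
    proof (intro sum.cong refl)
      fix j assume "j \<in> {..N}"
      then have "cm.act q (mon N j) ?one = (\<Sum>i\<le>N. otens q (cls q (mon N i)) (cls q (umat q N i j)))"
        using cm_act_mon[of q j "N - j"] by (simp add: mon_def[of N j] umat_def)
      then show "scl (v (phi q j)) (cm.act q (mon N j) ?one)
          = scl (v (phi q j)) (\<Sum>i\<le>N. otens q (cls q (mon N i)) (cls q (umat q N i j)))"
        by (rule arg_cong)
    qed
    also have "\<dots> = (\<Sum>i\<le>N. \<Sum>j\<le>N. otens q (cls q (mon N i)) (scl (v (phi q j)) (cls q (umat q N i j))))"
      unfolding fs.scale_sum_right by (subst sum.swap) (simp add: tens_scl_right)
    also have "\<dots> = (\<Sum>i\<le>N. otens q (cls q (mon N i)) (?h i))"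
      by (intro sum.cong refl tens_sum_right[symmetric] subspace_Oq_carrier
          fs.subspace_scale cls_in)
    finally have "comult (Oq_SL2 q) v
        = (\<Sum>i\<le>N. tens (alg (Oq_SL2 q)) (alg (Oq_SL2 q)) (cls q (mon N i)) (?h i))"
      by (simp add: Oq_SL2_def)
    then show "coact (X_comodule q l) v = (\<Sum>i\<le>N. tens (X_space q l) (alg (Oq_SL2 q)) (cls q (mon N i)) (?h i))"
      unfolding X_comodule_def
      by (intro coideal_coact[OF coordinates_axioms])
        (use h in \<open>simp_all add: alg subspace_Oq_carrier X_space_subset\<close>)
  qed
qed

lemma Oq_gamma_form:
  fixes q :: "'k::field"
  assumes "q \<noteq> 0"
  shows "form_on (Oq_carrier q) (Oq_gamma q)"
proof -
  have "Oq_gamma q (cls q x + cls q y) = Oq_gamma q (cls q x) + Oq_gamma q (cls q y)"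
    "Oq_gamma q (scl c (cls q x)) = c * Oq_gamma q (cls q x)" for x y c
    by (simp_all only: Oq_gamma_cls[OF assms] gamma_free_simps flip: cls_add cls_scl)
  then show ?thesis by (auto simp: form_on_def Oq_carrier_def)
qed

section \<open>Comodule maps from X_l to its dual, and the indicator\<close>

context
  fixes q :: "'k::field" and l :: rat and N :: nat
  assumes q: "q \<noteq> 0" "\<forall>n>0. q ^ n \<noteq> 1" and N: "2 * l = of_nat N"
begin

interpretation matrix_comodule "X_space q l" N "\<lambda>i. cls q (mon N i)" "phi q" "Oq_SL2 q"
  "X_comodule q l" "\<lambda>i j. cls q (umat q N i j)"
  by (rule X_matrix_comodule[OF q(1) N])

abbreviation "E \<equiv> comodule_hom (Oq_SL2 q) (X_comodule q l) (dual_comodule (Oq_SL2 q) (X_comodule q l))"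
abbreviation "eb i \<equiv> cls q (mon N i)"

lemma antipode_eq: "antipode (Oq_SL2 q) (cls q x) = cls q (anti q x)"
  by (simp add: Oq_SL2_def Oq_antipode_cls[OF q(1)] anti_def)

lemma gamma_umat:
  "Oq_gamma q (cls q (umat q N i j)) = (if i = j then q ^ j * inverse q ^ (N - j) else 0)"
  "Oq_gamma q (cls q (anti q (umat q N i j))) = (if i = j then inverse q ^ j * q ^ (N - j) else 0)"
  by (simp_all add: Oq_gamma_cls[OF q(1)] umat_def gamma_free_col gamma_free_anti_col q(1))

lemma gamma_sum:
  "Oq_gamma q (\<Sum>i\<le>N. scl (c i) (cls q (f i))) = (\<Sum>i\<le>N. c i * Oq_gamma q (cls q (f i)))"
proof -
  have "(\<Sum>i\<le>N. scl (c i) (cls q (f i))) = cls q (\<Sum>i\<le>N. fscl (c i) (f i))"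
    by (simp add: cls_sum cls_scl)
  moreover have "gamma_free q (\<Sum>i\<le>N. fscl (c i) (f i)) = (\<Sum>i\<le>N. gamma_free q (fscl (c i) (f i)))"
    by (rule sum_additive_on[of UNIV "gamma_free q"]) simp_all
  ultimately show ?thesis by (simp add: Oq_gamma_cls[OF q(1)])
qed

lemma hom_matrix_antidiagonal:
  assumes g: "g \<in> E" and kj: "k \<le> N" "j \<le> N" "k + j \<noteq> N"
  shows "g (eb k) (eb j) = 0"
proof (rule ccontr)
  assume nz: "g (eb k) (eb j) \<noteq> 0"
  have "(\<Sum>i\<le>N. scl (g (eb i) (eb j)) (cls q (umat q N i k)))
      = (\<Sum>i\<le>N. scl (g (eb k) (eb i)) (cls q (anti q (umat q N i j))))"
    using g kj unfolding comodule_hom_dual_iff antipode_eq by blast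
  then have "Oq_gamma q (\<Sum>i\<le>N. scl (g (eb i) (eb j)) (cls q (umat q N i k)))
      = Oq_gamma q (\<Sum>i\<le>N. scl (g (eb k) (eb i)) (cls q (anti q (umat q N i j))))"
    by (rule arg_cong)
  \<comment> \<open>Off-diagonal entries die under \<gamma>; the diagonal ones give the weight
    q^(2k-N) on the left and q^(N-2j) on the right.\<close>
  then have "g (eb k) (eb j) * (q ^ k * inverse q ^ (N - k))
      = g (eb k) (eb j) * (inverse q ^ j * q ^ (N - j))"
    unfolding gamma_sum gamma_umat using kj by (simp add: if_distrib cong: if_cong)
  then have "q ^ k * inverse q ^ (N - k) = inverse q ^ j * q ^ (N - j)"
    using nz by simp
  then have "q ^ (k + j) = q ^ ((N - k) + (N - j))"
    using q(1) by (simp add: power_add power_inverse field_simps)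
  then have "k + j = (N - k) + (N - j)"
    by (rule power_inj_not_root[OF q])
  then show False using kj by linarith
qed

text \<open>In the equation at (k, N) antidiagonality leaves one term on each side, and
  \<open>antipode_umat_zcoef\<close> makes the right one a multiple of the same entry u_0k.
  Evaluation at \<open>phi q k\<close> gives 1 on that entry, so the coefficients agree.\<close>

lemma hom_matrix_ratio:
  assumes g: "g \<in> E" and k: "k \<le> N"
  shows "g (eb k) (eb (N - k)) * zcoef q N (N - k) = g (eb 0) (eb N) * zcoef q N N"
proof -
  have sum1: "(\<Sum>i\<le>N. scl (g (eb i) (eb N)) (cls q (umat q N i k)))
      = scl (g (eb 0) (eb N)) (cls q (umat q N 0 k))"
  proof -
    have "(\<Sum>i\<le>N. scl (g (eb i) (eb N)) (cls q (umat q N i k)))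
        = (\<Sum>i\<le>N. if i = 0 then scl (g (eb 0) (eb N)) (cls q (umat q N 0 k)) else 0)"
      by (intro sum.cong refl) (simp add: hom_matrix_antidiagonal[OF g])
    then show ?thesis by simp
  qed
  have sum2: "(\<Sum>i\<le>N. scl (g (eb k) (eb i)) (cls q (anti q (umat q N i N))))
      = scl (g (eb k) (eb (N - k))) (cls q (anti q (umat q N (N - k) N)))"
  proof -
    have "(\<Sum>i\<le>N. scl (g (eb k) (eb i)) (cls q (anti q (umat q N i N))))
        = (\<Sum>i\<le>N. if i = N - k then scl (g (eb k) (eb (N - k))) (cls q (anti q (umat q N (N - k) N))) else 0)"
      using k by (intro sum.cong refl) (auto simp: hom_matrix_antidiagonal[OF g])
    then show ?thesis by simp
  qed
  have "(\<Sum>i\<le>N. scl (g (eb i) (eb N)) (cls q (umat q N i k)))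
      = (\<Sum>i\<le>N. scl (g (eb k) (eb i)) (cls q (anti q (umat q N i N))))"
    using g k unfolding comodule_hom_dual_iff antipode_eq by blast
  then have eq: "scl (g (eb 0) (eb N)) (cls q (umat q N 0 k))
      = scl (g (eb k) (eb (N - k))) (cls q (anti q (umat q N (N - k) N)))"
    unfolding sum1 sum2 .
  have "scl (g (eb 0) (eb N) * zcoef q N N) (cls q (umat q N 0 k))
      = scl (zcoef q N N) (scl (g (eb 0) (eb N)) (cls q (umat q N 0 k)))"
    by (simp add: mult.commute)
  also have "\<dots> = scl (g (eb k) (eb (N - k))) (scl (zcoef q N N) (cls q (anti q (umat q N (N - k) N))))"
    unfolding eq by (simp add: mult.commute)
  also have "\<dots> = scl (g (eb k) (eb (N - k)) * zcoef q N (N - k)) (cls q (umat q N 0 k))"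
    using antipode_umat_zcoef[OF q order_refl k] by simp
  finally have "scl (g (eb 0) (eb N) * zcoef q N N) (cls q (umat q N 0 k)) (phi q k)
      = scl (g (eb k) (eb (N - k)) * zcoef q N (N - k)) (cls q (umat q N 0 k)) (phi q k)"
    by (rule fun_cong)
  moreover have "cls q (umat q N 0 k) (phi q k) = 1"
    by (simp add: umat_def col_at_0 cls_def phi_annihilator q(1) phi_monomial)
  ultimately show ?thesis by (simp add: scl_apply)
qed

lemma hom_apply:
  assumes g: "g \<in> E" and vw: "v \<in> X_space q l" "w \<in> X_space q l"
  shows "g v w = (\<Sum>k\<le>N. v (phi q k) * (w (phi q (N - k)) * g (eb k) (eb (N - k))))"
proof -
  have "g v w = (\<Sum>k\<le>N. v (phi q k) * (\<Sum>j\<le>N. w (phi q j) * g (eb k) (eb j)))"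
    using g vw unfolding comodule_hom_dual_iff by (intro to_dual_expand) blast+
  also have "\<dots> = (\<Sum>k\<le>N. v (phi q k) * (w (phi q (N - k)) * g (eb k) (eb (N - k))))"
  proof (intro sum.cong refl)
    fix k assume k: "k \<in> {..N}"
    have "(\<Sum>j\<le>N. w (phi q j) * g (eb k) (eb j))
        = (\<Sum>j\<le>N. if j = N - k then w (phi q (N - k)) * g (eb k) (eb (N - k)) else 0)"
      using k by (intro sum.cong refl) (auto simp: hom_matrix_antidiagonal[OF g])
    then show "v (phi q k) * (\<Sum>j\<le>N. w (phi q j) * g (eb k) (eb j))
        = v (phi q k) * (w (phi q (N - k)) * g (eb k) (eb (N - k)))"
      by simp
  qed
  finally show ?thesis .
qed

text \<open>The form with matrix z^-1: inverting the antidiagonal matrix z moves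
  \<open>zcoef q N (N - k)\<close> from (N - k, k) to (k, N - k) and inverts it. The zero values off
  X_l are the normalisation in \<open>comodule_hom\<close> and \<open>dual\<close>.\<close>

definition inv_form :: "('k Oq_index \<Rightarrow> 'k) \<Rightarrow> ('k Oq_index \<Rightarrow> 'k) \<Rightarrow> 'k"
  where "inv_form v w = (if v \<in> X_space q l \<and> w \<in> X_space q l
    then \<Sum>k\<le>N. v (phi q k) * (w (phi q (N - k)) * inverse (zcoef q N (N - k))) else 0)"

lemma inv_form_basis:
  assumes "k \<le> N" "j \<le> N"
  shows "inv_form (eb k) (eb j) = (if k + j = N then inverse (zcoef q N j) else 0)"
proof -
  have "inv_form (eb k) (eb j)
      = (\<Sum>i\<le>N. eb k (phi q i) * (eb j (phi q (N - i)) * inverse (zcoef q N (N - i))))"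
    by (simp add: inv_form_def basis_in assms)
  also have "\<dots> = (\<Sum>i\<le>N. if i = k then (if k + j = N then inverse (zcoef q N j) else 0) else 0)"
    using assms by (intro sum.cong refl) (auto simp: dual_basis)
  finally have "inv_form (eb k) (eb j)
      = (\<Sum>i\<le>N. if i = k then (if k + j = N then inverse (zcoef q N j) else 0) else 0)" .
  then show ?thesis using assms by simp
qed

lemma inv_form_hom: "inv_form \<in> E"
  unfolding comodule_hom_dual_iff
proof (intro conjI allI impI)
  note sub = fs.subspace_add[OF subspace_V] fs.subspace_scale[OF subspace_V]
  show "linear_on (X_space q l) inv_form"
    unfolding linear_on_def
    by (auto simp: fun_eq_iff inv_form_def sub scl_apply distrib_right sum.distrib sum_distrib_left mult.assoc)
  show "inv_form ` X_space q l \<subseteq> dual (X_space q l)"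
    by (auto simp: dual_def form_on_def inv_form_def sub scl_apply distrib_right distrib_left
        sum.distrib sum_distrib_left mult_ac)
  show "inv_form v = 0" if "v \<notin> X_space q l" for v
    using that by (simp add: inv_form_def fun_eq_iff)
  fix k j assume kj: "k \<le> N" "j \<le> N"
  have "(\<Sum>i\<le>N. scl (inv_form (eb i) (eb j)) (cls q (umat q N i k)))
      = (\<Sum>i\<le>N. if i = N - j then scl (inverse (zcoef q N j)) (cls q (umat q N (N - j) k)) else 0)"
    using kj by (intro sum.cong refl) (auto simp: inv_form_basis)
  also have "\<dots> = scl (inverse (zcoef q N j)) (cls q (umat q N (N - j) k))"
    by simp
  \<comment> \<open>One term survives on each side, i = N - j and i = N - k; inserting
    \<open>zcoef q N (N - k)\<close> brings the left one into the form of
    \<open>antipode_umat_zcoef\<close>.\<close>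
  also have "\<dots> = scl (inverse (zcoef q N j) * inverse (zcoef q N (N - k)))
      (scl (zcoef q N (N - k)) (cls q (umat q N (N - j) k)))"
    using zcoef_nonzero[OF q, of "N - k" N] by simp
  also have "\<dots> = scl (inverse (zcoef q N j) * inverse (zcoef q N (N - k)))
      (scl (zcoef q N j) (cls q (anti q (umat q N (N - k) j))))"
    using antipode_umat_zcoef[OF q kj(2,1)] by simp
  also have "\<dots> = scl (inverse (zcoef q N (N - k))) (cls q (anti q (umat q N (N - k) j)))"
    using zcoef_nonzero[OF q kj(2)] by simp
  also have "\<dots> = (\<Sum>i\<le>N. if i = N - k then scl (inverse (zcoef q N (N - k))) (cls q (anti q (umat q N (N - k) j))) else 0)"
    by simp
  also have "\<dots> = (\<Sum>i\<le>N. scl (inv_form (eb k) (eb i)) (cls q (anti q (umat q N i j))))"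
    using kj by (intro sum.cong refl) (auto simp: inv_form_basis)
  finally show "(\<Sum>i\<le>N. scl (inv_form (eb i) (eb j)) (cls q (umat q N i k)))
      = (\<Sum>i\<le>N. scl (inv_form (eb k) (eb i)) (antipode (Oq_SL2 q) (cls q (umat q N i j))))"
    unfolding antipode_eq .
qed

lemma hom_outside:
  assumes "g \<in> E" "v \<notin> X_space q l \<or> w \<notin> X_space q l"
  shows "g v w = 0"
proof (cases "v \<in> X_space q l")
  case True
  then have "g v \<in> dual (X_space q l)"
    using assms(1) unfolding comodule_hom_dual_iff by blast
  then show ?thesis using True assms(2) by (simp add: dual_def)
next
  case False
  then show ?thesis using assms(1) unfolding comodule_hom_dual_iff by simp
qed

lemma hom_mscl:
  assumes "g \<in> E"
  shows "mscl c g \<in> E"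
proof -
  have g: "linear_on (X_space q l) g" "g ` X_space q l \<subseteq> dual (X_space q l)"
      "\<And>v. v \<notin> X_space q l \<Longrightarrow> g v = 0"
      "\<And>k j. k \<le> N \<Longrightarrow> j \<le> N \<Longrightarrow> (\<Sum>i\<le>N. scl (g (eb i) (eb j)) (cls q (umat q N i k)))
        = (\<Sum>i\<le>N. scl (g (eb k) (eb i)) (antipode (Oq_SL2 q) (cls q (umat q N i j))))"
    using assms unfolding comodule_hom_dual_iff by blast+
  show ?thesis
    unfolding comodule_hom_dual_iff
  proof (intro conjI allI impI)
    show "linear_on (X_space q l) (mscl c g)"
      using g(1) by (simp add: linear_on_def mscl_def fs.scale_right_distrib mult.commute)
    show "mscl c g ` X_space q l \<subseteq> dual (X_space q l)"
      using g(2) fs.subspace_scale[OF subspace_dual] by (auto simp: mscl_def)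
    show "mscl c g v = 0" if "v \<notin> X_space q l" for v
      by (simp add: mscl_def g(3)[OF that])
    show "(\<Sum>i\<le>N. scl (mscl c g (eb i) (eb j)) (cls q (umat q N i k)))
        = (\<Sum>i\<le>N. scl (mscl c g (eb k) (eb i)) (antipode (Oq_SL2 q) (cls q (umat q N i j))))"
      if "k \<le> N" "j \<le> N" for k j
      using arg_cong[OF g(4)[OF that], of "scl c"]
      by (simp add: mscl_def scl_apply fs.scale_sum_right)
  qed
qed

lemma hom_eq_span: "E = ms.span {inv_form}"
proof
  show "E \<subseteq> ms.span {inv_form}"
  proof
    fix g assume g: "g \<in> E"
    \<comment> \<open>The corner entry fixes the scalar, and \<open>hom_matrix_ratio\<close>
      propagates it along the antidiagonal.\<close>
    define c where "c = g (eb 0) (eb N) * zcoef q N N"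
    have gk: "g (eb k) (eb (N - k)) = c * inverse (zcoef q N (N - k))" if "k \<le> N" for k
      using hom_matrix_ratio[OF g that] zcoef_nonzero[OF q, of "N - k" N]
      by (simp add: c_def field_simps)
    have "g = mscl c inv_form"
    proof (intro ext)
      fix v w
      show "g v w = mscl c inv_form v w"
      proof (cases "v \<in> X_space q l \<and> w \<in> X_space q l")
        case True
        then show ?thesis
          by (simp add: hom_apply[OF g] mscl_def scl_apply inv_form_def gk sum_distrib_left mult_ac)
      next
        case False
        then show ?thesis
          using hom_outside[OF g, of v w] by (auto simp: mscl_def scl_apply inv_form_def)
      qed
    qed
    then show "g \<in> ms.span {inv_form}"
      by (auto intro: ms.span_scale ms.span_base)
  qed
  show "ms.span {inv_form} \<subseteq> E"
  proof
    fix g assume "g \<in> ms.span {inv_form}"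
    then obtain c where c: "g = mscl c inv_form"
      by (auto simp: ms.span_singleton)
    from inv_form_hom show "g \<in> E"
      unfolding c by (rule hom_mscl)
  qed
qed

lemma inv_form_nonzero: "inv_form \<noteq> 0"
proof
  assume "inv_form = 0"
  then have "inv_form (eb 0) (eb N) = 0" by simp
  then show False
    using zcoef_nonzero[OF q order_refl] by (simp add: inv_form_basis)
qed

text \<open>Since \<gamma>(u) is diagonal, the entry at (k, N - k) becomes the transposed entry
  times q^(2k-N); by \<open>zcoef_sym\<close> that weight is the ratio of the two entries up to
  sign.\<close>

lemma twisted_transpose_hom:
  assumes g: "g \<in> E"
  shows "(\<lambda>v. if v \<in> X_space q l then transpose_on (X_space q l) g
      (copivotal_map (Oq_gamma q) (X_comodule q l) v) else 0) = mscl ((- 1) ^ N) g"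
proof (intro ext)
  fix v w
  show "(if v \<in> X_space q l then transpose_on (X_space q l) g
      (copivotal_map (Oq_gamma q) (X_comodule q l) v) else 0) w = mscl ((- 1) ^ N) g v w"
  proof (cases "v \<in> X_space q l \<and> w \<in> X_space q l")
    case True
    then have v: "v \<in> X_space q l" and w: "w \<in> X_space q l" by simp_all
    have sub: "g ` X_space q l \<subseteq> dual (X_space q l)"
      using g unfolding comodule_hom_dual_iff by blast
    have form: "form_on (alg (Oq_SL2 q)) (Oq_gamma q)"
      using Oq_gamma_form[OF q(1)] by (simp add: Oq_SL2_def)
    define c where "c = g (eb 0) (eb N) * zcoef q N N"
    have gk: "g (eb k) (eb (N - k)) = c / zcoef q N (N - k)" if "k \<le> N" for k
      using hom_matrix_ratio[OF g that] zcoef_nonzero[OF q, of "N - k" N]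
      by (simp add: c_def field_simps)
    have gwe: "g w (eb i) = w (phi q (N - i)) * (c / zcoef q N i)" if i: "i \<le> N" for i
    proof -
      have "g w (eb i) = (\<Sum>k\<le>N. w (phi q k) * (eb i (phi q (N - k)) * g (eb k) (eb (N - k))))"
        by (rule hom_apply[OF g w basis_in[OF i]])
      also have "\<dots> = (\<Sum>k\<le>N. if k = N - i then w (phi q (N - i)) * (c / zcoef q N i) else 0)"
        using i by (intro sum.cong refl) (auto simp: dual_basis gk)
      finally show ?thesis by simp
    qed
    have sign: "c / zcoef q N k * (q ^ k * inverse q ^ (N - k)) = (- 1) ^ N * (c / zcoef q N (N - k))"
      if k: "k \<le> N" for k
    proof -
      \<comment> \<open>The extra factor q^(N-k) keeps all exponents natural, so that
        \<open>zcoef_sym\<close> applies; it is cancelled afterwards.\<close>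
      have "q ^ (N - k) * (q ^ k * zcoef q N (N - k)) = q ^ N * zcoef q N (N - k)"
        using k by (simp flip: mult.assoc power_add)
      also have "\<dots> = q ^ (N - k) * ((- 1) ^ N * q ^ (N - k) * zcoef q N k)"
        unfolding zcoef_sym[OF q(1) k] by (simp add: mult_2_right power_add mult_ac)
      finally have "q ^ k * zcoef q N (N - k) = (- 1) ^ N * q ^ (N - k) * zcoef q N k"
        using q(1) by simp
      then show ?thesis
        using q(1) zcoef_nonzero[OF q k] zcoef_nonzero[OF q, of "N - k" N]
        by (simp add: power_inverse field_simps)
    qed
    have "transpose_on (X_space q l) g (copivotal_map (Oq_gamma q) (X_comodule q l) v) w
        = (\<Sum>i\<le>N. \<Sum>k\<le>N. v (phi q k) * (g w (eb i) * Oq_gamma q (cls q (umat q N i k))))"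
      by (rule transpose_copivotal[OF sub form v w])
    also have "\<dots> = (\<Sum>k\<le>N. v (phi q k) * (g w (eb k) * (q ^ k * inverse q ^ (N - k))))"
    proof (intro sum.cong refl)
      fix i assume i: "i \<in> {..N}"
      have "(\<Sum>k\<le>N. v (phi q k) * (g w (eb i) * Oq_gamma q (cls q (umat q N i k))))
          = (\<Sum>k\<le>N. if k = i then v (phi q i) * (g w (eb i) * (q ^ i * inverse q ^ (N - i))) else 0)"
        by (intro sum.cong refl) (simp add: gamma_umat)
      then show "(\<Sum>k\<le>N. v (phi q k) * (g w (eb i) * Oq_gamma q (cls q (umat q N i k))))
          = v (phi q i) * (g w (eb i) * (q ^ i * inverse q ^ (N - i)))"
        using i by simp
    qed
    also have "\<dots> = (\<Sum>k\<le>N. (- 1) ^ N * (v (phi q k) * (w (phi q (N - k)) * g (eb k) (eb (N - k)))))"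
    proof (intro sum.cong refl)
      fix k assume "k \<in> {..N}"
      then have k: "k \<le> N" by simp
      have "g w (eb k) * (q ^ k * inverse q ^ (N - k))
          = w (phi q (N - k)) * (c / zcoef q N k * (q ^ k * inverse q ^ (N - k)))"
        unfolding gwe[OF k] by (simp only: mult.assoc)
      also have "\<dots> = (- 1) ^ N * (w (phi q (N - k)) * g (eb k) (eb (N - k)))"
        unfolding sign[OF k] gk[OF k] by (rule mult.left_commute)
      finally show "v (phi q k) * (g w (eb k) * (q ^ k * inverse q ^ (N - k)))
          = (- 1) ^ N * (v (phi q k) * (w (phi q (N - k)) * g (eb k) (eb (N - k))))"
        by (simp only: mult.left_commute)
    qed
    also have "\<dots> = mscl ((- 1) ^ N) g v w"
      by (simp add: hom_apply[OF g v w] mscl_def scl_apply sum_distrib_left)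
    finally show ?thesis using v by simp
  next
    case False
    then show ?thesis
      using hom_outside[OF g, of v w] by (auto simp: mscl_def scl_apply transpose_on_def)
  qed
qed

lemma fs_indicator_X: "fs_indicator (Oq_SL2 q) (Oq_gamma q) (X_comodule q l) = (- 1) ^ N"
  unfolding fs_indicator_def hom_eq_span space_M
  by (rule trace_on_line[OF inv_form_nonzero]) (rule twisted_transpose_hom, simp only: hom_eq_span)

end

theorem theorem5p1:
  fixes q :: "'k::{alg_closed_field, field_char_0}" and l :: rat
  assumes "q \<noteq> 0" and "\<forall>n>0. q ^ n \<noteq> 1"
    and "2 * l \<in> \<nat>"
  shows "fs_indicator (Oq_SL2 q) (Oq_gamma q) (X_comodule q l) = (- 1) ^ nat \<lfloor>2 * l\<rfloor>"
proof -
  obtain N where N: "2 * l = of_nat N"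
    using assms(3) by (auto simp: Nats_def)
  then have "nat \<lfloor>2 * l\<rfloor> = N" by simp
  then show ?thesis
    using fs_indicator_X[OF assms(1,2) N] by simp
qed

end
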